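(* Let $G$ be a locally compact, $\sigma$-compact abelian group and let $(X,G)$ be a minimal dynamical system. Then the dynamical systems $(X_{\mathcal{A}},G)$, $(\mathbb{T}_{\mathcal{E}_{top}(X,G)},G)$ and $(X_\sim,G)$ are canonically conjugate. In particular, they are all uniquely ergodic and minimal and have pure point spectrum.
   Context: A dynamical system $(X,G)$ is a compact Hausdorff space $X$ with a continuous action $(t,x)\mapsto t\cdot x$ of $G$; it is minimal if all orbits are dense. Two systems are conjugate if there is a $G$-equivariant homeomorphism between them. A continuous $f:X\to\mathbb{C}$, $f\neq0$, is a continuous eigenfunction with (continuous) eigenvalue $\chi\in\widehat{G}$ (the Pontryagin dual, with pairing $(\chi,t)$) if $f(t\cdot x)=(\chi,t)f(x)$ for all $t\in G$, $x\in X$. The continuous eigenvalues form a subgroup $\mathcal{E}_{top}(X,G)$ of $\widehat{G}$, which is given the discrete topology. The three systems are: (1) $\mathbb{T}_{\mathcal{E}_{top}(X,G)}$ is the compact dual group of the discrete group $\mathcal{E}_{top}(X,G)$, with action $(t\cdot x)(\chi)=(\chi,t)\,x(\chi)$. (2) $X_\sim:=X/\!\sim$ with the quotient topology, where $x\sim y$ iff $f(x)=f(y)$ for every continuous eigenfunction $f$; $G$ acts by $t\cdot[x]=[t\cdot x]$. (3) $\mathcal{A}$ is the closed (with respect to $\|\cdot\|_\infty$) subalgebra of $C(X)$ generated by the continuous eigenfunctions, a commutative $C^*$-algebra; $X_{\mathcal{A}}$ is its Gelfand spectrum (the compact space of nonzero multiplicative linear functionals on $\mathcal{A}$), with the $G$-action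 induced by the action of $G$ on $\mathcal{A}$, so that the Gelfand transform $\Gamma:\mathcal{A}\to C(X_{\mathcal{A}})$ satisfies $\Gamma(f(t\,\cdot))=(\Gamma f)(t\,\cdot)$. A system is uniquely ergodic if it has exactly one invariant Borel probability measure $m$; it has pure point spectrum if $L^2(X,m)$ is generated, as a closed subspace, by eigenfunctions (elements $f\in L^2$ with $f(t\,\cdot)=(\chi,t)f$ in $L^2$ for all $t$, for some $\chi\in\widehat G$). *)

theory Defs
  imports
    "HOL-Analysis.Analysis"
    "HOL-Probability.Probability_Measure"
    "HOL-Algebra.Group_Action"
begin

section \<open>Topological groups and Pontryagin duals\<close>

locale topological_comm_group = comm_group G
  for G :: "('g, 'm) monoid_scheme" (structure) and T :: "'g topology" +
  assumes topspace_eq_carrier: "topspace T = carrier G"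
    and continuous_mult: "continuous_map (prod_topology T T) T (\<lambda>(s, t). s \<otimes> t)"
    and continuous_inv: "continuous_map T T (\<lambda>t. inv t)"

definition sigma_compact_space :: "'a topology \<Rightarrow> bool" where
  "sigma_compact_space T \<longleftrightarrow>
     (\<exists>K :: nat \<Rightarrow> 'a set. (\<forall>n. compactin T (K n)) \<and> topspace T = (\<Union>n. K n))"

definition circle_group :: "complex monoid" where
  "circle_group = \<lparr>carrier = {z. cmod z = 1}, mult = (*), one = 1\<rparr>"

text \<open>Characters are extensional functions on the carrier (the value outside is
  \<^term>\<open>undefined\<close>), so that equality of characters is equality on the group.  The pairing
  of \<open>\<gamma>\<close> with \<open>t\<close> is the value \<open>\<gamma> t\<close>.\<close>

definition dual_group :: "('g, 'm) monoid_scheme \<Rightarrow> 'g topology \<Rightarrow> ('g \<Rightarrow> complex) monoid" where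
  "dual_group G T =
     \<lparr>carrier = {\<gamma> \<in> hom G circle_group \<inter> extensional (carrier G).
                    continuous_map T euclidean \<gamma>},
      mult = (\<lambda>\<gamma> \<delta>. \<lambda>t\<in>carrier G. \<gamma> t * \<delta> t),
      one = (\<lambda>t\<in>carrier G. 1)\<rparr>"

text \<open>The compact-open topology.  The choice \<open>K = {}\<close> shows that the whole dual is open.\<close>

definition dual_topology :: "('g, 'm) monoid_scheme \<Rightarrow> 'g topology \<Rightarrow> ('g \<Rightarrow> complex) topology" where
  "dual_topology G T =
     topology_generated_by
       {{\<gamma> \<in> carrier (dual_group G T). \<gamma> ` K \<subseteq> U} | K U. compactin T K \<and> open U}"

section \<open>Dynamical systems\<close>

text \<open>The locale \<^locale>\<open>group_action\<close> requires each \<open>act t\<close> to be an extensional bijection of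
  the space; this fixes the irrelevant values of \<open>act t\<close> outside \<^term>\<open>topspace X\<close>.\<close>

locale dynamical_system =
  topological_comm_group G T + group_action G "topspace X" act
  for G :: "('g, 'm) monoid_scheme" (structure) and T :: "'g topology"
    and X :: "'x topology" and act :: "'g \<Rightarrow> 'x \<Rightarrow> 'x" +
  assumes compact: "compact_space X"
    and Hausdorff: "Hausdorff_space X"
    and continuous_action: "continuous_map (prod_topology T X) X (\<lambda>(t, x). act t x)"

locale minimal_system = dynamical_system +
  assumes nonempty: "topspace X \<noteq> {}"
    and dense_orbits: "x \<in> topspace X \<Longrightarrow> X closure_of (orbit G act x) = topspace X"

definition conjugacy ::
  "('g, 'm) monoid_scheme \<Rightarrow> 'x topology \<Rightarrow> ('g \<Rightarrow> 'x \<Rightarrow> 'x) \<Rightarrow>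
     'y topology \<Rightarrow> ('g \<Rightarrow> 'y \<Rightarrow> 'y) \<Rightarrow> ('x \<Rightarrow> 'y) \<Rightarrow> bool" where
  "conjugacy G X actX Y actY h \<longleftrightarrow>
     homeomorphic_map X Y h \<and>
     (\<forall>t\<in>carrier G. \<forall>x\<in>topspace X. h (actX t x) = actY t (h x))"

definition borel_sets :: "'x topology \<Rightarrow> 'x set set" where
  "borel_sets X = sigma_sets (topspace X) {U. openin X U}"

definition invariant_probability ::
  "('g, 'm) monoid_scheme \<Rightarrow> 'x topology \<Rightarrow> ('g \<Rightarrow> 'x \<Rightarrow> 'x) \<Rightarrow> 'x measure \<Rightarrow> bool" where
  "invariant_probability G X act M \<longleftrightarrow>
     prob_space M \<and> space M = topspace X \<and> sets M = borel_sets X \<and>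
     (\<forall>t\<in>carrier G. \<forall>B\<in>sets M. emeasure M (act t -` B \<inter> space M) = emeasure M B)"

definition uniquely_ergodic ::
  "('g, 'm) monoid_scheme \<Rightarrow> 'x topology \<Rightarrow> ('g \<Rightarrow> 'x \<Rightarrow> 'x) \<Rightarrow> bool" where
  "uniquely_ergodic G X act \<longleftrightarrow> (\<exists>!M. invariant_probability G X act M)"

subsection \<open>Pure point spectrum\<close>

text \<open>Elements of \<open>L\<^sup>2\<close> are represented by square integrable functions; a set of such functions
  that is closed for the \<open>L\<^sup>2\<close> seminorm is automatically invariant under changes on null sets.\<close>

definition L2_functions :: "'x measure \<Rightarrow> ('x \<Rightarrow> complex) set" where
  "L2_functions M = {f \<in> borel_measurable M. integrable M (\<lambda>x. (cmod (f x))\<^sup>2)}"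

definition closed_L2_subspace :: "'x measure \<Rightarrow> ('x \<Rightarrow> complex) set \<Rightarrow> bool" where
  "closed_L2_subspace M V \<longleftrightarrow>
     V \<subseteq> L2_functions M \<and>
     (\<lambda>_. 0) \<in> V \<and>
     (\<forall>f\<in>V. \<forall>g\<in>V. (\<lambda>x. f x + g x) \<in> V) \<and>
     (\<forall>c. \<forall>f\<in>V. (\<lambda>x. c * f x) \<in> V) \<and>
     (\<forall>f\<in>L2_functions M.
        (\<forall>\<epsilon>>0. \<exists>g\<in>V. sqrt (\<integral>x. (cmod (f x - g x))\<^sup>2 \<partial>M) < \<epsilon>) \<longrightarrow> f \<in> V)"

definition L2_eigenfunctions ::
  "('g, 'm) monoid_scheme \<Rightarrow> 'g topology \<Rightarrow> ('g \<Rightarrow> 'x \<Rightarrow> 'x) \<Rightarrow> 'x measure \<Rightarrow> ('x \<Rightarrow> complex) set"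
  where
  "L2_eigenfunctions G T act M =
     {f \<in> L2_functions M. \<exists>\<gamma>\<in>carrier (dual_group G T).
        \<forall>t\<in>carrier G. AE x in M. f (act t x) = \<gamma> t * f x}"

definition pure_point_spectrum ::
  "('g, 'm) monoid_scheme \<Rightarrow> 'g topology \<Rightarrow> ('g \<Rightarrow> 'x \<Rightarrow> 'x) \<Rightarrow> 'x measure \<Rightarrow> bool" where
  "pure_point_spectrum G T act M \<longleftrightarrow>
     \<Inter>{V. closed_L2_subspace M V \<and> L2_eigenfunctions G T act M \<subseteq> V} = L2_functions M"

section \<open>Continuous eigenfunctions and eigenvalues\<close>

text \<open>Continuous functions on \<open>X\<close> are extensional, as in \<^const>\<open>cfunspace\<close>, the
  library's space of bounded continuous functions with the supremum metric.\<close>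

definition continuous_eigenfunction ::
  "('g, 'm) monoid_scheme \<Rightarrow> 'g topology \<Rightarrow> 'x topology \<Rightarrow> ('g \<Rightarrow> 'x \<Rightarrow> 'x) \<Rightarrow>
     ('g \<Rightarrow> complex) \<Rightarrow> ('x \<Rightarrow> complex) \<Rightarrow> bool" where
  "continuous_eigenfunction G T X act \<gamma> f \<longleftrightarrow>
     \<gamma> \<in> carrier (dual_group G T) \<and>
     f \<in> extensional (topspace X) \<and> continuous_map X euclidean f \<and>
     (\<exists>x\<in>topspace X. f x \<noteq> 0) \<and>
     (\<forall>t\<in>carrier G. \<forall>x\<in>topspace X. f (act t x) = \<gamma> t * f x)"

definition continuous_eigenvalues ::
  "('g, 'm) monoid_scheme \<Rightarrow> 'g topology \<Rightarrow> 'x topology \<Rightarrow> ('g \<Rightarrow> 'x \<Rightarrow> 'x) \<Rightarrow> ('g \<Rightarrow> complex) set"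
  where
  "continuous_eigenvalues G T X act = {\<gamma>. \<exists>f. continuous_eigenfunction G T X act \<gamma> f}"

section \<open>The dual of the group of continuous eigenvalues\<close>

definition eigenvalue_group ::
  "('g, 'm) monoid_scheme \<Rightarrow> 'g topology \<Rightarrow> 'x topology \<Rightarrow> ('g \<Rightarrow> 'x \<Rightarrow> 'x) \<Rightarrow>
     ('g \<Rightarrow> complex) monoid" where
  "eigenvalue_group G T X act =
     (dual_group G T)\<lparr>carrier := continuous_eigenvalues G T X act\<rparr>"

definition eigenvalue_dual ::
  "('g, 'm) monoid_scheme \<Rightarrow> 'g topology \<Rightarrow> 'x topology \<Rightarrow> ('g \<Rightarrow> 'x \<Rightarrow> 'x) \<Rightarrow>
     (('g \<Rightarrow> complex) \<Rightarrow> complex) topology" where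
  "eigenvalue_dual G T X act =
     dual_topology (eigenvalue_group G T X act)
       (discrete_topology (continuous_eigenvalues G T X act))"

definition eigenvalue_dual_action ::
  "('g, 'm) monoid_scheme \<Rightarrow> 'g topology \<Rightarrow> 'x topology \<Rightarrow> ('g \<Rightarrow> 'x \<Rightarrow> 'x) \<Rightarrow>
     'g \<Rightarrow> (('g \<Rightarrow> complex) \<Rightarrow> complex) \<Rightarrow> ('g \<Rightarrow> complex) \<Rightarrow> complex" where
  "eigenvalue_dual_action G T X act t =
     (\<lambda>\<xi>\<in>topspace (eigenvalue_dual G T X act).
        \<lambda>\<gamma>\<in>continuous_eigenvalues G T X act. \<gamma> t * \<xi> \<gamma>)"

section \<open>The quotient by the continuous eigenfunctions\<close>

definition quotient_topology :: "'x topology \<Rightarrow> ('x \<times> 'x) set \<Rightarrow> 'x set topology" where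
  "quotient_topology X r =
     topology (\<lambda>\<U>. \<U> \<subseteq> topspace X // r \<and> openin X {x \<in> topspace X. r `` {x} \<in> \<U>})"

lemma openin_quotient_topology:
  "openin (quotient_topology X r) \<U> \<longleftrightarrow>
     \<U> \<subseteq> topspace X // r \<and> openin X {x \<in> topspace X. r `` {x} \<in> \<U>}"
proof -
  have 1: "{x \<in> topspace X. r `` {x} \<in> S \<inter> S'} =
        {x \<in> topspace X. r `` {x} \<in> S} \<inter> {x \<in> topspace X. r `` {x} \<in> S'}" for S S'
    by blast
  have 2: "{x \<in> topspace X. r `` {x} \<in> \<Union>\<K>} = (\<Union>S\<in>\<K>. {x \<in> topspace X. r `` {x} \<in> S})" for \<K>
    by blast
  have "istopology (\<lambda>\<U>. \<U> \<subseteq> topspace X // r \<and> openin X {x \<in> topspace X. r `` {x} \<in> \<U>})"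
    unfolding istopology_def 1 2 by (intro conjI allI impI) auto
  then show ?thesis
    by (simp add: quotient_topology_def topology_inverse')
qed

lemma topspace_quotient_topology: "topspace (quotient_topology X r) = topspace X // r"
proof -
  have "{x \<in> topspace X. r `` {x} \<in> topspace X // r} = topspace X"
    by (auto intro: quotientI)
  then have "openin (quotient_topology X r) (topspace X // r)"
    by (simp add: openin_quotient_topology)
  then show ?thesis
    by (metis openin_quotient_topology openin_subset openin_topspace subset_antisym)
qed

definition eigen_rel ::
  "('g, 'm) monoid_scheme \<Rightarrow> 'g topology \<Rightarrow> 'x topology \<Rightarrow> ('g \<Rightarrow> 'x \<Rightarrow> 'x) \<Rightarrow> ('x \<times> 'x) set" where
  "eigen_rel G T X act =
     {(x, y). x \<in> topspace X \<and> y \<in> topspace X \<and>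
        (\<forall>\<gamma> f. continuous_eigenfunction G T X act \<gamma> f \<longrightarrow> f x = f y)}"

definition eigen_quotient ::
  "('g, 'm) monoid_scheme \<Rightarrow> 'g topology \<Rightarrow> 'x topology \<Rightarrow> ('g \<Rightarrow> 'x \<Rightarrow> 'x) \<Rightarrow> 'x set topology" where
  "eigen_quotient G T X act = quotient_topology X (eigen_rel G T X act)"

text \<open>\<open>t \<cdot> [x] = [t \<cdot> x]\<close>, written as the union over all representatives \<open>x\<close> of the class.\<close>

definition eigen_quotient_action ::
  "('g, 'm) monoid_scheme \<Rightarrow> 'g topology \<Rightarrow> 'x topology \<Rightarrow> ('g \<Rightarrow> 'x \<Rightarrow> 'x) \<Rightarrow>
     'g \<Rightarrow> 'x set \<Rightarrow> 'x set" where
  "eigen_quotient_action G T X act t =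
     (\<lambda>c\<in>topspace (eigen_quotient G T X act). \<Union>x\<in>c. eigen_rel G T X act `` {act t x})"

section \<open>The Gelfand spectrum of the algebra generated by the continuous eigenfunctions\<close>

definition closed_subalgebra :: "'x topology \<Rightarrow> ('x \<Rightarrow> complex) set \<Rightarrow> bool" where
  "closed_subalgebra X A \<longleftrightarrow>
     closedin (mtopology_of (cfunspace X euclidean_metric)) A \<and>
     (\<lambda>x\<in>topspace X. 0) \<in> A \<and>
     (\<forall>f\<in>A. \<forall>g\<in>A. (\<lambda>x\<in>topspace X. f x + g x) \<in> A) \<and>
     (\<forall>c. \<forall>f\<in>A. (\<lambda>x\<in>topspace X. c * f x) \<in> A) \<and>
     (\<forall>f\<in>A. \<forall>g\<in>A. (\<lambda>x\<in>topspace X. f x * g x) \<in> A)"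

definition eigen_algebra ::
  "('g, 'm) monoid_scheme \<Rightarrow> 'g topology \<Rightarrow> 'x topology \<Rightarrow> ('g \<Rightarrow> 'x \<Rightarrow> 'x) \<Rightarrow> ('x \<Rightarrow> complex) set"
  where
  "eigen_algebra G T X act =
     \<Inter>{A. closed_subalgebra X A \<and> {f. \<exists>\<gamma>. continuous_eigenfunction G T X act \<gamma> f} \<subseteq> A}"

definition multiplicative_functionals ::
  "'x set \<Rightarrow> ('x \<Rightarrow> complex) set \<Rightarrow> (('x \<Rightarrow> complex) \<Rightarrow> complex) set" where
  "multiplicative_functionals S A =
     {\<phi> \<in> extensional A.
        (\<forall>f\<in>A. \<forall>g\<in>A. \<phi> (\<lambda>x\<in>S. f x + g x) = \<phi> f + \<phi> g) \<and>
        (\<forall>c. \<forall>f\<in>A. \<phi> (\<lambda>x\<in>S. c * f x) = c * \<phi> f) \<and>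
        (\<forall>f\<in>A. \<forall>g\<in>A. \<phi> (\<lambda>x\<in>S. f x * g x) = \<phi> f * \<phi> g) \<and>
        (\<exists>f\<in>A. \<phi> f \<noteq> 0)}"

text \<open>The Gelfand topology is the topology of pointwise convergence on \<open>A\<close>.\<close>

definition gelfand_spectrum ::
  "'x set \<Rightarrow> ('x \<Rightarrow> complex) set \<Rightarrow> (('x \<Rightarrow> complex) \<Rightarrow> complex) topology" where
  "gelfand_spectrum S A =
     subtopology (product_topology (\<lambda>_. euclidean) A) (multiplicative_functionals S A)"

definition eigen_spectrum ::
  "('g, 'm) monoid_scheme \<Rightarrow> 'g topology \<Rightarrow> 'x topology \<Rightarrow> ('g \<Rightarrow> 'x \<Rightarrow> 'x) \<Rightarrow>
     (('x \<Rightarrow> complex) \<Rightarrow> complex) topology" where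
  "eigen_spectrum G T X act = gelfand_spectrum (topspace X) (eigen_algebra G T X act)"

text \<open>\<open>(t \<cdot> \<phi>)(f) = \<phi>(f(t \<cdot>))\<close>, i.e. the Gelfand transform \<open>\<Gamma>\<close>
  satisfies \<open>\<Gamma>(f(t \<cdot>)) = (\<Gamma> f)(t \<cdot>)\<close>.\<close>

definition eigen_spectrum_action ::
  "('g, 'm) monoid_scheme \<Rightarrow> 'g topology \<Rightarrow> 'x topology \<Rightarrow> ('g \<Rightarrow> 'x \<Rightarrow> 'x) \<Rightarrow>
     'g \<Rightarrow> (('x \<Rightarrow> complex) \<Rightarrow> complex) \<Rightarrow> ('x \<Rightarrow> complex) \<Rightarrow> complex" where
  "eigen_spectrum_action G T X act t =
     (\<lambda>\<phi>\<in>topspace (eigen_spectrum G T X act).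
        \<lambda>f\<in>eigen_algebra G T X act. \<phi> (\<lambda>x\<in>topspace X. f (act t x)))"

end

theory Submission
  imports Defs
begin

text \<open>
  Write \<open>K\<close> for the dual of the discrete group \<open>E\<close> of continuous eigenvalues.  It is a compact
  group on which \<open>t \<in> G\<close> acts as multiplication by the character \<open>\<gamma> \<mapsto> \<gamma> t\<close> of \<open>E\<close>.
  The other two systems are compared with \<open>K\<close>.

  \<^emph>\<open>The conjugacies.\<close>  By minimality an eigenfunction has constant nonzero modulus and is
  determined by its eigenvalue up to a scalar.  Fix a base point \<open>x0\<close> and let \<open>f\<^sub>\<gamma>\<close> be the
  eigenfunction for \<open>\<gamma>\<close> with value \<open>1\<close> at \<open>x0\<close>.  Then \<open>\<gamma> \<mapsto> f\<^sub>\<gamma>\<close> is multiplicative, so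
  \<open>x \<mapsto> (\<gamma> \<mapsto> f\<^sub>\<gamma> x)\<close> is a continuous equivariant map from \<open>X\<close> to \<open>K\<close>, whose fibres are the
  classes of \<open>\<sim>\<close>.  Its image is closed and invariant, hence equal to \<open>K\<close> because \<open>K\<close> is minimal
  (\<open>factor_surj\<close>); this identifies the quotient with \<open>K\<close>.  A multiplicative functional \<open>\<phi>\<close> on the
  algebra is a contraction (\<open>functional_contraction\<close>).  Therefore \<open>\<gamma> \<mapsto> \<phi> f\<^sub>\<gamma>\<close> is an element of
  \<open>K\<close>, and it determines \<open>\<phi>\<close>.  Point evaluations already exhaust \<open>K\<close>, so every \<open>\<phi>\<close> is
  a point evaluation, and the Gelfand spectrum is \<open>K\<close> as well.

  \<^emph>\<open>Means on \<open>K\<close>.\<close>  The operator \<open>f \<mapsto> (f + f(t \<cdot>)) / 2\<close> multiplies the function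
  \<open>\<xi> \<mapsto> \<xi> \<gamma>\<close> by \<open>(1 + \<gamma> t) / 2\<close>, a number of modulus less than \<open>1\<close> if \<open>\<gamma> t \<noteq> 1\<close>.
  Hence suitable compositions of such operators bring every trigonometric polynomial, and by
  Stone-Weierstrass every continuous function, uniformly close to a constant, its mean
  (\<open>continuous_has_mean\<close>).  The operators commute, so the mean is unique, linear and positive; it
  is invariant under all translations of \<open>K\<close>, and it is the integral for every \<open>G\<close>-invariant
  probability.  Minimality of \<open>K\<close> follows: a continuous function \<open>f \<ge> 0\<close> that vanishes on a closed
  invariant set has mean \<open>0\<close>, but if \<open>f\<close> is not identically \<open>0\<close> then finitely many translates of
  \<open>f\<close> have a sum bounded below by a positive constant (\<open>closed_invariant_eq\<close>).  A construction in
  the manner of Riesz turns the mean into an invariant Borel measure.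

  \<^emph>\<open>Uniqueness.\<close>  The group \<open>K\<close> may fail to be metrizable, and the invariant Borel probabilities
  in question are not assumed to be regular, so that equality of the integrals of continuous
  functions does not by itself give equality of measures.  The missing step is in the spirit of
  Kakutani and Kodaira: each open set \<open>U\<close> lies in a set \<open>{f > 0}\<close> with \<open>f\<close> continuous for
  which the supremum of the means of the continuous functions below the indicator is not
  larger than it is for \<open>U\<close> (\<open>cozero_majorant\<close>).  The measure of \<open>{f > 0}\<close>
  is a limit of integrals of continuous functions, so all invariant probabilities agree on \<open>U\<close>.

  \<^emph>\<open>Pure point spectrum.\<close>  A closed subspace of \<open>L\<^sup>2\<close> that contains the functions
  \<open>\<xi> \<mapsto> \<xi> \<gamma>\<close> contains the continuous functions, then the indicators of open sets, because their
  measures are suprema of means of continuous functions, then all indicators of Borel sets, and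
  so everything.  Finally the three properties pass along conjugacies.
\<close>

section \<open>Measures representing positive functionals\<close>

lemma Hausdorff_space_top_of_set: "Hausdorff_space (top_of_set (S :: 'a::t2_space set))"
proof (rule Hausdorff_space_subtopology)
  show "Hausdorff_space (euclidean :: 'a topology)"
    unfolding Hausdorff_space_def disjnt_def using hausdorff by auto
qed

text \<open>A normalised positive linear functional on the continuous real functions on a compact set.  As a
  total function \<open>I\<close> has values everywhere; the axioms constrain those on continuous functions.\<close>

locale normalised_functional =
  fixes K :: "'a::t2_space set" and I :: "('a \<Rightarrow> real) \<Rightarrow> real"
  assumes compact_K: "compact K"
    and I_add: "continuous_on K f \<Longrightarrow> continuous_on K g \<Longrightarrow> I (\<lambda>x. f x + g x) = I f + I g"
    and I_scale: "continuous_on K f \<Longrightarrow> I (\<lambda>x. c * f x) = c * I f"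
    and I_mono: "continuous_on K f \<Longrightarrow> continuous_on K g \<Longrightarrow> (\<And>x. x \<in> K \<Longrightarrow> f x \<le> g x) \<Longrightarrow> I f \<le> I g"
    and I_one: "I (\<lambda>x. 1) = 1"
begin

definition minorants :: "'a set \<Rightarrow> ('a \<Rightarrow> real) set" where
  "minorants U = {f. continuous_on K f \<and> (\<forall>x\<in>K. 0 \<le> f x \<and> f x \<le> 1 \<and> (x \<notin> U \<longrightarrow> f x = 0))}"

definition inner_content :: "'a set \<Rightarrow> real" where
  "inner_content U = (SUP f\<in>minorants U. I f)"

definition outer_content :: "'a set \<Rightarrow> ennreal" where
  "outer_content A = (INF U\<in>{U. openin (top_of_set K) U \<and> A \<subseteq> U}. ennreal (inner_content U))"

lemma I_const: "I (\<lambda>x. c) = c"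
  using I_scale[of "\<lambda>x. 1" c] I_one by simp

lemma zero_minorant: "(\<lambda>x. 0) \<in> minorants U"
  by (simp add: minorants_def)

lemma minorants_mono: "U \<subseteq> V \<Longrightarrow> minorants U \<subseteq> minorants V"
  by (auto simp: minorants_def)

lemma minorant_le_one: "f \<in> minorants U \<Longrightarrow> x \<in> K \<Longrightarrow> f x \<le> 1"
  by (auto simp: minorants_def)

lemma I_minorant: "f \<in> minorants U \<Longrightarrow> 0 \<le> I f \<and> I f \<le> 1"
  using I_mono[of "\<lambda>x. 0" f] I_mono[of f "\<lambda>x. 1"] minorant_le_one[of f U] I_const
  by (auto simp: minorants_def)

lemma bdd_above_minorants: "bdd_above (I ` minorants U)"
  using I_minorant by (intro bdd_aboveI2[where M = 1]) auto

lemma I_le_inner_content: "f \<in> minorants U \<Longrightarrow> I f \<le> inner_content U"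
  unfolding inner_content_def by (rule cSUP_upper[OF _ bdd_above_minorants])

lemma inner_content_leI: "(\<And>f. f \<in> minorants U \<Longrightarrow> I f \<le> c) \<Longrightarrow> inner_content U \<le> c"
  unfolding inner_content_def by (rule cSUP_least) (use zero_minorant in auto)

lemma inner_content_nonneg: "0 \<le> inner_content U"
  using I_le_inner_content[OF zero_minorant] I_const[of 0] by simp

lemma inner_content_mono: "U \<subseteq> V \<Longrightarrow> inner_content U \<le> inner_content V"
  by (meson I_le_inner_content inner_content_leI minorants_mono subsetD)

lemma inner_content_approx:
  assumes "e > 0" obtains f where "f \<in> minorants U" "inner_content U - e < I f"
proof -
  have "minorants U \<noteq> {}" using zero_minorant by auto
  then have "\<exists>f\<in>minorants U. inner_content U - e < I f"
    using less_cSUP_iff[of "minorants U" I "inner_content U - e"] bdd_above_minorants assms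
    by (simp add: inner_content_def)
  then show ?thesis using that by auto
qed

lemma inner_content_empty: "inner_content {} = 0"
proof (rule antisym)
  show "inner_content {} \<le> 0"
  proof (rule inner_content_leI)
    fix f assume "f \<in> minorants {}"
    then show "I f \<le> 0"
      using I_mono[of f "\<lambda>x. 0"] I_const[of 0] by (auto simp: minorants_def)
  qed
qed (rule inner_content_nonneg)

lemma inner_content_space: "inner_content K = 1"
proof (rule antisym)
  show "inner_content K \<le> 1" by (rule inner_content_leI) (use I_minorant in auto)
  have "(\<lambda>x. 1) \<in> minorants K" by (simp add: minorants_def)
  then show "1 \<le> inner_content K" using I_le_inner_content I_one by force
qed

lemma max_minorant:
  "f \<in> minorants U \<Longrightarrow> g \<in> minorants U \<Longrightarrow> (\<lambda>x. max (f x) (g x)) \<in> minorants U"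
  by (auto simp: minorants_def intro: continuous_intros)

lemma Urysohn_minorant:
  assumes "openin (top_of_set K) U" "x \<in> U"
  obtains f where "f \<in> minorants U" "f x = 1"
proof -
  have xK: "x \<in> K" using assms openin_subset by fastforce
  have "normal_space (top_of_set K)"
    using compact_K by (intro compact_Hausdorff_or_regular_imp_normal_space compact_space_subtopology)
      (auto simp: Hausdorff_space_top_of_set)
  moreover have "closedin (top_of_set K) {x}"
    using xK by (simp add: closedin_subset_trans closed_subset)
  moreover have "closedin (top_of_set K) (K - U)"
    using assms by (simp add: closedin_diff openin_diff openin_closedin_eq)
  moreover have "disjnt (K - U) {x}" using assms by (simp add: disjnt_def)
  ultimately obtain f where f: "continuous_map (top_of_set K) (top_of_set {0..1::real}) f"
      "f ` (K - U) \<subseteq> {0}" "f ` {x} \<subseteq> {1}"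
    using Urysohn_lemma[of "top_of_set K" "K - U" "{x}" 0 1] by auto
  then have "continuous_on K f" "\<And>y. y \<in> K \<Longrightarrow> 0 \<le> f y \<and> f y \<le> 1"
    by (auto simp: continuous_map_in_subtopology image_subset_iff Pi_iff)
  then have "f \<in> minorants U" using f by (auto simp: minorants_def indicator_def)
  then show ?thesis using that f by auto
qed

lemma I_sum:
  assumes "finite J" "\<And>j. j \<in> J \<Longrightarrow> continuous_on K (h j)"
  shows "I (\<lambda>x. \<Sum>j\<in>J. h j x) = (\<Sum>j\<in>J. I (h j))"
  using assms
proof (induction J)
  case empty then show ?case by (simp add: I_const)
next
  case (insert a J)
  then show ?case by (simp add: I_add continuous_on_sum)
qed

text \<open>The subadditivity that makes the outer content countably subadditive.  Instead of a partition of
  unity the proof uses that \<open>f - e\<close> is dominated near each point by one Urysohn function of one of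
  the sets \<open>U i\<close>; by compactness finitely many of them suffice, and those that belong to the
  same \<open>U i\<close> are merged into their maximum.\<close>

lemma inner_content_subadditive:
  fixes U :: "nat \<Rightarrow> 'a set"
  assumes U: "\<And>i. openin (top_of_set K) (U i)" and f: "f \<in> minorants (\<Union>i. U i)" and "e > 0"
  obtains n where "I f \<le> e + (\<Sum>i<n. inner_content (U i))"
proof -
  have contf: "continuous_on K f" using f by (simp add: minorants_def)
  \<comment> \<open>Pairs of an index and a Urysohn function for the set with that index.\<close>
  define \<C> where "\<C> = {(i, h) | i h. h \<in> minorants (U i)}"
  define O' where "O' p = {y \<in> K. f y - e < snd p y}" for p :: "nat \<times> ('a \<Rightarrow> real)"
  have contp: "continuous_on K (snd p)" if "p \<in> \<C>" for p
    using that by (auto simp: \<C>_def minorants_def)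
  have "openin (top_of_set K) (O' p)" if "p \<in> \<C>" for p
  proof -
    have "continuous_on K (\<lambda>y. snd p y - f y)"
      using contp[OF that] contf by (intro continuous_intros)
    then have "openin (top_of_set K) (K \<inter> (\<lambda>y. snd p y - f y) -` {- e <..})"
      by (intro continuous_openin_preimage_gen) auto
    moreover have "O' p = K \<inter> (\<lambda>y. snd p y - f y) -` {- e <..}" by (auto simp: O'_def)
    ultimately show ?thesis by simp
  qed
  moreover have "K \<subseteq> (\<Union>p\<in>\<C>. O' p)"
  proof
    fix x assume x: "x \<in> K"
    show "x \<in> (\<Union>p\<in>\<C>. O' p)"
    proof (cases "\<exists>i. x \<in> U i")
      case True
      then obtain i where "x \<in> U i" by auto
      then obtain h where "h \<in> minorants (U i)" "h x = 1" using Urysohn_minorant[OF U] by metis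
      moreover have "f x \<le> 1" using minorant_le_one[OF f x] .
      ultimately show ?thesis using x \<open>e > 0\<close> by (auto simp: \<C>_def O'_def intro!: exI[of _ i] exI[of _ h])
    next
      case False
      then have "f x \<le> 0" using f x by (force simp: minorants_def)
      then show ?thesis using x \<open>e > 0\<close> zero_minorant[of "U 0"]
        by (auto simp: \<C>_def O'_def intro!: exI[of _ 0] exI[of _ "\<lambda>x. 0"])
    qed
  qed
  ultimately have "\<exists>D\<subseteq>O' ` \<C>. finite D \<and> K \<subseteq> \<Union>D"
    using compact_K[unfolded compact_eq_openin_cover, rule_format, of "O' ` \<C>"] by auto
  then obtain P where P: "P \<subseteq> \<C>" "finite P" "K \<subseteq> (\<Union>p\<in>P. O' p)"
    by (metis finite_subset_image)
  have "\<exists>H. (\<forall>i. H i \<in> minorants (U i)) \<and> (\<forall>(i, h)\<in>P. \<forall>x\<in>K. h x \<le> H i x)"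
    using P(2,1)
  proof (induction P)
    case empty then show ?case using zero_minorant by (intro exI[of _ "\<lambda>i x. 0"]) auto
  next
    case (insert p P)
    obtain i h where p: "p = (i, h)" by (cases p)
    have h: "h \<in> minorants (U i)" using insert p by (auto simp: \<C>_def)
    obtain H where H: "\<And>j. H j \<in> minorants (U j)" "\<And>j g x. (j, g) \<in> P \<Longrightarrow> x \<in> K \<Longrightarrow> g x \<le> H j x"
      using insert by fastforce
    define H' where "H' = H(i := \<lambda>x. max (H i x) (h x))"
    have "H' j \<in> minorants (U j)" for j using H(1) h by (auto simp: H'_def max_minorant)
    moreover have "g x \<le> H' j x" if "(j, g) \<in> insert p P" "x \<in> K" for j g x
      using that H(2)[of j g x] by (auto simp: H'_def p le_max_iff_disj)
    ultimately show ?case by blast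
  qed
  then obtain H where H: "\<And>i. H i \<in> minorants (U i)" "\<And>i h x. (i, h) \<in> P \<Longrightarrow> x \<in> K \<Longrightarrow> h x \<le> H i x"
    by fastforce
  obtain n where n: "\<And>i. i \<in> fst ` P \<Longrightarrow> i < n"
    using P(2) finite_nat_set_iff_bounded by (metis finite_imageI)
  have contH: "continuous_on K (H i)" for i using H(1)[of i] by (simp add: minorants_def)
  have "f x \<le> e + (\<Sum>i<n. H i x)" if "x \<in> K" for x
  proof -
    obtain i h where ih: "(i, h) \<in> P" "f x - e < h x" using P(3) \<open>x \<in> K\<close> by (fastforce simp: O'_def)
    have "h x \<le> H i x" using H ih that by auto
    also have "\<dots> \<le> (\<Sum>i<n. H i x)"
      using n[of i] ih H(1) that by (intro member_le_sum) (force simp: minorants_def)+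
    finally show ?thesis using ih by simp
  qed
  then have "I f \<le> I (\<lambda>x. e + (\<Sum>i<n. H i x))"
    using contf contH by (intro I_mono continuous_intros) auto
  also have "\<dots> = e + (\<Sum>i<n. I (H i))"
    using contH by (subst I_add) (auto intro!: continuous_intros simp: I_const I_sum)
  also have "\<dots> \<le> e + (\<Sum>i<n. inner_content (U i))"
    using H(1) by (auto intro!: sum_mono I_le_inner_content)
  finally show ?thesis using that by blast
qed

lemma outer_content_open: "openin (top_of_set K) U \<Longrightarrow> outer_content U = ennreal (inner_content U)"
  unfolding outer_content_def
  by (intro antisym INF_lower INF_greatest) (auto intro!: ennreal_leI inner_content_mono)

lemma outer_content_approx:
  assumes "A \<subseteq> K" "e > 0"
  obtains U where "openin (top_of_set K) U" "A \<subseteq> U" "ennreal (inner_content U) \<le> outer_content A + ennreal e"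
proof -
  have "outer_content A \<le> outer_content K"
    unfolding outer_content_def using assms by (intro INF_superset_mono) auto
  then have fin: "outer_content A < top_class.top"
    by (metis outer_content_open openin_topspace topspace_euclidean_subtopology ennreal_less_top le_less_trans)
  then have "outer_content A < outer_content A + ennreal e"
    using assms by (simp add: ennreal_less_top less_top)
  then show ?thesis
    using that unfolding outer_content_def[of A] INF_less_iff by (metis (mono_tags, lifting) less_imp_le mem_Collect_eq)
qed

lemma outer_measure_space_outer_content: "outer_measure_space (Pow K) outer_content"
  unfolding outer_measure_space_def
proof (intro conjI)
  show "positive (Pow K) outer_content"
    using outer_content_open[of "{}"] by (simp add: positive_def inner_content_empty)
  show "increasing (Pow K) outer_content"
    unfolding increasing_def outer_content_def by (auto intro!: INF_superset_mono)
  show "countably_subadditive (Pow K) outer_content"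
    unfolding countably_subadditive_def
  proof (intro allI impI)
    fix A :: "nat \<Rightarrow> 'a set" assume A: "range A \<subseteq> Pow K"
    show "outer_content (\<Union>i. A i) \<le> (\<Sum>i. outer_content (A i))"
    proof (rule ennreal_le_epsilon)
      fix e :: real assume "e > 0"
      have "\<exists>U. openin (top_of_set K) U \<and> A i \<subseteq> U \<and>
              ennreal (inner_content U) \<le> outer_content (A i) + ennreal (e / 2 * (1/2) ^ Suc i)" for i
        using outer_content_approx[of "A i" "e / 2 * (1/2) ^ Suc i"] A \<open>e > 0\<close> by (metis PowD UNIV_I image_subset_iff
            half_gt_zero mult_pos_pos zero_less_divide_1_iff zero_less_numeral zero_less_power)
      then obtain U where U: "\<And>i. openin (top_of_set K) (U i)" "\<And>i. A i \<subseteq> U i"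
          "\<And>i. ennreal (inner_content (U i)) \<le> outer_content (A i) + ennreal (e / 2 * (1/2) ^ Suc i)"
        by metis
      have half: "(\<Sum>i. ennreal (e / 2 * (1/2) ^ Suc i)) = ennreal (e / 2)"
        using \<open>e > 0\<close> sums_mult[OF power_half_series, of "e / 2"] by (intro suminf_ennreal_eq) auto
      have le: "ennreal (I f) \<le> (\<Sum>i. outer_content (A i)) + ennreal e" if f: "f \<in> minorants (\<Union>i. U i)" for f
      proof -
        obtain n where n: "I f \<le> e / 2 + (\<Sum>i<n. inner_content (U i))"
          using inner_content_subadditive[OF U(1) f, of "e / 2"] \<open>e > 0\<close> by auto
        have "ennreal (I f) \<le> ennreal (e / 2) + (\<Sum>i<n. ennreal (inner_content (U i)))"
          using n \<open>e > 0\<close> by (subst sum_ennreal) (auto simp: inner_content_nonneg sum_nonneg ennreal_plus[symmetric]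
              simp del: ennreal_plus intro!: ennreal_leI)
        also have "\<dots> \<le> ennreal (e / 2) + (\<Sum>i. ennreal (inner_content (U i)))"
          by (intro add_left_mono sum_le_suminf) auto
        also have "\<dots> \<le> ennreal (e / 2) + (\<Sum>i. outer_content (A i) + ennreal (e / 2 * (1/2) ^ Suc i))"
          by (intro add_left_mono suminf_le U) auto
        also have "\<dots> = (\<Sum>i. outer_content (A i)) + (ennreal (e / 2) + ennreal (e / 2))"
          by (simp only: suminf_add[symmetric] summableI half ac_simps)
        also have "ennreal (e / 2) + ennreal (e / 2) = ennreal e"
          using \<open>e > 0\<close> by (simp add: ennreal_plus[symmetric] del: ennreal_plus)
        finally show ?thesis .
      qed
      have op: "openin (top_of_set K) (\<Union>i. U i)" using U(1) by auto
      have "outer_content (\<Union>i. A i) \<le> ennreal (inner_content (\<Union>i. U i))"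
        unfolding outer_content_def using op U(2) by (intro INF_lower) auto
      also have "\<dots> \<le> (\<Sum>i. outer_content (A i)) + ennreal e"
      proof (cases "(\<Sum>i. outer_content (A i)) + ennreal e = top_class.top")
        case False
        then obtain r where r: "(\<Sum>i. outer_content (A i)) + ennreal e = ennreal r" "r \<ge> 0"
          by (metis ennreal_cases)
        have "inner_content (\<Union>i. U i) \<le> r"
          using le r I_minorant by (intro inner_content_leI) (simp add: ennreal_le_iff)
        then show ?thesis using r by (simp add: ennreal_leI)
      qed simp
      finally show "outer_content (\<Union>i. A i) \<le> (\<Sum>i. outer_content (A i)) + ennreal e" .
    qed
  qed
qed

text \<open>The Caratheodory inequality for open sets.  If \<open>f\<close> nearly exhausts \<open>V \<inter> U\<close>, then the open set
  \<open>W = V \<inter> {f < d}\<close> contains \<open>V - U\<close>; a function \<open>g\<close> below the indicator of \<open>W\<close> satisfies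
  \<open>f + g \<le> 1 + d\<close>, since \<open>g\<close> vanishes where \<open>f \<ge> d\<close>.\<close>

lemma inner_content_split:
  assumes V: "openin (top_of_set K) V" and U: "openin (top_of_set K) U"
  shows "ennreal (inner_content (V \<inter> U)) + outer_content (V - U) \<le> ennreal (inner_content V)"
proof (rule ennreal_le_epsilon)
  fix e :: real assume "e > 0"
  define d where "d = e / 3"
  have "d > 0" using \<open>e > 0\<close> by (simp add: d_def)
  obtain f where f: "f \<in> minorants (V \<inter> U)" "inner_content (V \<inter> U) - d < I f"
    using inner_content_approx[OF \<open>d > 0\<close>] .
  have contf: "continuous_on K f" using f by (simp add: minorants_def)
  define W where "W = V \<inter> (K \<inter> f -` {..<d})"
  have W: "openin (top_of_set K) W"
    unfolding W_def using V contf by (intro openin_Int continuous_openin_preimage_gen) auto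
  have VK: "V \<subseteq> K" using V openin_subset by fastforce
  have "V - U \<subseteq> W" using f(1) VK \<open>d > 0\<close> by (force simp: W_def minorants_def)
  then have out: "outer_content (V - U) \<le> ennreal (inner_content W)"
    unfolding outer_content_def using W by (intro INF_lower) auto
  obtain g where g: "g \<in> minorants W" "inner_content W - d < I g"
    using inner_content_approx[OF \<open>d > 0\<close>] .
  have contg: "continuous_on K g" using g by (simp add: minorants_def)
  \<comment> \<open>Division by \<open>1 + d\<close> makes the sum a minorant of \<open>V\<close>.\<close>
  define h where "h x = inverse (1 + d) * (f x + g x)" for x
  have "h \<in> minorants V"
  proof -
    have "0 \<le> f x + g x \<and> f x + g x \<le> 1 + d \<and> (x \<notin> V \<longrightarrow> f x + g x = 0)" if "x \<in> K" for x
      using f(1) g(1) that \<open>d > 0\<close> by (cases "x \<in> W") (force simp: minorants_def W_def)+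
    moreover have "continuous_on K h" unfolding h_def using contf contg by (intro continuous_intros)
    ultimately show ?thesis using \<open>d > 0\<close> by (auto simp: minorants_def h_def field_simps)
  qed
  then have "I h \<le> inner_content V" by (rule I_le_inner_content)
  moreover have "I h = inverse (1 + d) * (I f + I g)"
    unfolding h_def using contf contg by (simp add: I_scale I_add continuous_on_add)
  ultimately have 1: "I f + I g \<le> (1 + d) * inner_content V" using \<open>d > 0\<close> by (simp add: field_simps)
  have "inner_content V \<le> 1" using inner_content_mono[OF VK] inner_content_space by simp
  then have "d * inner_content V \<le> d * 1" using \<open>d > 0\<close> by (intro mult_left_mono) auto
  then have le: "inner_content (V \<inter> U) + inner_content W \<le> inner_content V + e"
    using 1 f(2) g(2) by (simp add: algebra_simps d_def)
  have "ennreal (inner_content (V \<inter> U)) + outer_content (V - U)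
      \<le> ennreal (inner_content (V \<inter> U)) + ennreal (inner_content W)"
    using out by (intro add_left_mono)
  also have "\<dots> \<le> ennreal (inner_content V) + ennreal e"
    using le \<open>e > 0\<close> inner_content_nonneg
    by (simp add: ennreal_plus[symmetric] ennreal_leI del: ennreal_plus)
  finally show "ennreal (inner_content (V \<inter> U)) + outer_content (V - U) \<le> ennreal (inner_content V) + ennreal e" .
qed

lemma openin_lambda_system:
  assumes U: "openin (top_of_set K) U"
  shows "U \<in> lambda_system K (Pow K) outer_content"
proof -
  have UK: "U \<subseteq> K" using U openin_subset by fastforce
  interpret P: sigma_algebra K "Pow K" by (rule sigma_algebra_Pow)
  have oms: "positive (Pow K) outer_content" "increasing (Pow K) outer_content"
      "countably_subadditive (Pow K) outer_content"
    using outer_measure_space_outer_content by (auto simp: outer_measure_space_def)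
  have "outer_content (A \<inter> U) + outer_content (A - U) = outer_content A" if A: "A \<subseteq> K" for A
  proof (rule antisym)
    show "outer_content (A \<inter> U) + outer_content (A - U) \<le> outer_content A"
    proof (rule ennreal_le_epsilon)
      fix e :: real assume "e > 0"
      obtain V where V: "openin (top_of_set K) V" "A \<subseteq> V"
          "ennreal (inner_content V) \<le> outer_content A + ennreal e"
        using outer_content_approx[OF A \<open>e > 0\<close>] .
      have VK: "V \<subseteq> K" using V openin_subset by fastforce
      have "outer_content (A \<inter> U) + outer_content (A - U) \<le> outer_content (V \<inter> U) + outer_content (V - U)"
        using V(2) VK A by (intro add_mono increasingD[OF oms(2)]) auto
      also have "\<dots> \<le> ennreal (inner_content V)"
        using inner_content_split[OF V(1) U] outer_content_open[OF openin_Int[OF V(1) U]] by simp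
      finally show "outer_content (A \<inter> U) + outer_content (A - U) \<le> outer_content A + ennreal e"
        using V(3) by order
    qed
    have "subadditive (Pow K) outer_content"
      using P.countably_subadditive_subadditive oms by blast
    then have "outer_content ((A \<inter> U) \<union> (A - U)) \<le> outer_content (A \<inter> U) + outer_content (A - U)"
      using A by (intro subadditiveD) auto
    then show "outer_content A \<le> outer_content (A \<inter> U) + outer_content (A - U)"
      by (simp add: Int_Diff_Un)
  qed
  then show ?thesis using UK by (simp add: P.lambda_system_eq)
qed

text \<open>The Riesz measure of the functional.  It is described through its values on open sets, which is
  how regularity is used later.\<close>

proposition representing_measure:
  obtains M where "space M = K" "sets M = borel_sets (top_of_set K)"
    "\<And>U. openin (top_of_set K) U \<Longrightarrow> emeasure M U = ennreal (inner_content U)"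
proof -
  interpret P: sigma_algebra K "Pow K" by (rule sigma_algebra_Pow)
  have ms: "measure_space K (lambda_system K (Pow K) outer_content) outer_content"
    using P.caratheodory_lemma[OF outer_measure_space_outer_content] .
  have sub: "borel_sets (top_of_set K) \<subseteq> lambda_system K (Pow K) outer_content"
    unfolding borel_sets_def topspace_euclidean_subtopology
    using ms openin_lambda_system by (intro sigma_algebra.sigma_sets_subset) (auto simp: measure_space_def)
  have sa: "sigma_algebra K (borel_sets (top_of_set K))"
    unfolding borel_sets_def topspace_euclidean_subtopology
    by (intro sigma_algebra_sigma_sets) (use openin_subset in fastforce)
  have ms': "measure_space K (borel_sets (top_of_set K)) outer_content"
    using measure_down[OF ms sa sub] .
  define M where "M = measure_of K (borel_sets (top_of_set K)) outer_content"
  have "borel_sets (top_of_set K) \<subseteq> Pow K" using sa unfolding sigma_algebra_iff2 by auto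
  then have 1: "space M = K" "sets M = borel_sets (top_of_set K)"
    unfolding M_def by (rule space_measure_of, simp add: sigma_algebra.sets_measure_of_eq[OF sa])
  moreover have "emeasure M U = ennreal (inner_content U)" if "openin (top_of_set K) U" for U
  proof -
    have U: "U \<in> sets M" unfolding 1 borel_sets_def using that by (auto intro: sigma_sets.Basic)
    have "emeasure M U = outer_content U"
      unfolding M_def using ms' U 1 by (intro emeasure_measure_of_sigma) (auto simp: measure_space_def)
    then show ?thesis using outer_content_open that by simp
  qed
  ultimately show ?thesis using that by blast
qed

end

section \<open>Means under commuting maps\<close>

lemma openin_borel_sets: "openin X U \<Longrightarrow> U \<in> borel_sets X"
  unfolding borel_sets_def by (auto intro: sigma_sets.Basic)

lemma continuous_map_borel_measurable:
  fixes f :: "'a \<Rightarrow> 'b::topological_space"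
  assumes "space M = topspace X" "sets M = borel_sets X" "continuous_map X euclidean f"
  shows "f \<in> borel_measurable M"
proof (rule borel_measurableI)
  fix S :: "'b set" assume "open S"
  then have "openin X {x \<in> topspace X. f x \<in> S}"
    using assms(3) by (auto simp: continuous_map_def)
  moreover have "{x \<in> topspace X. f x \<in> S} = f -` S \<inter> space M" using assms(1) by auto
  ultimately show "f -` S \<inter> space M \<in> sets M" using assms(2) openin_borel_sets by metis
qed

lemma continuous_map_measurable_borel_sets:
  assumes M: "space M = topspace X" "sets M = borel_sets X"
    and N: "space N = topspace Y" "sets N = borel_sets Y" and h: "continuous_map X Y h"
  shows "h \<in> measurable M N"
proof (rule measurable_sigma_sets)
  show "sets N = sigma_sets (topspace Y) {U. openin Y U}" using N by (simp add: borel_sets_def)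
  show "{U. openin Y U} \<subseteq> Pow (topspace Y)" by (auto dest: openin_subset)
  show "h \<in> space M \<rightarrow> topspace Y" using M h by (auto simp: continuous_map_def)
  show "h -` U \<inter> space M \<in> sets M" if "U \<in> {U. openin Y U}" for U
  proof -
    have "h -` U \<inter> space M = {x \<in> topspace X. h x \<in> U}" using M by auto
    then show ?thesis using that h M openin_borel_sets[of X] by (auto simp: continuous_map_def)
  qed
qed

text \<open>The open sets are closed under intersection and generate the Borel sets.\<close>

lemma borel_measure_eqI:
  assumes "finite_measure M" "finite_measure N" "space M = topspace X" "space N = topspace X"
    and "sets M = borel_sets X" "sets N = borel_sets X"
    and eq: "\<And>U. openin X U \<Longrightarrow> emeasure M U = emeasure N U"
  shows "M = N"
proof (rule measure_eqI_generator_eq[where \<Omega> = "topspace X" and E = "{U. openin X U}" and A = "\<lambda>_. topspace X"])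
  show "Int_stable {U. openin X U}" by (auto simp: Int_stable_def)
  show "{U. openin X U} \<subseteq> Pow (topspace X)" by (auto dest: openin_subset)
  show "sets M = sigma_sets (topspace X) {U. openin X U}" "sets N = sigma_sets (topspace X) {U. openin X U}"
    using assms by (auto simp: borel_sets_def)
  show "emeasure M (topspace X) \<noteq> \<infinity>" for i :: nat using finite_measure.emeasure_finite[OF assms(1)] by simp
qed (use eq in auto)

text \<open>Means make sense for any family of commuting continuous self-maps of a compact set, before the
  group structure of the dual enters.\<close>

locale commuting_maps =
  fixes G :: "('g, 'm) monoid_scheme" and K :: "'a::t2_space set" and act :: "'g \<Rightarrow> 'a \<Rightarrow> 'a"
  assumes compact: "compact K" and nonempty: "K \<noteq> {}"
    and act_closed: "t \<in> carrier G \<Longrightarrow> x \<in> K \<Longrightarrow> act t x \<in> K"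
    and act_cont: "t \<in> carrier G \<Longrightarrow> continuous_on K (act t)"
    and act_commute: "s \<in> carrier G \<Longrightarrow> t \<in> carrier G \<Longrightarrow> x \<in> K \<Longrightarrow> act s (act t x) = act t (act s x)"
begin

text \<open>Averages are compositions of half-sums rather than arithmetic means over finite sets: they
  compose by appending lists, and each half-sum acts on a character as multiplication by a number.\<close>

primrec avg :: "'g list \<Rightarrow> ('a \<Rightarrow> 'b::real_normed_vector) \<Rightarrow> 'a \<Rightarrow> 'b" where
  "avg [] f x = f x"
| "avg (t # ts) f x = (1/2) *\<^sub>R (avg ts f x + avg ts f (act t x))"

lemma avg_Nil: "avg [] f = f"
  by (rule ext) simp

definition has_mean :: "('a \<Rightarrow> 'b::real_normed_vector) \<Rightarrow> 'b \<Rightarrow> bool" where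
  "has_mean f c \<longleftrightarrow> (\<forall>e>0. \<exists>ts. set ts \<subseteq> carrier G \<and> (\<forall>x\<in>K. norm (avg ts f x - c) < e))"

lemma avg_append: "avg (ts @ ss) f x = avg ts (avg ss f) x"
  by (induction ts arbitrary: x) auto

lemma avg_cong:
  "set ts \<subseteq> carrier G \<Longrightarrow> (\<And>x. x \<in> K \<Longrightarrow> f x = g x) \<Longrightarrow> x \<in> K \<Longrightarrow> avg ts f x = avg ts g x"
  by (induction ts arbitrary: x) (auto simp: act_closed)

lemma avg_add: "avg ts (\<lambda>x. f x + g x) x = avg ts f x + avg ts g x"
  by (induction ts arbitrary: x) (auto simp: algebra_simps)

lemma avg_linear:
  assumes "bounded_linear L" shows "avg ts (\<lambda>x. L (f x)) x = L (avg ts f x)"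
proof -
  interpret L: bounded_linear L by fact
  show ?thesis by (induction ts arbitrary: x) (auto simp: L.add L.scaleR)
qed

lemma avg_const: "avg ts (\<lambda>x. c) x = c"
  by (induction ts arbitrary: x) (auto simp: scaleR_left_distrib[symmetric] simp flip: scaleR_2)

lemma avg_near:
  assumes "set ts \<subseteq> carrier G" "\<And>x. x \<in> K \<Longrightarrow> norm (f x - c) < e" "x \<in> K"
  shows "norm (avg ts f x - c) < e"
  using assms(1,3)
proof (induction ts arbitrary: x)
  case Nil then show ?case using assms by simp
next
  case (Cons t ts)
  then have 1: "norm (avg ts f x - c) < e" "norm (avg ts f (act t x) - c) < e"
    by (auto simp: act_closed)
  have "avg (t # ts) f x - c = (1/2) *\<^sub>R ((avg ts f x - c) + (avg ts f (act t x) - c))"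
    by (simp add: algebra_simps flip: scaleR_2)
  then have "norm (avg (t # ts) f x - c) = norm ((avg ts f x - c) + (avg ts f (act t x) - c)) / 2"
    by (metis (no_types, lifting) norm_scaleR abs_divide abs_numeral abs_one mult.left_neutral times_divide_eq_left)
  then show ?case using 1 norm_triangle_ineq[of "avg ts f x - c" "avg ts f (act t x) - c"] by linarith
qed

lemma avg_mono:
  fixes f :: "'a \<Rightarrow> real"
  shows "set ts \<subseteq> carrier G \<Longrightarrow> (\<And>x. x \<in> K \<Longrightarrow> f x \<le> g x) \<Longrightarrow> x \<in> K \<Longrightarrow> avg ts f x \<le> avg ts g x"
  by (induction ts arbitrary: x) (auto simp: act_closed intro!: add_mono)

lemma avg_compose:
  assumes "\<And>x. x \<in> K \<Longrightarrow> k x \<in> K" "\<And>t x. t \<in> carrier G \<Longrightarrow> x \<in> K \<Longrightarrow> k (act t x) = act t (k x)"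
  shows "set ts \<subseteq> carrier G \<Longrightarrow> x \<in> K \<Longrightarrow> avg ts (\<lambda>x. f (k x)) x = avg ts f (k x)"
  by (induction ts arbitrary: x) (auto simp: act_closed assms)

lemma avg_commute:
  "set ts \<subseteq> carrier G \<Longrightarrow> set ss \<subseteq> carrier G \<Longrightarrow> x \<in> K \<Longrightarrow> avg ts (avg ss f) x = avg ss (avg ts f) x"
proof (induction ss arbitrary: x)
  case Nil
  then show ?case by (auto intro: avg_cong)
next
  case (Cons s ss)
  have "avg ts (avg (s # ss) f) x = avg ts (\<lambda>x. (1/2) *\<^sub>R (avg ss f x + avg ss f (act s x))) x"
    by (rule arg_cong[where f = "\<lambda>g. avg ts g x"]) auto
  also have "\<dots> = (1/2) *\<^sub>R (avg ts (avg ss f) x + avg ts (\<lambda>x. avg ss f (act s x)) x)"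
    by (simp add: avg_linear[OF bounded_linear_scaleR_right] avg_add)
  also have "avg ts (\<lambda>x. avg ss f (act s x)) x = avg ts (avg ss f) (act s x)"
    using Cons.prems by (intro avg_compose) (auto simp: act_closed act_commute)
  finally show ?case using Cons by (simp add: act_closed)
qed

lemma continuous_on_avg:
  fixes f :: "'a \<Rightarrow> 'b::real_normed_vector"
  assumes "set ts \<subseteq> carrier G" "continuous_on K f" shows "continuous_on K (avg ts f)"
  using assms(1)
proof (induction ts)
  case Nil
  then show ?case using assms by (simp cong: continuous_on_cong)
next
  case (Cons t ts)
  have "continuous_on K (\<lambda>x. avg ts f (act t x))"
    by (rule continuous_on_compose2[of K "avg ts f"]) (use Cons in \<open>auto simp: act_closed act_cont\<close>)
  then show ?case using Cons by (auto intro!: continuous_intros)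
qed

lemma has_meanE:
  assumes "has_mean f c" "e > 0"
  obtains ts where "set ts \<subseteq> carrier G" "\<And>x. x \<in> K \<Longrightarrow> norm (avg ts f x - c) < e"
proof -
  from assms have "\<exists>ts. set ts \<subseteq> carrier G \<and> (\<forall>x\<in>K. norm (avg ts f x - c) < e)"
    unfolding has_mean_def by simp
  then show ?thesis using that by blast
qed

text \<open>Since averages commute, and since averaging keeps a function that is close to a constant
  close to it, one average can serve two functions.  Additivity, monotonicity and
  uniqueness of the mean all rest on this.\<close>

lemma has_mean_joint:
  assumes "has_mean f c" "has_mean g d" "e > 0"
  obtains ts where "set ts \<subseteq> carrier G" "\<And>x. x \<in> K \<Longrightarrow> norm (avg ts f x - c) < e"
    "\<And>x. x \<in> K \<Longrightarrow> norm (avg ts g x - d) < e"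
proof -
  obtain ts where ts: "set ts \<subseteq> carrier G" "\<And>x. x \<in> K \<Longrightarrow> norm (avg ts f x - c) < e"
    using has_meanE[OF assms(1,3)] by metis
  obtain ss where ss: "set ss \<subseteq> carrier G" "\<And>x. x \<in> K \<Longrightarrow> norm (avg ss g x - d) < e"
    using has_meanE[OF assms(2,3)] by metis
  have "norm (avg (ts @ ss) f x - c) < e" if "x \<in> K" for x
    using avg_near[OF ss(1) ts(2) that] avg_commute[OF ts(1) ss(1) that, of f] by (simp add: avg_append)
  moreover have "norm (avg (ts @ ss) g x - d) < e" if "x \<in> K" for x
    using avg_near[OF ts(1) ss(2) that] by (simp add: avg_append)
  ultimately show ?thesis using that[of "ts @ ss"] ts ss by auto
qed

lemma has_mean_add:
  assumes "has_mean f c" "has_mean g d" shows "has_mean (\<lambda>x. f x + g x) (c + d)"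
  unfolding has_mean_def
proof (intro allI impI)
  fix e :: real assume "e > 0"
  then obtain ts where ts: "set ts \<subseteq> carrier G" "\<And>x. x \<in> K \<Longrightarrow> norm (avg ts f x - c) < e / 2"
    "\<And>x. x \<in> K \<Longrightarrow> norm (avg ts g x - d) < e / 2"
    using has_mean_joint[OF assms, of "e / 2"] by auto
  have "norm (avg ts (\<lambda>x. f x + g x) x - (c + d)) < e" if "x \<in> K" for x
    using norm_diff_triangle_ineq[of "avg ts f x" "avg ts g x" c d] ts(2,3)[OF that] by (simp add: avg_add)
  then show "\<exists>ts. set ts \<subseteq> carrier G \<and> (\<forall>x\<in>K. norm (avg ts (\<lambda>x. f x + g x) x - (c + d)) < e)"
    using ts(1) by auto
qed

lemma has_mean_const: "has_mean (\<lambda>x. c) c"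
  unfolding has_mean_def by (auto simp: avg_const intro!: exI[of _ "[]"])

lemma has_mean_linear:
  assumes "bounded_linear L" "has_mean f c" shows "has_mean (\<lambda>x. L (f x)) (L c)"
  unfolding has_mean_def
proof (intro allI impI)
  fix e :: real assume "e > 0"
  interpret L: bounded_linear L by fact
  obtain B where B: "B > 0" "\<And>x. norm (L x) \<le> norm x * B" using L.pos_bounded by auto
  obtain ts where ts: "set ts \<subseteq> carrier G" "\<And>x. x \<in> K \<Longrightarrow> norm (avg ts f x - c) < e / B"
    using has_meanE[OF assms(2), of "e / B"] B \<open>e > 0\<close> by auto
  have "norm (avg ts (\<lambda>x. L (f x)) x - L c) < e" if "x \<in> K" for x
  proof -
    have "norm (avg ts (\<lambda>x. L (f x)) x - L c) \<le> norm (avg ts f x - c) * B"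
      using B(2)[of "avg ts f x - c"] by (simp add: avg_linear[OF assms(1)] L.diff)
    also have "\<dots> < e" using ts(2)[OF that] B(1) by (simp add: field_simps)
    finally show ?thesis .
  qed
  then show "\<exists>ts. set ts \<subseteq> carrier G \<and> (\<forall>x\<in>K. norm (avg ts (\<lambda>x. L (f x)) x - L c) < e)"
    using ts(1) by auto
qed

lemma has_mean_cong:
  assumes "has_mean f c" "\<And>x. x \<in> K \<Longrightarrow> f x = g x" shows "has_mean g c"
proof -
  have "avg ts g x = avg ts f x" if "set ts \<subseteq> carrier G" "x \<in> K" for ts x
    using avg_cong[OF that(1) assms(2) that(2)] by simp
  then show ?thesis using assms(1) by (simp add: has_mean_def cong: conj_cong)
qed

lemma has_mean_compose:
  assumes "has_mean f c" "\<And>x. x \<in> K \<Longrightarrow> k x \<in> K"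
    and "\<And>t x. t \<in> carrier G \<Longrightarrow> x \<in> K \<Longrightarrow> k (act t x) = act t (k x)"
  shows "has_mean (\<lambda>x. f (k x)) c"
  unfolding has_mean_def
proof (intro allI impI)
  fix e :: real assume "e > 0"
  then obtain ts where "set ts \<subseteq> carrier G" "\<And>x. x \<in> K \<Longrightarrow> norm (avg ts f x - c) < e"
    using has_meanE[OF assms(1)] by metis
  then show "\<exists>ts. set ts \<subseteq> carrier G \<and> (\<forall>x\<in>K. norm (avg ts (\<lambda>x. f (k x)) x - c) < e)"
    using assms(2) by (intro exI[of _ ts]) (auto simp: avg_compose[OF assms(2,3)])
qed

text \<open>The mean is \<open>1\<close>-Lipschitz for the supremum distance; taking \<open>f = g\<close> gives uniqueness.\<close>

lemma has_mean_near:
  assumes "has_mean f c" "has_mean g d" "\<And>x. x \<in> K \<Longrightarrow> norm (f x - g x) < e"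
  shows "norm (c - d) \<le> e"
proof (rule field_le_epsilon)
  fix r :: real assume "r > 0"
  obtain ts where ts: "set ts \<subseteq> carrier G" "\<And>x. x \<in> K \<Longrightarrow> norm (avg ts f x - c) < r / 2"
    "\<And>x. x \<in> K \<Longrightarrow> norm (avg ts g x - d) < r / 2"
    using has_mean_joint[OF assms(1,2), of "r / 2"] \<open>r > 0\<close> by auto
  obtain x where x: "x \<in> K" using nonempty by auto
  have "avg ts (\<lambda>x. f x - g x) x = avg ts f x - avg ts g x"
    using avg_add[of ts f "\<lambda>x. - g x" x] avg_linear[OF bounded_linear_minus[OF bounded_linear_ident], of ts g x]
    by simp
  then have "norm (avg ts f x - avg ts g x) < e"
    using avg_near[OF ts(1), of "\<lambda>x. f x - g x" 0 e x] assms(3) x by simp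
  then show "norm (c - d) \<le> e + r"
    using ts(2,3)[OF x] by norm
qed

lemma has_mean_unique: "has_mean f c \<Longrightarrow> has_mean f d \<Longrightarrow> c = d"
  using has_mean_near[of f c f d] field_le_epsilon[of "norm (c - d)" 0] by auto

lemma has_mean_mono:
  fixes f g :: "'a \<Rightarrow> real"
  assumes "has_mean f c" "has_mean g d" "\<And>x. x \<in> K \<Longrightarrow> f x \<le> g x" shows "c \<le> d"
proof (rule field_le_epsilon)
  fix r :: real assume "r > 0"
  obtain ts where ts: "set ts \<subseteq> carrier G" "\<And>x. x \<in> K \<Longrightarrow> norm (avg ts f x - c) < r / 2"
    "\<And>x. x \<in> K \<Longrightarrow> norm (avg ts g x - d) < r / 2"
    using has_mean_joint[OF assms(1,2), of "r / 2"] \<open>r > 0\<close> by auto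
  obtain x where x: "x \<in> K" using nonempty by auto
  show "c \<le> d + r"
    using ts(2,3)[OF x] avg_mono[of ts f g x] assms(3) ts(1) x
    unfolding real_norm_def by (smt (verit) field_sum_of_halves)
qed

text \<open>The means of approximating functions form a Cauchy sequence, and their limit is the mean of \<open>f\<close>.\<close>

lemma has_mean_uniform_limit:
  fixes f :: "'a \<Rightarrow> 'b::banach"
  assumes approx: "\<And>e. e > 0 \<Longrightarrow> \<exists>g d. has_mean g d \<and> (\<forall>x\<in>K. norm (f x - g x) < e)"
  obtains c where "has_mean f c"
proof -
  have "\<forall>n. \<exists>g d. has_mean g d \<and> (\<forall>x\<in>K. norm (f x - g x) < inverse (Suc n))"
    using approx by simp
  then obtain g d where gd: "\<And>n. has_mean (g n) (d n)"
    "\<And>n x. x \<in> K \<Longrightarrow> norm (f x - g n x) < inverse (Suc n)" by metis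
  have dd: "norm (d m - d n) \<le> inverse (Suc m) + inverse (Suc n)" for m n
  proof (rule has_mean_near[OF gd(1) gd(1)])
    fix x assume "x \<in> K"
    then show "norm (g m x - g n x) < inverse (real (Suc m)) + inverse (real (Suc n))"
      using gd(2)[of x m] gd(2)[of x n] norm_triangle_ineq4[of "f x - g n x" "f x - g m x"] by simp
  qed
  have "Cauchy d"
    unfolding Cauchy_altdef2
  proof (intro allI impI)
    fix e :: real assume "e > 0"
    then obtain N where N: "inverse (real (Suc N)) < e / 2" using reals_Archimedean[of "e / 2"] by auto
    have "dist (d n) (d N) < e" if "n \<ge> N" for n
    proof -
      have "inverse (real (Suc n)) \<le> inverse (real (Suc N))" using that by (simp add: field_simps)
      then show ?thesis using dd[of n N] N unfolding dist_norm by linarith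
    qed
    then show "\<exists>N. \<forall>n\<ge>N. dist (d n) (d N) < e" by auto
  qed
  then obtain c where c: "d \<longlonglongrightarrow> c" using Cauchy_convergent convergent_def by blast
  have "has_mean f c"
    unfolding has_mean_def
  proof (intro allI impI)
    fix e :: real assume "e > 0"
    have "(\<lambda>n. inverse (real (Suc n))) \<longlonglongrightarrow> 0" by (rule LIMSEQ_inverse_real_of_nat)
    then have "\<forall>\<^sub>F n in sequentially. inverse (real (Suc n)) < e / 3"
      using \<open>e > 0\<close> by (intro order_tendstoD) auto
    moreover have "\<forall>\<^sub>F n in sequentially. dist (d n) c < e / 3"
      using c \<open>e > 0\<close> by (intro tendstoD) auto
    ultimately have "\<forall>\<^sub>F n in sequentially. inverse (real (Suc n)) < e / 3 \<and> dist (d n) c < e / 3"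
      by (rule eventually_conj)
    then obtain n where n: "inverse (real (Suc n)) < e / 3" "dist (d n) c < e / 3"
      by (auto dest: eventually_happens)
    obtain ts where ts: "set ts \<subseteq> carrier G" "\<And>x. x \<in> K \<Longrightarrow> norm (avg ts (g n) x - d n) < e / 3"
      using has_meanE[OF gd(1), of "e / 3"] \<open>e > 0\<close> by (metis divide_pos_pos zero_less_numeral)
    have "norm (avg ts f x - c) < e" if "x \<in> K" for x
    proof -
      have "avg ts (\<lambda>x. f x - g n x) x = avg ts f x - avg ts (g n) x"
        using avg_add[of ts f "\<lambda>x. - g n x" x]
          avg_linear[OF bounded_linear_minus[OF bounded_linear_ident], of ts "g n" x] by simp
      then have "norm (avg ts f x - avg ts (g n) x) < e / 3"
        using avg_near[OF ts(1), of "\<lambda>x. f x - g n x" 0 "e / 3" x] gd(2)[of _ n] n(1) that by force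
      moreover have "norm (avg ts f x - c) \<le> norm (avg ts f x - avg ts (g n) x) + norm (avg ts (g n) x - d n) + norm (d n - c)"
        by norm
      ultimately show ?thesis using ts(2)[OF that] n(2) unfolding dist_norm by linarith
    qed
    then show "\<exists>ts. set ts \<subseteq> carrier G \<and> (\<forall>x\<in>K. norm (avg ts f x - c) < e)" using ts(1) by auto
  qed
  then show ?thesis using that by blast
qed

lemma integrable_continuous:
  fixes f :: "'a \<Rightarrow> real"
  assumes M: "invariant_probability G (top_of_set K) act M" and f: "continuous_on K f"
  shows "integrable M f"
proof -
  interpret prob_space M using M by (simp add: invariant_probability_def)
  have sp: "space M = K" "sets M = borel_sets (top_of_set K)" using M by (auto simp: invariant_probability_def)
  have "bounded (f ` K)" using compact_continuous_image[OF f compact] compact_imp_bounded by blast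
  then obtain B where "\<And>x. x \<in> K \<Longrightarrow> norm (f x) \<le> B" by (auto simp: bounded_iff)
  moreover have "f \<in> borel_measurable M"
    using sp f by (intro continuous_map_borel_measurable[of M "top_of_set K"]) auto
  ultimately show ?thesis using sp by (intro integrable_const_bound[where B = B]) auto
qed

lemma integral_act:
  fixes f :: "'a \<Rightarrow> real"
  assumes M: "invariant_probability G (top_of_set K) act M" and f: "continuous_on K f" and t: "t \<in> carrier G"
  shows "(\<integral>x. f (act t x) \<partial>M) = (\<integral>x. f x \<partial>M)"
proof -
  have sp: "space M = K" "sets M = borel_sets (top_of_set K)" using M by (auto simp: invariant_probability_def)
  have meas: "act t \<in> measurable M M"
    using sp act_cont[OF t] act_closed[OF t]
    by (intro continuous_map_measurable_borel_sets[of M "top_of_set K" M "top_of_set K"]) auto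
  have "distr M M (act t) = M"
    using M t meas by (intro measure_eqI) (auto simp: emeasure_distr invariant_probability_def)
  moreover have "f \<in> borel_measurable M"
    using sp f by (intro continuous_map_borel_measurable[of M "top_of_set K"]) auto
  ultimately show ?thesis using integral_distr[OF meas, of f] by simp
qed

text \<open>Averaging does not change the integral for an invariant probability, and brings the integrand
  uniformly close to the constant \<open>c\<close>.\<close>

lemma integral_eq_mean:
  fixes f :: "'a \<Rightarrow> real"
  assumes M: "invariant_probability G (top_of_set K) act M" and f: "continuous_on K f" and c: "has_mean f c"
  shows "(\<integral>x. f x \<partial>M) = c"
proof -
  interpret prob_space M using M by (simp add: invariant_probability_def)
  have sp: "space M = K" using M by (auto simp: invariant_probability_def)
  have avg: "(\<integral>x. avg ts f x \<partial>M) = (\<integral>x. f x \<partial>M)" if "set ts \<subseteq> carrier G" for ts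
    using that
  proof (induction ts)
    case (Cons t ts)
    have c1: "continuous_on K (avg ts f)" using Cons f by (auto intro: continuous_on_avg)
    have c2: "continuous_on K (\<lambda>x. avg ts f (act t x))"
      by (rule continuous_on_compose2[of K "avg ts f"]) (use Cons c1 in \<open>auto simp: act_closed act_cont\<close>)
    have "(\<integral>x. avg (t # ts) f x \<partial>M) = (1/2) * ((\<integral>x. avg ts f x \<partial>M) + (\<integral>x. avg ts f (act t x) \<partial>M))"
      using integrable_continuous[OF M c1] integrable_continuous[OF M c2] by simp
    then show ?case using Cons integral_act[OF M c1, of t] by simp
  qed (simp add: avg_Nil)
  have "norm ((\<integral>x. f x \<partial>M) - c) \<le> e" if "e > 0" for e
  proof -
    obtain ts where ts: "set ts \<subseteq> carrier G" "\<And>x. x \<in> K \<Longrightarrow> norm (avg ts f x - c) < e"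
      using has_meanE[OF c \<open>e > 0\<close>] by metis
    have int: "integrable M (avg ts f)" using integrable_continuous[OF M] continuous_on_avg[OF ts(1) f] .
    have "(\<integral>x. f x \<partial>M) - c = (\<integral>x. avg ts f x - c \<partial>M)" using avg[OF ts(1)] int by (simp add: prob_space)
    also have "norm \<dots> \<le> (\<integral>x. norm (avg ts f x - c) \<partial>M)" by (rule integral_norm_bound)
    also have "\<dots> \<le> (\<integral>x. e \<partial>M)"
      using int ts(2) sp by (intro integral_mono) (auto simp: less_imp_le)
    finally show ?thesis by (simp add: prob_space)
  qed
  then have "norm ((\<integral>x. f x \<partial>M) - c) \<le> 0" by (rule field_le_epsilon) simp
  then show ?thesis by simp
qed

end

text \<open>The situation in which the mean is a functional on all continuous functions.  Inverses are
  required because an invariant measure is compared with its image under \<open>act t\<close> through open sets,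
  in both directions.\<close>

locale mean_system = commuting_maps G K act
  for G :: "('g, 'm) monoid_scheme" and K :: "'a::t2_space set" and act :: "'g \<Rightarrow> 'a \<Rightarrow> 'a" +
  assumes ex_mean: "continuous_on K (f :: 'a \<Rightarrow> real) \<Longrightarrow> \<exists>c. has_mean f c"
    and act_inverse: "t \<in> carrier G \<Longrightarrow> \<exists>s\<in>carrier G. \<forall>x\<in>K. act s (act t x) = x \<and> act t (act s x) = x"
begin

definition mean :: "('a \<Rightarrow> real) \<Rightarrow> real" where "mean f = (THE c. has_mean f c)"

lemma mean_eq:
  assumes "has_mean f c" shows "mean f = c"
  unfolding mean_def by (rule the_equality[of "has_mean f", OF assms has_mean_unique[OF _ assms]])

lemma has_mean_mean: "continuous_on K f \<Longrightarrow> has_mean f (mean f)"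
  using ex_mean[of f] mean_eq[of f] by auto

sublocale normalised_functional K mean
proof
  show "compact K" by (rule compact)
  show "mean (\<lambda>x. f x + g x) = mean f + mean g" if "continuous_on K f" "continuous_on K g" for f g
    using mean_eq[OF has_mean_add[OF has_mean_mean has_mean_mean]] that .
  show "mean (\<lambda>x. c * f x) = c * mean f" if "continuous_on K f" for f c
    using mean_eq[OF has_mean_linear[OF bounded_linear_mult_right has_mean_mean[OF that]]] .
  show "mean f \<le> mean g" if "continuous_on K f" "continuous_on K g" "\<And>x. x \<in> K \<Longrightarrow> f x \<le> g x" for f g
    using has_mean_mono[OF has_mean_mean[OF that(1)] has_mean_mean[OF that(2)] that(3)] .
  show "mean (\<lambda>x. 1) = 1" using mean_eq[OF has_mean_const] .
qed

lemma mean_compose: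
  assumes "continuous_on K f" "\<And>x. x \<in> K \<Longrightarrow> k x \<in> K"
    and "\<And>t x. t \<in> carrier G \<Longrightarrow> x \<in> K \<Longrightarrow> k (act t x) = act t (k x)"
  shows "mean (\<lambda>x. f (k x)) = mean f"
  using mean_eq[OF has_mean_compose[OF has_mean_mean[OF assms(1)] assms(2,3)]] .

text \<open>A mean that is invariant under a transitive set of maps charges every nonempty open set, whereas
  the mean of a function vanishing on \<open>H\<close> can be computed at a point of \<open>H\<close>, where all averages
  are \<open>0\<close>.\<close>

lemma closed_invariant_eq:
  assumes H: "closedin (top_of_set K) H" "H \<noteq> {}" "\<And>t x. t \<in> carrier G \<Longrightarrow> x \<in> H \<Longrightarrow> act t x \<in> H"
    and trans: "\<And>x y. x \<in> K \<Longrightarrow> y \<in> K \<Longrightarrow> \<exists>k. continuous_on K k \<and> k ` K \<subseteq> K \<and> k x = y \<and>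
      (\<forall>t\<in>carrier G. \<forall>z\<in>K. k (act t z) = act t (k z))"
  shows "H = K"
proof (rule ccontr)
  assume "H \<noteq> K"
  moreover have HK: "H \<subseteq> K" using H(1) closedin_subset by fastforce
  ultimately obtain y where y: "y \<in> K - H" by auto
  have "openin (top_of_set K) (K - H)" using H(1) by (simp add: openin_diff openin_subtopology_self)
  then obtain f where f: "f \<in> minorants (K - H)" "f y = 1" using Urysohn_minorant y by blast
  have contf: "continuous_on K f" and f0: "\<And>x. x \<in> K \<Longrightarrow> f x \<ge> 0" and fH: "\<And>x. x \<in> H \<Longrightarrow> f x = 0"
    using f(1) HK by (auto simp: minorants_def)
  have avg0: "avg ts f x = 0" if "set ts \<subseteq> carrier G" "x \<in> H" for ts x
    using that H(3) fH by (induction ts arbitrary: x) auto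
  have mean0: "mean f = 0"
  proof -
    obtain x where x: "x \<in> H" using H(2) by auto
    have "norm (mean f) \<le> e" if "e > 0" for e
      using has_meanE[OF has_mean_mean[OF contf] that] avg0[OF _ x] x HK
      by (metis abs_minus_cancel diff_0 less_imp_le real_norm_def subsetD)
    then show ?thesis using field_le_epsilon[of "norm (mean f)" 0] by auto
  qed
  have "\<exists>k. continuous_on K k \<and> k ` K \<subseteq> K \<and> k x = y \<and> (\<forall>t\<in>carrier G. \<forall>z\<in>K. k (act t z) = act t (k z))"
    if "x \<in> K" for x using trans that y by auto
  then obtain k where k: "\<And>x. x \<in> K \<Longrightarrow> continuous_on K (k x)" "\<And>x. x \<in> K \<Longrightarrow> k x ` K \<subseteq> K"
    "\<And>x. x \<in> K \<Longrightarrow> k x x = y" "\<And>x t z. x \<in> K \<Longrightarrow> t \<in> carrier G \<Longrightarrow> z \<in> K \<Longrightarrow> k x (act t z) = act t (k x z)"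
    by metis
  \<comment> \<open>\<open>k x\<close> moves \<open>x\<close> to \<open>y\<close>, where \<open>f\<close> is \<open>1\<close>; so \<open>x\<close> lies in \<open>W x\<close>.\<close>
  define W where "W x = {z \<in> K. f (k x z) > 1/2}" for x
  have contfk: "continuous_on K (\<lambda>z. f (k x z))" if "x \<in> K" for x
    using contf k(1,2)[OF that] by (rule continuous_on_compose2)
  have "openin (top_of_set K) (W x)" if "x \<in> K" for x
  proof -
    have "openin (top_of_set K) (K \<inter> (\<lambda>z. f (k x z)) -` {1/2<..})"
      using contfk[OF that] by (intro continuous_openin_preimage_gen) auto
    moreover have "W x = K \<inter> (\<lambda>z. f (k x z)) -` {1/2<..}" by (auto simp: W_def)
    ultimately show ?thesis by simp
  qed
  moreover have "K \<subseteq> \<Union>(W ` K)" using k(3) f(2) by (force simp: W_def)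
  ultimately have "\<exists>D\<subseteq>W ` K. finite D \<and> K \<subseteq> \<Union>D"
    using compact_K[unfolded compact_eq_openin_cover, rule_format, of "W ` K"] by auto
  then obtain F where F: "F \<subseteq> K" "finite F" "K \<subseteq> \<Union>(W ` F)" by (metis finite_subset_image)
  have "1/2 \<le> (\<Sum>x\<in>F. f (k x z))" if "z \<in> K" for z
  proof -
    obtain x where x: "x \<in> F" "z \<in> W x" using F(3) \<open>z \<in> K\<close> by auto
    have "f (k x z) \<le> (\<Sum>x\<in>F. f (k x z))"
      using F x f0 k(2) that by (intro member_le_sum) (auto simp: image_subset_iff)
    then show ?thesis using x(2) by (simp add: W_def)
  qed
  then have "mean (\<lambda>z. 1/2) \<le> mean (\<lambda>z. \<Sum>x\<in>F. f (k x z))"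
    using F contfk by (intro I_mono continuous_on_sum) auto
  also have "\<dots> = (\<Sum>x\<in>F. mean (\<lambda>z. f (k x z)))"
    using F contfk by (intro I_sum) auto
  also have "\<dots> = 0"
  proof (rule sum.neutral, rule ballI)
    fix x assume "x \<in> F"
    then have "x \<in> K" using F by auto
    then show "mean (\<lambda>z. f (k x z)) = 0"
      using mean_compose[OF contf, of "k x"] k(2,4) mean0 by (auto simp: image_subset_iff)
  qed
  finally show False using I_const by simp
qed

lemma inner_content_preimage:
  assumes k: "continuous_on K k" "k ` K \<subseteq> K" "\<And>t x. t \<in> carrier G \<Longrightarrow> x \<in> K \<Longrightarrow> k (act t x) = act t (k x)"
  shows "inner_content U \<le> inner_content (k -` U \<inter> K)"
proof (rule inner_content_leI)
  fix f assume f: "f \<in> minorants U"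
  then have contf: "continuous_on K f" by (simp add: minorants_def)
  have "(\<lambda>x. f (k x)) \<in> minorants (k -` U \<inter> K)"
    using f k(2) continuous_on_compose2[OF contf k(1,2)] by (auto simp: minorants_def)
  then show "mean f \<le> inner_content (k -` U \<inter> K)"
    using I_le_inner_content mean_compose[OF contf, of k] k(2,3) by (metis image_subset_iff)
qed

text \<open>A homeomorphism \<open>k\<close> of \<open>K\<close> with inverse \<open>k'\<close> that commutes with all \<open>act t\<close>.  On the dual
  group this covers the translations by arbitrary elements, not only those that come from \<open>G\<close>.\<close>

definition commuting_homeo :: "('a \<Rightarrow> 'a) \<Rightarrow> ('a \<Rightarrow> 'a) \<Rightarrow> bool" where
  "commuting_homeo k k' \<longleftrightarrow>
     continuous_on K k \<and> k ` K \<subseteq> K \<and> continuous_on K k' \<and> k' ` K \<subseteq> K \<and>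
     (\<forall>x\<in>K. k (k' x) = x \<and> k' (k x) = x) \<and>
     (\<forall>t\<in>carrier G. \<forall>x\<in>K. k (act t x) = act t (k x) \<and> k' (act t x) = act t (k' x))"

proposition invariant_measure_exists:
  "\<exists>M. invariant_probability G (top_of_set K) act M \<and>
     (\<forall>U. openin (top_of_set K) U \<longrightarrow> emeasure M U = ennreal (inner_content U)) \<and>
     (\<forall>k k' B. commuting_homeo k k' \<longrightarrow> B \<in> sets M \<longrightarrow> emeasure M (k -` B \<inter> K) = emeasure M B)"
proof -
  obtain M where M: "space M = K" "sets M = borel_sets (top_of_set K)"
    "\<And>U. openin (top_of_set K) U \<Longrightarrow> emeasure M U = ennreal (inner_content U)"
    using representing_measure by metis
  have "emeasure M (space M) = 1" using M by (simp add: inner_content_space)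
  then interpret prob_space M by (rule prob_spaceI)
  have inv: "emeasure M (k -` B \<inter> K) = emeasure M B"
    if homeo: "commuting_homeo k k'" and B: "B \<in> sets M" for k k' B
  proof -
    have k: "continuous_on K k" "k ` K \<subseteq> K" and k': "continuous_on K k'" "k' ` K \<subseteq> K"
      and kk: "\<And>x. x \<in> K \<Longrightarrow> k (k' x) = x" "\<And>x. x \<in> K \<Longrightarrow> k' (k x) = x"
      and com: "\<And>t x. t \<in> carrier G \<Longrightarrow> x \<in> K \<Longrightarrow> k (act t x) = act t (k x)"
        "\<And>t x. t \<in> carrier G \<Longrightarrow> x \<in> K \<Longrightarrow> k' (act t x) = act t (k' x)"
      using homeo by (auto simp: commuting_homeo_def)
    have meas: "k \<in> measurable M M"
      using M k by (intro continuous_map_measurable_borel_sets[of M "top_of_set K" M "top_of_set K"])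
        (auto simp: image_subset_iff)
    have "distr M M k = M"
    proof (rule borel_measure_eqI[where X = "top_of_set K"])
      show "finite_measure (distr M M k)" using prob_space_distr[OF meas] prob_space.finite_measure by auto
      show "finite_measure M" by unfold_locales
      show "space (distr M M k) = topspace (top_of_set K)" "space M = topspace (top_of_set K)"
        "sets (distr M M k) = borel_sets (top_of_set K)" "sets M = borel_sets (top_of_set K)"
        using M by auto
      fix U assume U: "openin (top_of_set K) U"
      then have UK: "U \<subseteq> K" using openin_subset by fastforce
      have op: "openin (top_of_set K) (k -` U \<inter> K)"
        using k U by (metis Int_commute continuous_openin_preimage image_subset_iff_funcset)
      have "k' -` (k -` U \<inter> K) \<inter> K = U" using UK kk k'(2) by (auto simp: image_subset_iff subset_iff)
      then have "inner_content (k -` U \<inter> K) = inner_content U"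
        using inner_content_preimage[OF k com(1), of U] inner_content_preimage[OF k' com(2), of "k -` U \<inter> K"]
        by simp
      then show "emeasure (distr M M k) U = emeasure M U"
        using M op U openin_borel_sets[OF U] by (simp add: emeasure_distr[OF meas])
    qed
    then show ?thesis using emeasure_distr[OF meas B] M(1) by simp
  qed
  have "invariant_probability G (top_of_set K) act M"
    unfolding invariant_probability_def
  proof (intro conjI ballI)
    show "prob_space M" by unfold_locales
    show "space M = topspace (top_of_set K)" "sets M = borel_sets (top_of_set K)" using M by auto
    fix t B assume t: "t \<in> carrier G" and B: "B \<in> sets M"
    obtain s where s: "s \<in> carrier G" "\<And>x. x \<in> K \<Longrightarrow> act s (act t x) = x" "\<And>x. x \<in> K \<Longrightarrow> act t (act s x) = x"
      using act_inverse[OF t] by auto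
    show "emeasure M (act t -` B \<inter> space M) = emeasure M B"
      unfolding M(1) using t s act_closed act_cont act_commute
      by (intro inv[OF _ B, of "act t" "act s"]) (auto simp: commuting_homeo_def)
  qed
  then show ?thesis using M(3) inv by (intro exI[of _ M]) auto
qed

lemma integral_eq_mean_functional:
  assumes "invariant_probability G (top_of_set K) act M" "continuous_on K f"
  shows "(\<integral>x. f x \<partial>M) = mean f"
  using integral_eq_mean[OF assms has_mean_mean[OF assms(2)]] .

lemma minorant_le_emeasure:
  assumes M: "invariant_probability G (top_of_set K) act M" and U: "U \<in> sets M" and f: "f \<in> minorants U"
  shows "mean f \<le> measure M U"
proof -
  interpret prob_space M using M by (simp add: invariant_probability_def)
  have sp: "space M = K" using M by (auto simp: invariant_probability_def)
  have contf: "continuous_on K f" using f by (simp add: minorants_def)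
  have "mean f = (\<integral>x. f x \<partial>M)" using integral_eq_mean_functional[OF M contf] by simp
  also have "\<dots> \<le> (\<integral>x. indicator U x \<partial>M)"
  proof (rule integral_mono)
    show "integrable M f" by (rule integrable_continuous[OF M contf])
    show "integrable M (indicator U :: _ \<Rightarrow> real)" using U by (simp add: emeasure_eq_measure)
    show "f x \<le> indicator U x" if "x \<in> space M" for x
      using f that sp by (auto simp: minorants_def indicator_def)
  qed
  also have "\<dots> = measure M U" using U sets.sets_into_space by (simp add: Int_absorb2)
  finally show ?thesis .
qed

lemma inner_content_le_measure:
  assumes "invariant_probability G (top_of_set K) act M" "U \<in> sets M"
  shows "inner_content U \<le> measure M U"
  using minorant_le_emeasure[OF assms] by (rule inner_content_leI)

text \<open>The indicator of \<open>W\<close> is the increasing limit of the functions \<open>min 1 (n * f)\<close>, whose integrals are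
  means.  This is an upper bound on the measure that holds without any regularity of \<open>M\<close>.\<close>

lemma measure_cozero_le:
  fixes f :: "'a \<Rightarrow> real"
  assumes M: "invariant_probability G (top_of_set K) act M" and f: "continuous_on K f" "\<And>x. x \<in> K \<Longrightarrow> f x \<ge> 0"
    and W: "W = {x \<in> K. f x > 0}"
  shows "measure M W \<le> inner_content W"
proof -
  interpret prob_space M using M by (simp add: invariant_probability_def)
  have sp: "space M = K" "sets M = borel_sets (top_of_set K)" using M by (auto simp: invariant_probability_def)
  have "openin (top_of_set K) (K \<inter> f -` {0<..})"
    using f by (intro continuous_openin_preimage_gen) auto
  moreover have "W = K \<inter> f -` {0<..}" using W by auto
  ultimately have Ws: "W \<in> sets M" using sp openin_borel_sets by metis
  define g where "g n x = min 1 (real n * f x)" for n x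
  have contg: "continuous_on K (g n)" for n unfolding g_def using f by (intro continuous_intros)
  have gm: "g n \<in> minorants W" for n
    using contg f(2) W by (auto simp: minorants_def g_def) (force simp: min_def)+
  have lim: "(\<lambda>n. \<integral>x. g n x \<partial>M) \<longlonglongrightarrow> (\<integral>x. indicator W x \<partial>M)"
  proof (rule integral_dominated_convergence[where w = "\<lambda>x. 1"])
    show "g n \<in> borel_measurable M" for n using integrable_continuous[OF M contg] by auto
    show "AE x in M. (\<lambda>n. g n x) \<longlonglongrightarrow> indicator W x"
    proof (rule AE_I2)
      fix x assume "x \<in> space M"
      then have x: "x \<in> K" using sp by simp
      show "(\<lambda>n. g n x) \<longlonglongrightarrow> indicator W x"
      proof (cases "f x > 0")
        case True
        then obtain N where N: "1 / f x \<le> real N" using real_arch_simple by blast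
        have "g n x = indicator W x" if "n \<ge> N" for n
        proof -
          have "1 / f x \<le> real n" using N that by linarith
          then show ?thesis using True x W by (simp add: g_def field_simps)
        qed
        then show ?thesis by (intro tendsto_eventually eventually_sequentiallyI[of N])
      next
        case False
        then have "f x = 0" using f(2)[OF x] by simp
        then show ?thesis using W by (simp add: g_def)
      qed
    qed
    show "AE x in M. norm (g n x) \<le> 1" for n
      using gm[of n] sp by (intro AE_I2) (auto simp: minorants_def)
  qed (use Ws in auto)
  have "(\<integral>x. g n x \<partial>M) \<le> inner_content W" for n
    using integral_eq_mean_functional[OF M contg] I_le_inner_content[OF gm] by simp
  then have "(\<integral>x. indicator W x \<partial>M) \<le> inner_content W" using LIMSEQ_le_const2[OF lim] by auto
  moreover have "(\<integral>x. indicator W x \<partial>M) = measure M W" using Ws sets.sets_into_space by (simp add: Int_absorb2)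
  ultimately show ?thesis by simp
qed

end

section \<open>The dual of a discrete group of characters\<close>

text \<open>The separation axioms for the product topology on function types let the dual group be treated
  as a compact subset of a Hausdorff type, to which the Stone-Weierstrass theorem applies.\<close>

lemma open_fun_vimage_eval: "open U \<Longrightarrow> open ((\<lambda>h :: 'a \<Rightarrow> 'b::topological_space. h a) -` U)"
  by (rule open_vimage[OF _ continuous_on_product_coordinates])

instance "fun" :: (type, t0_space) t0_space
proof
  fix f g :: "'a \<Rightarrow> 'b" assume "f \<noteq> g"
  then obtain a where "f a \<noteq> g a" by auto
  then obtain U where "open U" "\<not> (f a \<in> U \<longleftrightarrow> g a \<in> U)" using separation_t0[of "f a" "g a"] by auto
  then show "\<exists>U. open U \<and> \<not> (f \<in> U \<longleftrightarrow> g \<in> U)"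
    using open_fun_vimage_eval[of U a] by (intro exI[of _ "(\<lambda>h. h a) -` U"]) auto
qed

instance "fun" :: (type, t1_space) t1_space
proof
  fix f g :: "'a \<Rightarrow> 'b" assume "f \<noteq> g"
  then obtain a where "f a \<noteq> g a" by auto
  then obtain U where "open U" "f a \<in> U" "g a \<notin> U" using separation_t1[of "f a" "g a"] by auto
  then show "\<exists>U. open U \<and> f \<in> U \<and> g \<notin> U"
    using open_fun_vimage_eval[of U a] by (intro exI[of _ "(\<lambda>h. h a) -` U"]) auto
qed

instance "fun" :: (type, t2_space) t2_space
proof
  fix f g :: "'a \<Rightarrow> 'b" assume "f \<noteq> g"
  then obtain a where "f a \<noteq> g a" by auto
  then obtain U V where UV: "open U" "open V" "f a \<in> U" "g a \<in> V" "U \<inter> V = {}" using hausdorff by metis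
  then show "\<exists>U V. open U \<and> open V \<and> f \<in> U \<and> g \<in> V \<and> U \<inter> V = {}"
    using open_fun_vimage_eval[of U a] open_fun_vimage_eval[of V a]
    by (intro exI[of _ "(\<lambda>h. h a) -` U"] exI[of _ "(\<lambda>h. h a) -` V"]) auto
qed

lemma continuous_map_complex_mult:
  fixes f g :: "'a \<Rightarrow> complex"
  assumes "continuous_map X euclidean f" "continuous_map X euclidean g"
  shows "continuous_map X euclidean (\<lambda>x. f x * g x)"
  using assms by (simp add: continuous_map_atin tendsto_mult)

lemma dual_groupD:
  assumes "\<gamma> \<in> carrier (dual_group G T)"
  shows "t \<in> carrier G \<Longrightarrow> cmod (\<gamma> t) = 1"
    and "s \<in> carrier G \<Longrightarrow> t \<in> carrier G \<Longrightarrow> \<gamma> (s \<otimes>\<^bsub>G\<^esub> t) = \<gamma> s * \<gamma> t"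
    and "\<gamma> \<in> extensional (carrier G)"
    and "continuous_map T euclidean \<gamma>"
  using assms by (auto simp: dual_group_def hom_def circle_group_def Pi_iff)

lemma dual_group_one:
  assumes "group G" "\<gamma> \<in> carrier (dual_group G T)" shows "\<gamma> \<one>\<^bsub>G\<^esub> = 1"
proof -
  interpret group G by fact
  have "\<gamma> \<one>\<^bsub>G\<^esub> * \<gamma> \<one>\<^bsub>G\<^esub> = \<gamma> \<one>\<^bsub>G\<^esub>" "cmod (\<gamma> \<one>\<^bsub>G\<^esub>) = 1"
    using dual_groupD(2)[OF assms(2), of "\<one>\<^bsub>G\<^esub>" "\<one>\<^bsub>G\<^esub>"] dual_groupD(1)[OF assms(2), of "\<one>\<^bsub>G\<^esub>"] by auto
  then show ?thesis by auto
qed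

lemma cmod_1_cnj_mult: "cmod z = 1 \<Longrightarrow> cnj z * z = 1" "cmod z = 1 \<Longrightarrow> z * cnj z = 1"
  using complex_norm_square[of z] by (auto simp: mult.commute)

text \<open>The bijections required by \<^locale>\<open>group_action\<close> come from the group law: \<open>act (inv t)\<close> is
  inverse to \<open>act t\<close>.\<close>

lemma (in group) group_actionI:
  assumes closed: "\<And>t y. t \<in> carrier G \<Longrightarrow> y \<in> Y \<Longrightarrow> act t y \<in> Y"
    and ext: "\<And>t. t \<in> carrier G \<Longrightarrow> act t \<in> extensional Y"
    and one: "\<And>y. y \<in> Y \<Longrightarrow> act \<one> y = y"
    and comp: "\<And>s t y. s \<in> carrier G \<Longrightarrow> t \<in> carrier G \<Longrightarrow> y \<in> Y \<Longrightarrow> act (s \<otimes> t) y = act s (act t y)"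
  shows "group_action G Y act"
proof -
  have bij: "act t \<in> Bij Y" if t: "t \<in> carrier G" for t
  proof -
    have "bij_betw (act t) Y Y"
    proof (rule bij_betwI[where g = "act (inv t)"])
      show "act (inv t) (act t y) = y" if "y \<in> Y" for y
        using comp[of "inv t" t y] t that one by (simp add: l_inv)
      show "act t (act (inv t) y) = y" if "y \<in> Y" for y
        using comp[of t "inv t" y] t that one by (simp add: r_inv)
    qed (use t closed in auto)
    then show ?thesis using ext[OF t] by (simp add: Bij_def)
  qed
  show ?thesis
  proof (intro group_action.intro group_hom.intro group_hom_axioms.intro)
    show "group G" by (rule is_group)
    show "group (BijGroup Y)" by (rule group_BijGroup)
    show "act \<in> hom G (BijGroup Y)"
    proof (rule homI)
      show "act t \<in> carrier (BijGroup Y)" if "t \<in> carrier G" for t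
        using bij[OF that] by (simp add: BijGroup_def)
      fix s t assume st: "s \<in> carrier G" "t \<in> carrier G"
      have "act (s \<otimes> t) = compose Y (act s) (act t)"
        by (rule extensionalityI[of _ Y]) (use st comp ext in \<open>auto simp: compose_eq\<close>)
      then show "act (s \<otimes> t) = act s \<otimes>\<^bsub>BijGroup Y\<^esub> act t"
        using st bij by (simp add: BijGroup_def)
    qed
  qed
qed

text \<open>A subgroup \<open>E\<close> of the dual of \<open>G\<close>, with the operations written out for extensional functions.\<close>

locale character_subgroup = topological_comm_group G T
  for G :: "('g, 'm) monoid_scheme" (structure) and T :: "'g topology" +
  fixes E :: "('g \<Rightarrow> complex) set"
  assumes E_characters: "E \<subseteq> carrier (dual_group G T)"
    and E_one: "(\<lambda>t\<in>carrier G. 1) \<in> E"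
    and E_mult: "\<gamma> \<in> E \<Longrightarrow> \<delta> \<in> E \<Longrightarrow> (\<lambda>t\<in>carrier G. \<gamma> t * \<delta> t) \<in> E"
    and E_cnj: "\<gamma> \<in> E \<Longrightarrow> (\<lambda>t\<in>carrier G. cnj (\<gamma> t)) \<in> E"
begin

definition dual :: "(('g \<Rightarrow> complex) \<Rightarrow> complex) set" where
  "dual = {\<xi> \<in> extensional E. (\<forall>\<gamma>\<in>E. cmod (\<xi> \<gamma>) = 1) \<and>
     (\<forall>\<gamma>\<in>E. \<forall>\<delta>\<in>E. \<xi> (\<lambda>t\<in>carrier G. \<gamma> t * \<delta> t) = \<xi> \<gamma> * \<xi> \<delta>)}"

definition translate :: "'g \<Rightarrow> (('g \<Rightarrow> complex) \<Rightarrow> complex) \<Rightarrow> ('g \<Rightarrow> complex) \<Rightarrow> complex" where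
  "translate t = (\<lambda>\<xi>\<in>dual. \<lambda>\<gamma>\<in>E. \<gamma> t * \<xi> \<gamma>)"

definition dual_times :: "(('g \<Rightarrow> complex) \<Rightarrow> complex) \<Rightarrow> (('g \<Rightarrow> complex) \<Rightarrow> complex) \<Rightarrow> ('g \<Rightarrow> complex) \<Rightarrow> complex" where
  "dual_times \<kappa> \<xi> = (\<lambda>\<gamma>\<in>E. \<kappa> \<gamma> * \<xi> \<gamma>)"

lemma dual_mult: "\<xi> \<in> dual \<Longrightarrow> \<gamma> \<in> E \<Longrightarrow> \<delta> \<in> E \<Longrightarrow> \<xi> (\<lambda>t\<in>carrier G. \<gamma> t * \<delta> t) = \<xi> \<gamma> * \<xi> \<delta>"
  by (simp add: dual_def)

lemma dual_norm: "\<xi> \<in> dual \<Longrightarrow> \<gamma> \<in> E \<Longrightarrow> cmod (\<xi> \<gamma>) = 1"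
  by (simp add: dual_def)

lemma dual_ext: "\<xi> \<in> dual \<Longrightarrow> \<eta> \<in> dual \<Longrightarrow> (\<And>\<gamma>. \<gamma> \<in> E \<Longrightarrow> \<xi> \<gamma> = \<eta> \<gamma>) \<Longrightarrow> \<xi> = \<eta>"
  unfolding dual_def by (auto intro: extensionalityI)

lemma dual_undefined: "\<xi> \<in> dual \<Longrightarrow> \<gamma> \<notin> E \<Longrightarrow> \<xi> \<gamma> = undefined"
  unfolding dual_def by (auto simp: extensional_def)

lemma dual_one: assumes "\<xi> \<in> dual" shows "\<xi> (\<lambda>t\<in>carrier G. 1) = 1"
proof -
  let ?e = "\<lambda>t\<in>carrier G. 1 :: complex"
  have "(\<lambda>t\<in>carrier G. ?e t * ?e t) = ?e" by auto
  then have "\<xi> ?e * \<xi> ?e = \<xi> ?e" using dual_mult[OF assms E_one E_one] by (metis (no_types, lifting))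
  moreover have "\<xi> ?e \<noteq> 0" using dual_norm[OF assms E_one] by (metis norm_zero zero_neq_one)
  ultimately show ?thesis by simp
qed

lemma dual_cnj: assumes "\<xi> \<in> dual" "\<gamma> \<in> E" shows "\<xi> (\<lambda>t\<in>carrier G. cnj (\<gamma> t)) = cnj (\<xi> \<gamma>)"
proof -
  let ?d = "\<lambda>t\<in>carrier G. cnj (\<gamma> t)"
  have "(\<lambda>t\<in>carrier G. \<gamma> t * ?d t) = (\<lambda>t\<in>carrier G. 1)"
    using dual_groupD(1)[of \<gamma> G T] E_characters assms(2) by (auto simp: cmod_1_cnj_mult intro!: restrict_ext)
  then have 1: "\<xi> \<gamma> * \<xi> ?d = 1"
    using dual_mult[OF assms E_cnj[OF assms(2)]] dual_one[OF assms(1)] by simp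
  have "\<xi> ?d = cnj (\<xi> \<gamma>) * (\<xi> \<gamma> * \<xi> ?d)"
    using cmod_1_cnj_mult(1)[OF dual_norm[OF assms]] by (simp add: mult.assoc[symmetric])
  then show ?thesis using 1 by simp
qed

lemma char_props:
  assumes "\<gamma> \<in> E"
  shows "t \<in> carrier G \<Longrightarrow> cmod (\<gamma> t) = 1"
    and "s \<in> carrier G \<Longrightarrow> t \<in> carrier G \<Longrightarrow> \<gamma> (s \<otimes> t) = \<gamma> s * \<gamma> t"
    and "\<gamma> \<in> extensional (carrier G)" and "continuous_map T euclidean \<gamma>" and "\<gamma> \<one> = 1"
  using dual_groupD[of \<gamma> G T] dual_group_one[OF is_group, of \<gamma> T] E_characters assms by auto

lemma dual_times_closed: "\<kappa> \<in> dual \<Longrightarrow> \<xi> \<in> dual \<Longrightarrow> dual_times \<kappa> \<xi> \<in> dual"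
  by (auto simp: dual_def dual_times_def norm_mult E_mult)

lemma dual_eval: "t \<in> carrier G \<Longrightarrow> (\<lambda>\<gamma>\<in>E. \<gamma> t) \<in> dual"
  by (auto simp: dual_def char_props E_mult)

lemma dual_cnj_closed: "\<xi> \<in> dual \<Longrightarrow> (\<lambda>\<gamma>\<in>E. cnj (\<xi> \<gamma>)) \<in> dual"
  by (auto simp: dual_def E_mult)

lemma translate_eq: "t \<in> carrier G \<Longrightarrow> \<xi> \<in> dual \<Longrightarrow> translate t \<xi> = dual_times (\<lambda>\<gamma>\<in>E. \<gamma> t) \<xi>"
  by (auto simp: translate_def dual_times_def)

lemma translate_apply: "\<xi> \<in> dual \<Longrightarrow> \<gamma> \<in> E \<Longrightarrow> translate t \<xi> \<gamma> = \<gamma> t * \<xi> \<gamma>"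
  by (simp add: translate_def)

lemma translate_closed: "t \<in> carrier G \<Longrightarrow> \<xi> \<in> dual \<Longrightarrow> translate t \<xi> \<in> dual"
  by (simp add: translate_eq dual_times_closed dual_eval)

lemma continuous_on_eval: "continuous_on S (\<lambda>\<xi>. \<xi> \<gamma>)"
  for S :: "(('g \<Rightarrow> complex) \<Rightarrow> complex) set"
  by (rule continuous_on_subset[OF continuous_on_product_coordinates]) simp

lemma continuous_on_into_dual:
  fixes h :: "'b::topological_space \<Rightarrow> ('g \<Rightarrow> complex) \<Rightarrow> complex"
  assumes "h ` S \<subseteq> dual" "\<And>\<gamma>. \<gamma> \<in> E \<Longrightarrow> continuous_on S (\<lambda>x. h x \<gamma>)"
  shows "continuous_on S h"
proof (rule continuous_on_coordinatewise_then_product)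
  fix \<gamma>
  show "continuous_on S (\<lambda>x. h x \<gamma>)"
  proof (cases "\<gamma> \<in> E")
    case False
    then have "\<And>x. x \<in> S \<Longrightarrow> h x \<gamma> = undefined" using dual_undefined assms(1) by auto
    then show ?thesis by (simp cong: continuous_on_cong)
  qed (rule assms(2))
qed

lemma continuous_on_dual_times: "\<kappa> \<in> dual \<Longrightarrow> continuous_on dual (dual_times \<kappa>)"
  by (rule continuous_on_into_dual)
    (auto simp: dual_times_closed, auto simp: dual_times_def intro!: continuous_intros continuous_on_eval)

lemma compact_dual: "compact dual"
proof -
  let ?B = "\<lambda>\<gamma>. if \<gamma> \<in> E then sphere 0 1 else {undefined :: complex}"
  have B: "compact (?B \<gamma>)" for \<gamma> by simp
  have "compactin (product_topology (\<lambda>_. euclidean) UNIV) (PiE UNIV ?B)"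
    unfolding compactin_PiE using B by (simp del: if_split)
  then have comp: "compact (PiE UNIV ?B)" by (simp add: euclidean_product_topology)
  define D where "D \<gamma> \<delta> = {\<xi> :: ('g \<Rightarrow> complex) \<Rightarrow> complex. \<xi> (\<lambda>t\<in>carrier G. \<gamma> t * \<delta> t) = \<xi> \<gamma> * \<xi> \<delta>}" for \<gamma> \<delta> :: "'g \<Rightarrow> complex"
  have "closed (D \<gamma> \<delta>)" for \<gamma> \<delta>
    unfolding D_def by (intro closed_Collect_eq continuous_intros continuous_on_eval)
  then have "closed (\<Inter>\<gamma>\<in>E. \<Inter>\<delta>\<in>E. D \<gamma> \<delta>)" by auto
  then have "compact (PiE UNIV ?B \<inter> (\<Inter>\<gamma>\<in>E. \<Inter>\<delta>\<in>E. D \<gamma> \<delta>))" using comp by (intro compact_Int_closed)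
  also have "PiE UNIV ?B \<inter> (\<Inter>\<gamma>\<in>E. \<Inter>\<delta>\<in>E. D \<gamma> \<delta>) = dual"
    by (auto simp: dual_def D_def extensional_def Pi_iff split: if_splits)
  finally show ?thesis .
qed

lemma carrier_dual:
  "carrier (dual_group ((dual_group G T)\<lparr>carrier := E\<rparr>) (discrete_topology E)) = dual"
  by (auto simp: dual_group_def dual_def hom_def circle_group_def Pi_iff)

text \<open>Compact sets of a discrete space are finite, so the compact-open topology is the topology of
  pointwise convergence.  Outside \<open>E\<close> all elements of the dual take the value
  \<^const>\<open>undefined\<close>, hence nothing changes if all coordinates are used.\<close>

lemma dual_topology_eq:
  "dual_topology ((dual_group G T)\<lparr>carrier := E\<rparr>) (discrete_topology E) = top_of_set dual" (is "?D = _")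
proof -
  have base: "?D = topology_generated_by {{\<xi> \<in> dual. \<xi> ` F \<subseteq> U} | F U. finite F \<and> F \<subseteq> E \<and> open U}"
    unfolding dual_topology_def carrier_dual
    by (rule arg_cong[where f = topology_generated_by]) (auto simp: compactin_discrete_topology)
  have "dual = {\<xi> \<in> dual. \<xi> ` {} \<subseteq> UNIV}" by auto
  then have tops: "topspace ?D = dual"
    unfolding base topology_generated_by_topspace by blast
  have "openin (top_of_set dual) S" if "openin ?D S" for S
    using that unfolding base openin_topology_generated_by_iff
  proof (induction rule: generate_topology_on.induct)
    case (Basis s)
    then obtain F U where s: "s = {\<xi> \<in> dual. \<xi> ` F \<subseteq> U}" and F: "finite F" and U: "open U" by auto
    have "open (\<Inter>\<gamma>\<in>F. (\<lambda>\<xi>. \<xi> \<gamma>) -` U)"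
      using F U by (intro open_INT ballI open_fun_vimage_eval) auto
    then have "openin (top_of_set dual) (dual \<inter> (\<Inter>\<gamma>\<in>F. (\<lambda>\<xi>. \<xi> \<gamma>) -` U))" by (rule openin_open_Int)
    also have "dual \<inter> (\<Inter>\<gamma>\<in>F. (\<lambda>\<xi>. \<xi> \<gamma>) -` U) = s" using s by auto
    finally show ?case .
  next
    case (UN K) then show ?case by (intro openin_Union) auto
  qed auto
  moreover have "openin ?D S" if S: "openin (top_of_set dual) S" for S
  proof -
    have "continuous_map ?D (product_topology (\<lambda>_. euclidean) UNIV) (\<lambda>\<xi>. \<xi>)"
      unfolding continuous_map_componentwise_UNIV
    proof
      fix \<gamma>
      show "continuous_map ?D euclidean (\<lambda>\<xi>. \<xi> \<gamma>)"
      proof (cases "\<gamma> \<in> E")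
        case True
        have "openin ?D {\<xi> \<in> dual. \<xi> \<gamma> \<in> U}" if "open U" for U
        proof -
          have "{\<xi> \<in> dual. \<xi> \<gamma> \<in> U} = {\<xi> \<in> dual. \<xi> ` {\<gamma>} \<subseteq> U}" by auto
          then show ?thesis unfolding base using True that by (intro topology_generated_by_Basis) blast
        qed
        then show ?thesis by (simp add: continuous_map_def tops)
      next
        case False
        have "continuous_map ?D euclidean (\<lambda>\<xi>. undefined :: complex)" by simp
        then show ?thesis
          by (rule continuous_map_eq) (use False tops in \<open>auto simp: dual_undefined\<close>)
      qed
    qed
    then have cont: "continuous_map ?D euclidean (\<lambda>\<xi>. \<xi>)" by (simp add: euclidean_product_topology)
    obtain O' where O': "open O'" "S = dual \<inter> O'" using S by (auto simp: openin_open)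
    then have "openin ?D {\<xi> \<in> topspace ?D. \<xi> \<in> O'}" using cont by (auto simp: continuous_map_def)
    also have "{\<xi> \<in> topspace ?D. \<xi> \<in> O'} = S" using O' tops by auto
    finally show ?thesis .
  qed
  ultimately show ?thesis by (auto simp: topology_eq)
qed

sublocale commuting_maps G dual translate
proof
  show "compact dual" by (rule compact_dual)
  show "dual \<noteq> {}" using dual_eval[OF one_closed] by auto
  show "translate t x \<in> dual" if "t \<in> carrier G" "x \<in> dual" for t x
    using translate_closed that by simp
  show "continuous_on dual (translate t)" if "t \<in> carrier G" for t
    using continuous_on_dual_times[OF dual_eval[OF that]] translate_eq[OF that] by (simp cong: continuous_on_cong)
  show "translate s (translate t x) = translate t (translate s x)"
    if "s \<in> carrier G" "t \<in> carrier G" "x \<in> dual" for s t x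
    using that by (intro dual_ext) (auto simp: translate_closed translate_apply)
qed

text \<open>The trigonometric polynomials on the dual group.  Products of two of them are again of this form
  only on the dual group itself.\<close>

inductive_set trig :: "((('g \<Rightarrow> complex) \<Rightarrow> complex) \<Rightarrow> complex) set" where
  char: "\<gamma> \<in> E \<Longrightarrow> (\<lambda>\<xi>. c * \<xi> \<gamma>) \<in> trig"
| add: "p \<in> trig \<Longrightarrow> q \<in> trig \<Longrightarrow> (\<lambda>\<xi>. p \<xi> + q \<xi>) \<in> trig"

lemma trig_mult:
  assumes "p \<in> trig" "q \<in> trig" shows "\<exists>r\<in>trig. \<forall>\<xi>\<in>dual. r \<xi> = p \<xi> * q \<xi>"
  using assms(1)
proof (induction rule: trig.induct)
  case (char \<gamma> c)
  show ?case using assms(2)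
  proof (induction rule: trig.induct)
    case (char \<delta> d)
    define \<epsilon> where "\<epsilon> = (\<lambda>t\<in>carrier G. \<gamma> t * \<delta> t)"
    have "\<xi> \<epsilon> = \<xi> \<gamma> * \<xi> \<delta>" if "\<xi> \<in> dual" for \<xi>
      unfolding \<epsilon>_def using dual_mult that char \<open>\<gamma> \<in> E\<close> by blast
    moreover have "(\<lambda>\<xi>. c * d * \<xi> \<epsilon>) \<in> trig"
      unfolding \<epsilon>_def using char \<open>\<gamma> \<in> E\<close> by (intro trig.char E_mult)
    ultimately show ?case by (intro bexI[of _ "\<lambda>\<xi>. c * d * \<xi> \<epsilon>"]) auto
  next
    case (add p q)
    then obtain r s where "r \<in> trig" "s \<in> trig" "\<forall>\<xi>\<in>dual. r \<xi> = c * \<xi> \<gamma> * p \<xi>" "\<forall>\<xi>\<in>dual. s \<xi> = c * \<xi> \<gamma> * q \<xi>"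
      by auto
    then show ?case using trig.add[of r s] by (intro bexI[of _ "\<lambda>\<xi>. r \<xi> + s \<xi>"]) (auto simp: distrib_left)
  qed
next
  case (add p p')
  then obtain r s where "r \<in> trig" "s \<in> trig" "\<forall>\<xi>\<in>dual. r \<xi> = p \<xi> * q \<xi>" "\<forall>\<xi>\<in>dual. s \<xi> = p' \<xi> * q \<xi>"
    by auto
  then show ?case using trig.add[of r s] by (intro bexI[of _ "\<lambda>\<xi>. r \<xi> + s \<xi>"]) (auto simp: distrib_right)
qed

lemma trig_continuous: "p \<in> trig \<Longrightarrow> continuous_on S p"
  by (induction rule: trig.induct) (auto intro!: continuous_intros continuous_on_eval)

lemma trig_finite_support:
  "p \<in> trig \<Longrightarrow> \<exists>C. finite C \<and> C \<subseteq> E \<and> (\<forall>\<xi> \<eta>. (\<forall>\<gamma>\<in>C. \<xi> \<gamma> = \<eta> \<gamma>) \<longrightarrow> p \<xi> = p \<eta>)"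
proof (induction rule: trig.induct)
  case (char \<gamma> c)
  then show ?case by (intro exI[of _ "{\<gamma>}"]) auto
next
  case (add p q)
  then obtain C D where CD: "finite C" "C \<subseteq> E" "\<And>\<xi> \<eta>. (\<And>\<gamma>. \<gamma> \<in> C \<Longrightarrow> \<xi> \<gamma> = \<eta> \<gamma>) \<Longrightarrow> p \<xi> = p \<eta>"
    "finite D" "D \<subseteq> E" "\<And>\<xi> \<eta>. (\<And>\<gamma>. \<gamma> \<in> D \<Longrightarrow> \<xi> \<gamma> = \<eta> \<gamma>) \<Longrightarrow> q \<xi> = q \<eta>" by metis
  have eq: "p \<xi> + q \<xi> = p \<eta> + q \<eta>" if "\<forall>\<gamma>\<in>C \<union> D. \<xi> \<gamma> = \<eta> \<gamma>" for \<xi> \<eta>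
    using CD(3)[of \<xi> \<eta>] CD(6)[of \<xi> \<eta>] that by auto
  show ?case
  proof (intro exI[of _ "C \<union> D"] conjI allI impI)
    show "finite (C \<union> D)" "C \<union> D \<subseteq> E" using CD(1,2,4,5) by auto
  qed (rule eq)
qed

text \<open>Stone-Weierstrass for the real functions that agree on the dual group with a trigonometric
  polynomial: real and imaginary parts of \<open>\<xi> \<gamma>\<close> are of this kind because conjugation
  of \<open>\<xi> \<gamma>\<close> is evaluation at the conjugate character.\<close>

lemma trig_dense:
  assumes f: "continuous_on dual f" and "e > 0"
  obtains p where "p \<in> trig" "\<And>\<xi>. \<xi> \<in> dual \<Longrightarrow> cmod (of_real (f \<xi>) - p \<xi>) < e"
proof -
  define R where "R = {f :: _ \<Rightarrow> real. continuous_on dual f \<and> (\<exists>p\<in>trig. \<forall>\<xi>\<in>dual. of_real (f \<xi>) = p \<xi>)}"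
  interpret function_ring_on R dual
  proof
    show "compact dual" by (rule compact_dual)
    show "continuous_on dual f" if "f \<in> R" for f using that by (simp add: R_def)
    show "(\<lambda>x. f x + g x) \<in> R" if "f \<in> R" "g \<in> R" for f g
    proof -
      obtain p q where "p \<in> trig" "q \<in> trig" "\<forall>\<xi>\<in>dual. of_real (f \<xi>) = p \<xi>" "\<forall>\<xi>\<in>dual. of_real (g \<xi>) = q \<xi>"
        using \<open>f \<in> R\<close> \<open>g \<in> R\<close> by (auto simp: R_def)
      then have "\<exists>r\<in>trig. \<forall>\<xi>\<in>dual. of_real (f \<xi> + g \<xi>) = r \<xi>"
        by (intro bexI[OF _ trig.add[of p q]]) auto
      then show ?thesis using that by (auto simp: R_def intro: continuous_intros)
    qed
    show "(\<lambda>x. f x * g x) \<in> R" if "f \<in> R" "g \<in> R" for f g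
    proof -
      obtain p q where "p \<in> trig" "q \<in> trig" "\<forall>\<xi>\<in>dual. of_real (f \<xi>) = p \<xi>" "\<forall>\<xi>\<in>dual. of_real (g \<xi>) = q \<xi>"
        using \<open>f \<in> R\<close> \<open>g \<in> R\<close> by (auto simp: R_def)
      then have "\<exists>r\<in>trig. \<forall>\<xi>\<in>dual. of_real (f \<xi> * g \<xi>) = r \<xi>"
        using trig_mult[of p q] by (metis of_real_mult)
      then show ?thesis using that by (auto simp: R_def intro: continuous_intros)
    qed
    show "(\<lambda>_. c) \<in> R" for c
      using dual_one unfolding R_def
      by (auto intro!: bexI[OF _ trig.char[OF E_one, of "of_real c"]])
    show "\<exists>f\<in>R. f x \<noteq> f y" if "x \<in> dual" "y \<in> dual" "x \<noteq> y" for x y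
    proof -
      obtain \<gamma> where \<gamma>: "\<gamma> \<in> E" "x \<gamma> \<noteq> y \<gamma>"
        using dual_ext[of x y] \<open>x \<in> dual\<close> \<open>y \<in> dual\<close> \<open>x \<noteq> y\<close> by auto
      let ?c = "\<lambda>t\<in>carrier G. cnj (\<gamma> t)"
      have "(\<lambda>\<xi>. 1/2 * \<xi> \<gamma> + 1/2 * \<xi> ?c) \<in> trig" "(\<lambda>\<xi>. -\<i>/2 * \<xi> \<gamma> + \<i>/2 * \<xi> ?c) \<in> trig"
        by (intro trig.intros E_cnj \<gamma>(1))+
      moreover have "of_real (Re (\<xi> \<gamma>)) = 1/2 * \<xi> \<gamma> + 1/2 * \<xi> ?c" if "\<xi> \<in> dual" for \<xi>
        using dual_cnj[OF that \<gamma>(1)] by (simp add: complex_eq_iff)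
      moreover have "of_real (Im (\<xi> \<gamma>)) = -\<i>/2 * \<xi> \<gamma> + \<i>/2 * \<xi> ?c" if "\<xi> \<in> dual" for \<xi>
        using dual_cnj[OF that \<gamma>(1)] by (simp add: complex_eq_iff)
      ultimately have "(\<lambda>\<xi>. Re (\<xi> \<gamma>)) \<in> R" "(\<lambda>\<xi>. Im (\<xi> \<gamma>)) \<in> R"
        unfolding R_def by (auto intro!: continuous_intros continuous_on_eval bexI)
      then show ?thesis using \<gamma>(2) complex_eqI by metis
    qed
  qed
  obtain g where g: "g \<in> R" "\<And>x. x \<in> dual \<Longrightarrow> \<bar>f x - g x\<bar> < e"
    using Stone_Weierstrass_basic[OF f \<open>e > 0\<close>] by auto
  then obtain p where p: "p \<in> trig" "\<And>\<xi>. \<xi> \<in> dual \<Longrightarrow> of_real (g \<xi>) = p \<xi>" by (auto simp: R_def)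
  have "cmod (of_real (f \<xi>) - p \<xi>) < e" if "\<xi> \<in> dual" for \<xi>
    using g(2)[OF that] p(2)[OF that, symmetric] by (simp add: norm_of_real flip: of_real_diff)
  then show ?thesis using that p(1) by blast
qed

text \<open>If \<open>\<gamma> t \<noteq> 1\<close> then \<open>(1 + \<gamma> t) / 2\<close> has modulus less than \<open>1\<close> by strict
  convexity of the disc, and its powers tend to \<open>0\<close>.\<close>

lemma char_has_mean:
  assumes "\<gamma> \<in> E" shows "\<exists>d. has_mean (\<lambda>\<xi>. c * \<xi> \<gamma>) d"
proof (cases "\<gamma> = (\<lambda>t\<in>carrier G. 1)")
  case True
  then have "has_mean (\<lambda>\<xi>. c * \<xi> \<gamma>) c"
    using has_mean_cong[OF has_mean_const[of c], of "\<lambda>\<xi>. c * \<xi> \<gamma>"] dual_one by auto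
  then show ?thesis ..
next
  case False
  then obtain t where t: "t \<in> carrier G" "\<gamma> t \<noteq> 1"
    using char_props(3)[OF assms] by (metis extensionalityI restrict_apply' restrict_extensional)
  define z where "z = (1 + \<gamma> t) / 2"
  have "cmod z < 1"
  proof -
    have n1: "cmod (\<gamma> t) = 1" using char_props(1)[OF assms t(1)] .
    have "cmod (1 + \<gamma> t) \<noteq> 2"
    proof
      assume "cmod (1 + \<gamma> t) = 2"
      then have "norm (1 + \<gamma> t) = norm (1 :: complex) + norm (\<gamma> t)" using n1 by simp
      then have "norm (1::complex) *\<^sub>R \<gamma> t = norm (\<gamma> t) *\<^sub>R 1" by (simp only: norm_triangle_eq)
      then show False using n1 t(2) by simp
    qed
    moreover have "cmod (1 + \<gamma> t) \<le> 2" using norm_triangle_ineq[of 1 "\<gamma> t"] n1 by simp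
    ultimately show ?thesis by (simp add: z_def norm_divide)
  qed
  have avg: "avg (replicate n t) (\<lambda>\<xi>. c * \<xi> \<gamma>) \<xi> = z ^ n * (c * \<xi> \<gamma>)" if "\<xi> \<in> dual" for n \<xi>
    using that
  proof (induction n arbitrary: \<xi>)
    case (Suc n)
    then show ?case using t(1) assms
      by (simp add: translate_closed translate_apply z_def scaleR_conv_of_real field_simps)
  qed simp
  have "has_mean (\<lambda>\<xi>. c * \<xi> \<gamma>) 0"
    unfolding has_mean_def
  proof (intro allI impI)
    fix e :: real assume "e > 0"
    have "(\<lambda>n. cmod z ^ n * cmod c) \<longlonglongrightarrow> 0 * cmod c"
      using \<open>cmod z < 1\<close> by (intro tendsto_mult LIMSEQ_power_zero tendsto_const) simp
    then have "\<forall>\<^sub>F n in sequentially. cmod z ^ n * cmod c < e"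
      using \<open>e > 0\<close> by (intro order_tendstoD) auto
    then obtain n where "cmod z ^ n * cmod c < e" by (auto dest: eventually_happens)
    then have "norm (avg (replicate n t) (\<lambda>\<xi>. c * \<xi> \<gamma>) \<xi> - 0) < e" if "\<xi> \<in> dual" for \<xi>
      using avg[OF that] dual_norm[OF that assms] by (simp add: norm_mult norm_power)
    then show "\<exists>ts. set ts \<subseteq> carrier G \<and> (\<forall>x\<in>dual. norm (avg ts (\<lambda>\<xi>. c * \<xi> \<gamma>) x - 0) < e)"
      using t(1) by (intro exI[of _ "replicate n t"]) auto
  qed
  then show ?thesis ..
qed

lemma trig_has_mean: "p \<in> trig \<Longrightarrow> \<exists>d. has_mean p d"
  by (induction rule: trig.induct) (auto intro: char_has_mean has_mean_add)

lemma continuous_has_mean: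
  fixes f :: "(('g \<Rightarrow> complex) \<Rightarrow> complex) \<Rightarrow> real"
  assumes f: "continuous_on dual f" shows "\<exists>c. has_mean f c"
proof -
  have "\<exists>g d. has_mean g d \<and> (\<forall>x\<in>dual. norm (f x - g x) < e)" if e: "e > 0" for e
  proof -
    obtain p where p: "p \<in> trig" "\<And>\<xi>. \<xi> \<in> dual \<Longrightarrow> cmod (of_real (f \<xi>) - p \<xi>) < e"
      using trig_dense[OF f e] by metis
    obtain d where "has_mean p d" using trig_has_mean[OF p(1)] ..
    then have "has_mean (\<lambda>\<xi>. Re (p \<xi>)) (Re d)" by (rule has_mean_linear[OF bounded_linear_Re])
    moreover have "norm (f \<xi> - Re (p \<xi>)) < e" if "\<xi> \<in> dual" for \<xi>
      using p(2)[OF that] abs_Re_le_cmod[of "of_real (f \<xi>) - p \<xi>"] by simp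
    ultimately show ?thesis by blast
  qed
  then show ?thesis using has_mean_uniform_limit by metis
qed

lemma translate_inverse:
  assumes "t \<in> carrier G" "\<xi> \<in> dual" shows "translate (inv t) (translate t \<xi>) = \<xi>"
proof (rule dual_ext)
  fix \<gamma> assume \<gamma>: "\<gamma> \<in> E"
  have "\<gamma> (inv t) * \<gamma> t = 1"
    using char_props(2)[OF \<gamma>, of "inv t" t] char_props(5)[OF \<gamma>] assms by (simp add: l_inv)
  then show "translate (inv t) (translate t \<xi>) \<gamma> = \<xi> \<gamma>"
    using assms \<gamma> by (simp add: translate_closed translate_apply mult.assoc[symmetric])
qed (use assms in \<open>auto simp: translate_closed\<close>)

sublocale mean_system G dual translate
proof
  show "\<exists>c. has_mean f c" if "continuous_on dual f" for f :: "_ \<Rightarrow> real" using continuous_has_mean that .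
  show "\<exists>s\<in>carrier G. \<forall>x\<in>dual. translate s (translate t x) = x \<and> translate t (translate s x) = x"
    if "t \<in> carrier G" for t
    using translate_inverse[OF that] translate_inverse[of "inv t"] that
    by (intro bexI[of _ "inv t"]) auto
qed

lemma dual_times_translate: "\<kappa> \<in> dual \<Longrightarrow> t \<in> carrier G \<Longrightarrow> \<xi> \<in> dual \<Longrightarrow> dual_times \<kappa> (translate t \<xi>) = translate t (dual_times \<kappa> \<xi>)"
  by (intro dual_ext) (auto simp: translate_closed dual_times_closed translate_apply, auto simp: dual_times_def translate_apply)

lemma invariant_closed_eq_dual:
  assumes "closedin (top_of_set dual) H" "H \<noteq> {}" "\<And>t x. t \<in> carrier G \<Longrightarrow> x \<in> H \<Longrightarrow> translate t x \<in> H"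
  shows "H = dual"
proof (rule closed_invariant_eq[OF assms])
  fix \<xi> \<eta> assume \<xi>: "\<xi> \<in> dual" and \<eta>: "\<eta> \<in> dual"
  let ?\<kappa> = "dual_times \<eta> (\<lambda>\<gamma>\<in>E. cnj (\<xi> \<gamma>))"
  have \<kappa>: "?\<kappa> \<in> dual" using \<xi> \<eta> by (intro dual_times_closed dual_cnj_closed)
  have "dual_times ?\<kappa> \<xi> = \<eta>"
    using \<xi> \<eta> \<kappa> by (intro dual_ext dual_times_closed dual_cnj_closed)
      (auto simp: dual_times_def mult.assoc cmod_1_cnj_mult dual_norm)
  moreover have "dual_times ?\<kappa> ` dual \<subseteq> dual" using dual_times_closed[OF \<kappa>] by auto
  ultimately show "\<exists>k. continuous_on dual k \<and> k ` dual \<subseteq> dual \<and> k \<xi> = \<eta> \<and>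
      (\<forall>t\<in>carrier G. \<forall>z\<in>dual. k (translate t z) = translate t (k z))"
    using continuous_on_dual_times[OF \<kappa>] dual_times_translate[OF \<kappa>] by (intro exI[of _ "dual_times ?\<kappa>"]) auto
qed

lemma group_action_dual: "group_action G dual translate"
proof (rule group_actionI)
  show "translate \<one> \<xi> = \<xi>" if "\<xi> \<in> dual" for \<xi>
    using that by (intro dual_ext) (auto simp: translate_closed translate_apply char_props)
  show "translate (s \<otimes> t) \<xi> = translate s (translate t \<xi>)"
    if "s \<in> carrier G" "t \<in> carrier G" "\<xi> \<in> dual" for s t \<xi>
    using that by (intro dual_ext) (auto simp: translate_closed translate_apply char_props mult.assoc)
qed (auto simp: translate_closed, simp add: translate_def)

lemma continuous_map_translate: "continuous_map (prod_topology T (top_of_set dual)) (top_of_set dual) (\<lambda>(t, \<xi>). translate t \<xi>)"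
proof -
  have "continuous_map (prod_topology T (top_of_set dual)) (product_topology (\<lambda>_. euclidean) UNIV) (\<lambda>(t, \<xi>). translate t \<xi>)"
    unfolding continuous_map_componentwise_UNIV
  proof
    fix \<gamma>
    show "continuous_map (prod_topology T (top_of_set dual)) euclidean (\<lambda>p. (case p of (t, \<xi>) \<Rightarrow> translate t \<xi>) \<gamma>)"
    proof (cases "\<gamma> \<in> E")
      case True
      have c1: "continuous_map (prod_topology T (top_of_set dual)) euclidean (\<lambda>p. \<gamma> (fst p))"
        using continuous_map_compose[OF continuous_map_fst char_props(4)[OF True]] by (simp add: o_def)
      have ev: "continuous_map (top_of_set dual) euclidean (\<lambda>\<xi>. \<xi> \<gamma>)" using continuous_on_eval by simp
      have c2: "continuous_map (prod_topology T (top_of_set dual)) euclidean (\<lambda>p. snd p \<gamma>)"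
        using continuous_map_compose[OF continuous_map_snd ev] by (simp add: o_def)
      have "continuous_map (prod_topology T (top_of_set dual)) euclidean (\<lambda>p. \<gamma> (fst p) * snd p \<gamma>)"
        using continuous_map_complex_mult[OF c1 c2] .
      then show ?thesis
        by (rule continuous_map_eq) (use True in \<open>auto simp: translate_apply\<close>)
    next
      case False
      have "continuous_map (prod_topology T (top_of_set dual)) euclidean (\<lambda>p. undefined :: complex)" by simp
      then show ?thesis
        by (rule continuous_map_eq) (use False topspace_eq_carrier in \<open>auto simp: translate_closed dual_undefined\<close>)
    qed
  qed
  then show ?thesis
    using topspace_eq_carrier
    by (auto simp: continuous_map_in_subtopology euclidean_product_topology translate_closed)
qed

proposition minimal_dual: "minimal_system G T (top_of_set dual) translate"
proof (intro minimal_system.intro dynamical_system.intro dynamical_system_axioms.intro minimal_system_axioms.intro)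
  show "topological_comm_group G T" by unfold_locales
  show "group_action G (topspace (top_of_set dual)) translate" using group_action_dual by simp
  show "compact_space (top_of_set dual)" using compact_dual by (simp add: compact_space_subtopology)
  show "Hausdorff_space (top_of_set dual)" by (rule Hausdorff_space_top_of_set)
  show "continuous_map (prod_topology T (top_of_set dual)) (top_of_set dual) (\<lambda>(t, \<xi>). translate t \<xi>)"
    by (rule continuous_map_translate)
  show "topspace (top_of_set dual) \<noteq> {}" using nonempty by simp
  fix \<xi> assume "\<xi> \<in> topspace (top_of_set dual)"
  then have \<xi>: "\<xi> \<in> dual" by simp
  interpret act: group_action G dual translate by (rule group_action_dual)
  let ?H = "top_of_set dual closure_of orbit G translate \<xi>"
  have orb: "orbit G translate \<xi> \<subseteq> dual" using \<xi> translate_closed by (auto simp: orbit_def)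
  have sub: "orbit G translate \<xi> \<subseteq> ?H" using orb by (intro closure_of_subset) simp
  have "?H = dual"
  proof (rule invariant_closed_eq_dual)
    show "closedin (top_of_set dual) ?H" by (rule closedin_closure_of)
    show "?H \<noteq> {}" using sub one_closed by (auto simp: orbit_def)
    fix t \<eta> assume t: "t \<in> carrier G" and \<eta>: "\<eta> \<in> ?H"
    have "continuous_map (top_of_set dual) (top_of_set dual) (translate t)"
      using act_cont[OF t] act_closed[OF t] by auto
    then have "translate t ` ?H \<subseteq> top_of_set dual closure_of (translate t ` orbit G translate \<xi>)"
      by (rule continuous_map_image_closure_subset)
    also have "\<dots> \<subseteq> ?H"
    proof (rule closure_of_mono)
      have "translate t (translate s \<xi>) \<in> orbit G translate \<xi>" if "s \<in> carrier G" for s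
        unfolding orbit_def act.composition_rule[OF \<xi> t that, symmetric] using t that by blast
      then show "translate t ` orbit G translate \<xi> \<subseteq> orbit G translate \<xi>" by (auto simp: orbit_def)
    qed
    finally show "translate t \<eta> \<in> ?H" using \<eta> by auto
  qed
  then show "top_of_set dual closure_of orbit G translate \<xi> = topspace (top_of_set dual)" by simp
qed

end

section \<open>Unique ergodicity of the dual\<close>

context character_subgroup
begin

text \<open>A continuous function is a uniform limit of a sequence of trigonometric polynomials, each of which
  depends on finitely many coordinates.\<close>

lemma countable_coordinates:
  assumes f: "continuous_on dual f"
  shows "\<exists>C. countable C \<and> C \<subseteq> E \<and>
    (\<forall>\<xi>\<in>dual. \<forall>\<eta>\<in>dual. (\<forall>\<gamma>\<in>C. \<xi> \<gamma> = \<eta> \<gamma>) \<longrightarrow> f \<xi> = (f \<eta> :: real))"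
proof -
  have "\<exists>p. p \<in> trig \<and> (\<forall>\<xi>\<in>dual. cmod (of_real (f \<xi>) - p \<xi>) < inverse (real (Suc n)))" for n
    using trig_dense[OF f, of "inverse (real (Suc n))"] by (metis inverse_positive_iff_positive of_nat_0_less_iff zero_less_Suc)
  then obtain p where p: "\<And>n. p n \<in> trig"
    "\<And>n \<xi>. \<xi> \<in> dual \<Longrightarrow> cmod (of_real (f \<xi>) - p n \<xi>) < inverse (real (Suc n))" by metis
  obtain C where C: "\<And>n. finite (C n)" "\<And>n. C n \<subseteq> E"
    "\<And>n \<xi> \<eta>. (\<forall>\<gamma>\<in>C n. \<xi> \<gamma> = \<eta> \<gamma>) \<longrightarrow> p n \<xi> = p n \<eta>"
    using trig_finite_support[OF p(1)] by metis
  have eq: "f \<xi> = f \<eta>" if "\<xi> \<in> dual" "\<eta> \<in> dual" "\<And>\<gamma>. \<gamma> \<in> (\<Union>n. C n) \<Longrightarrow> \<xi> \<gamma> = \<eta> \<gamma>" for \<xi> \<eta>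
  proof -
    have "\<bar>f \<xi> - f \<eta>\<bar> \<le> 0 + e" if "e > 0" for e
    proof -
      obtain n where n: "inverse (real (Suc n)) < e / 2" using reals_Archimedean[of "e / 2"] \<open>e > 0\<close> by auto
      have "p n \<xi> = p n \<eta>" using C(3)[of n \<xi> \<eta>] \<open>\<And>\<gamma>. \<gamma> \<in> (\<Union>n. C n) \<Longrightarrow> \<xi> \<gamma> = \<eta> \<gamma>\<close> by auto
      then have "complex_of_real (f \<xi> - f \<eta>) = (of_real (f \<xi>) - p n \<xi>) - (of_real (f \<eta>) - p n \<eta>)" by simp
      then have "\<bar>f \<xi> - f \<eta>\<bar> \<le> cmod (of_real (f \<xi>) - p n \<xi>) + cmod (of_real (f \<eta>) - p n \<eta>)"
        by (metis norm_of_real norm_triangle_ineq4)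
      then show ?thesis using p(2)[OF \<open>\<xi> \<in> dual\<close>, of n] p(2)[OF \<open>\<eta> \<in> dual\<close>, of n] n by linarith
    qed
    then have "\<bar>f \<xi> - f \<eta>\<bar> \<le> 0" by (rule field_le_epsilon)
    then show ?thesis by simp
  qed
  show ?thesis
  proof (intro exI[of _ "\<Union>n. C n"] conjI ballI impI)
    show "countable (\<Union>n. C n)" using C(1) by (intro countable_UN) (auto simp: countable_finite)
    show "(\<Union>n. C n) \<subseteq> E" using C(2) by auto
  qed (rule eq, auto)
qed

text \<open>The countably many coordinates in \<open>C\<close> map the dual group to the metric space of sequences of
  complex numbers.  The complement of \<open>W\<close> has compact image there, and \<open>f\<close> is the distance to it.\<close>

lemma cozero_of_countable:
  assumes C: "countable C" "C \<noteq> {}" and W: "openin (top_of_set dual) W"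
    and sat: "\<And>\<xi> \<eta>. \<xi> \<in> dual \<Longrightarrow> \<eta> \<in> W \<Longrightarrow> (\<And>\<gamma>. \<gamma> \<in> C \<Longrightarrow> \<xi> \<gamma> = \<eta> \<gamma>) \<Longrightarrow> \<xi> \<in> W"
  shows "\<exists>f :: (('g \<Rightarrow> complex) \<Rightarrow> complex) \<Rightarrow> real.
    continuous_on dual f \<and> (\<forall>\<xi>\<in>dual. 0 \<le> f \<xi>) \<and> W = {\<xi> \<in> dual. f \<xi> > 0}"
proof (cases "W = dual")
  case True
  then show ?thesis by (intro exI[of _ "\<lambda>_. 1"]) auto
next
  case False
  have WK: "W \<subseteq> dual" using W openin_subset by fastforce
  define p where "p \<xi> = (\<lambda>n. \<xi> (from_nat_into C n))" for \<xi> :: "('g \<Rightarrow> complex) \<Rightarrow> complex"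
  have contp: "continuous_on S p" for S
    unfolding p_def by (intro continuous_on_coordinatewise_then_product continuous_on_eval)
  define Z where "Z = p ` (dual - W)"
  have "closedin (top_of_set dual) (dual - W)" using W by (simp add: closedin_diff)
  then have "compact (dual - W)" using compact_dual closedin_compact by blast
  then have "closed Z" unfolding Z_def using compact_continuous_image[OF contp] compact_imp_closed by blast
  moreover have "Z \<noteq> {}" using False WK by (auto simp: Z_def)
  ultimately have inf: "infdist y Z = 0 \<longleftrightarrow> y \<in> Z" for y by (simp add: in_closed_iff_infdist_zero)
  have "p \<xi> \<in> Z \<longleftrightarrow> \<xi> \<notin> W" if "\<xi> \<in> dual" for \<xi>
  proof
    assume "p \<xi> \<in> Z"
    then obtain \<eta> where \<eta>: "\<eta> \<in> dual" "\<eta> \<notin> W" "p \<xi> = p \<eta>" by (auto simp: Z_def)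
    have "\<eta> \<gamma> = \<xi> \<gamma>" if "\<gamma> \<in> C" for \<gamma>
      using \<eta>(3) from_nat_into_surj[OF C(1) that] unfolding p_def by metis
    then show "\<xi> \<notin> W" using sat[OF \<eta>(1)] \<eta>(2) by blast
  qed (use that in \<open>auto simp: Z_def\<close>)
  moreover have "infdist y Z > 0 \<longleftrightarrow> infdist y Z \<noteq> 0" for y using infdist_nonneg[of y Z] by linarith
  ultimately have "W = {\<xi> \<in> dual. infdist (p \<xi>) Z > 0}" using inf WK by auto
  then show ?thesis
    by (intro exI[of _ "\<lambda>\<xi>. infdist (p \<xi>) Z"] conjI ballI continuous_on_infdist contp infdist_nonneg)
qed

text \<open>Choose minorants \<open>g n\<close> of \<open>U\<close> whose means tend to the content of \<open>U\<close>, let \<open>C\<close> be a countable set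
  of coordinates on which they depend, and let \<open>N\<close> be the group of all \<open>\<kappa>\<close> that are \<open>1\<close> on \<open>C\<close>.
  The set \<open>V\<close> where some \<open>g n\<close> is positive is \<open>N\<close>-invariant and has full measure in \<open>U\<close>, for the
  invariant measure of the Riesz construction.  The saturation \<open>W\<close> of \<open>U\<close> under \<open>N\<close> is the union of the
  translates of \<open>U\<close> by \<open>N\<close>; each of them exceeds \<open>V\<close> only by a null set.  There may be
  uncountably many translates, but finitely many cover a given compact subset of \<open>W\<close>, so the content of \<open>W\<close> is at most the measure of \<open>V\<close>.  And \<open>W\<close> depends on countably
  many coordinates only, so it is of the form \<open>{f > 0}\<close>.\<close>

proposition cozero_majorant:
  assumes U: "openin (top_of_set dual) U"
  shows "\<exists>f :: (('g \<Rightarrow> complex) \<Rightarrow> complex) \<Rightarrow> real.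
    continuous_on dual f \<and> (\<forall>\<xi>\<in>dual. 0 \<le> f \<xi>) \<and> U \<subseteq> {\<xi> \<in> dual. f \<xi> > 0} \<and>
    inner_content {\<xi> \<in> dual. f \<xi> > 0} \<le> inner_content U"
proof -
  have UK: "U \<subseteq> dual" using U openin_subset by fastforce
  obtain M where M: "invariant_probability G (top_of_set dual) translate M"
    and MU: "\<And>U. openin (top_of_set dual) U \<Longrightarrow> emeasure M U = ennreal (inner_content U)"
    and Mk: "\<And>k k' B. commuting_homeo k k' \<Longrightarrow> B \<in> sets M \<Longrightarrow> emeasure M (k -` B \<inter> dual) = emeasure M B"
    using invariant_measure_exists by auto
  interpret prob_space M using M by (simp add: invariant_probability_def)
  have sp: "space M = dual" "sets M = borel_sets (top_of_set dual)" using M by (auto simp: invariant_probability_def)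
  have opM: "V \<in> sets M" if "openin (top_of_set dual) V" for V using sp openin_borel_sets[OF that] by simp
  have mU: "measure M V = inner_content V" if "openin (top_of_set dual) V" for V
    using MU[OF that] inner_content_nonneg by (simp add: measure_def)
  have inv: "emeasure M (dual_times \<kappa> -` B \<inter> dual) = emeasure M B" if \<kappa>: "\<kappa> \<in> dual" and B: "B \<in> sets M" for \<kappa> B
  proof -
    let ?\<kappa> = "\<lambda>\<gamma>\<in>E. cnj (\<kappa> \<gamma>)"
    have \<kappa>': "?\<kappa> \<in> dual" using dual_cnj_closed[OF \<kappa>] .
    have inverse: "dual_times \<kappa> (dual_times ?\<kappa> \<xi>) = \<xi>" "dual_times ?\<kappa> (dual_times \<kappa> \<xi>) = \<xi>" if "\<xi> \<in> dual" for \<xi>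
      using that \<kappa> \<kappa>' by (intro dual_ext dual_times_closed; simp add: dual_times_def mult.assoc[symmetric] cmod_1_cnj_mult dual_norm)+
    show ?thesis
      by (rule Mk[OF _ B, of "dual_times \<kappa>" "dual_times ?\<kappa>"])
        (use \<kappa> \<kappa>' inverse in \<open>auto simp: commuting_homeo_def dual_times_closed continuous_on_dual_times dual_times_translate\<close>)
  qed
  have "\<exists>g\<in>minorants U. inner_content U - inverse (real (Suc n)) < mean g" for n
    using inner_content_approx[of "inverse (real (Suc n))" U] by (metis inverse_positive_iff_positive of_nat_0_less_iff zero_less_Suc)
  then obtain g where g: "\<And>n. g n \<in> minorants U" "\<And>n. inner_content U - inverse (real (Suc n)) < mean (g n)"
    by metis
  have contg: "continuous_on dual (g n)" for n using g(1)[of n] by (simp add: minorants_def)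
  have g01: "0 \<le> g n \<xi>" "g n \<xi> \<le> 1" "\<xi> \<notin> U \<Longrightarrow> g n \<xi> = 0" if "\<xi> \<in> dual" for n \<xi>
    using g(1)[of n] that by (auto simp: minorants_def)
  have "\<exists>C. countable C \<and> C \<subseteq> E \<and> (\<forall>\<xi>\<in>dual. \<forall>\<eta>\<in>dual. (\<forall>\<gamma>\<in>C. \<xi> \<gamma> = \<eta> \<gamma>) \<longrightarrow> g n \<xi> = g n \<eta>)" for n
    by (rule countable_coordinates[OF contg[of n]])
  then obtain D where D: "\<And>n. countable (D n)" "\<And>n. D n \<subseteq> E"
    "\<And>n \<xi> \<eta>. \<xi> \<in> dual \<Longrightarrow> \<eta> \<in> dual \<Longrightarrow> (\<forall>\<gamma>\<in>D n. \<xi> \<gamma> = \<eta> \<gamma>) \<longrightarrow> g n \<xi> = g n \<eta>" by metis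
  \<comment> \<open>The trivial character is added to make the set of coordinates nonempty, as an enumeration requires.\<close>
  define C where "C = insert (\<lambda>t\<in>carrier G. 1) (\<Union>n. D n)"
  have C: "countable C" "C \<noteq> {}" "C \<subseteq> E" using D(1,2) E_one by (auto simp: C_def)
  have gC: "g n \<xi> = g n \<eta>" if "\<xi> \<in> dual" "\<eta> \<in> dual" "\<And>\<gamma>. \<gamma> \<in> C \<Longrightarrow> \<xi> \<gamma> = \<eta> \<gamma>" for n \<xi> \<eta>
    using D(3)[of \<xi> \<eta> n] that by (auto simp: C_def)
  define V where "V = {\<xi> \<in> dual. \<exists>n. g n \<xi> > 0}"
  have V: "openin (top_of_set dual) V"
  proof -
    have "openin (top_of_set dual) (dual \<inter> g n -` {0<..})" for n
      using contg by (intro continuous_openin_preimage_gen) auto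
    then have "openin (top_of_set dual) (\<Union>n. dual \<inter> g n -` {0<..})" by (intro openin_Union) auto
    moreover have "(\<Union>n. dual \<inter> g n -` {0<..}) = V" by (auto simp: V_def)
    ultimately show ?thesis by simp
  qed
  have VU: "V \<subseteq> U" using g01(3) by (force simp: V_def)
  have "inner_content U \<le> measure M V"
  proof (rule field_le_epsilon)
    fix e :: real assume "e > 0"
    then obtain n where n: "inverse (real (Suc n)) < e" using reals_Archimedean by blast
    have "g n \<xi> = 0" if "\<xi> \<in> dual" "\<xi> \<notin> V" for \<xi>
    proof -
      have "\<not> g n \<xi> > 0" using that by (auto simp: V_def)
      then show ?thesis using g01(1)[OF that(1), of n] by linarith
    qed
    then have "g n \<in> minorants V" using contg g01(1,2) by (auto simp: minorants_def)
    then have "mean (g n) \<le> measure M V" using I_le_inner_content mU[OF V] by metis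
    then show "inner_content U \<le> measure M V + e" using g(2)[of n] n by linarith
  qed
  then have null: "U - V \<in> null_sets M"
    using finite_measure_Diff[OF opM[OF U] opM[OF V] VU] mU[OF U] opM[OF U] opM[OF V]
    by (intro null_setsI) (auto simp: emeasure_eq_measure ennreal_neg)
  define N where "N = {\<kappa> \<in> dual. \<forall>\<gamma>\<in>C. \<kappa> \<gamma> = 1}"
  define W where "W = (\<Union>\<kappa>\<in>N. dual_times \<kappa> -` U \<inter> dual)"
  have op\<kappa>: "openin (top_of_set dual) (dual_times \<kappa> -` U \<inter> dual)" if "\<kappa> \<in> dual" for \<kappa>
    using continuous_openin_preimage[OF continuous_on_dual_times[OF that] _ U] dual_times_closed[OF that]
    by (simp add: Int_commute Pi_iff)
  have W: "openin (top_of_set dual) W" unfolding W_def using op\<kappa> by (intro openin_Union) (auto simp: N_def)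
  have UW: "U \<subseteq> W"
  proof
    fix \<xi> assume \<xi>: "\<xi> \<in> U"
    let ?e = "\<lambda>\<gamma>\<in>E. \<gamma> \<one>"
    have e: "?e \<in> dual" by (rule dual_eval) simp
    have "dual_times ?e \<xi> = \<xi>"
      using \<xi> UK e by (intro dual_ext dual_times_closed) (auto simp: dual_times_def char_props)
    moreover have "?e \<in> N" using e C(3) by (auto simp: N_def char_props)
    ultimately show "\<xi> \<in> W" using \<xi> UK unfolding W_def by fastforce
  qed
  have sat: "\<xi> \<in> W" if \<xi>: "\<xi> \<in> dual" and \<eta>: "\<eta> \<in> W" and eq: "\<And>\<gamma>. \<gamma> \<in> C \<Longrightarrow> \<xi> \<gamma> = \<eta> \<gamma>" for \<xi> \<eta>
  proof -
    obtain \<kappa> where \<kappa>: "\<kappa> \<in> N" "dual_times \<kappa> \<eta> \<in> U" and "\<eta> \<in> dual" using \<eta> by (auto simp: W_def)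
    have \<kappa>d: "\<kappa> \<in> dual" using \<kappa> by (simp add: N_def)
    \<comment> \<open>The element of \<open>N\<close> that carries \<open>\<xi>\<close> to \<open>\<kappa> \<eta>\<close>.\<close>
    let ?q = "dual_times (dual_times \<kappa> \<eta>) (\<lambda>\<gamma>\<in>E. cnj (\<xi> \<gamma>))"
    have \<lambda>: "?q \<in> dual" using \<kappa>d \<open>\<eta> \<in> dual\<close> \<xi> by (intro dual_times_closed dual_cnj_closed)
    have "?q \<gamma> = 1" if "\<gamma> \<in> C" for \<gamma>
    proof -
      have "\<gamma> \<in> E" using that C by auto
      then show ?thesis using that \<kappa>(1) eq[OF that] dual_norm[OF \<open>\<eta> \<in> dual\<close>, of \<gamma>]
        by (simp add: dual_times_def N_def cmod_1_cnj_mult)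
    qed
    then have "?q \<in> N" using \<lambda> by (simp add: N_def)
    moreover have "dual_times ?q \<xi> = dual_times \<kappa> \<eta>"
      using \<xi> \<kappa>d \<open>\<eta> \<in> dual\<close> by (intro dual_ext dual_times_closed dual_cnj_closed)
        (auto simp: dual_times_def mult.assoc cmod_1_cnj_mult dual_norm)
    ultimately show ?thesis using \<kappa>(2) \<xi> unfolding W_def by fastforce
  qed
  have "inner_content W \<le> inner_content U"
  proof (rule inner_content_leI, rule field_le_epsilon)
    fix h and e :: real assume h: "h \<in> minorants W" and "e > 0"
    have conth: "continuous_on dual h" using h by (simp add: minorants_def)
    define Q where "Q = dual \<inter> h -` {e..}"
    have "closedin (top_of_set dual) Q" unfolding Q_def using conth by (intro continuous_closedin_preimage) auto
    then have "compact Q" using compact_dual closedin_compact by blast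
    have Qd: "Q \<subseteq> dual" by (auto simp: Q_def)
    have "\<exists>F\<subseteq>N. finite F \<and> Q \<subseteq> (\<Union>\<kappa>\<in>F. dual_times \<kappa> -` U \<inter> dual)"
    proof -
      have "\<exists>A. open A \<and> dual_times \<kappa> -` U \<inter> dual = dual \<inter> A" if "\<kappa> \<in> N" for \<kappa>
        using op\<kappa>[of \<kappa>] that by (auto simp: N_def openin_open)
      then obtain A where A: "\<And>\<kappa>. \<kappa> \<in> N \<Longrightarrow> open (A \<kappa>)" "\<And>\<kappa>. \<kappa> \<in> N \<Longrightarrow> dual_times \<kappa> -` U \<inter> dual = dual \<inter> A \<kappa>" by metis
      have "Q \<subseteq> W" using h \<open>e > 0\<close> by (force simp: Q_def minorants_def)
      also have "W = (\<Union>\<kappa>\<in>N. dual \<inter> A \<kappa>)" unfolding W_def by (rule SUP_cong[OF refl A(2)])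
      finally have "Q \<subseteq> (\<Union>\<kappa>\<in>N. A \<kappa>)" by blast
      then obtain F where "F \<subseteq> N" "finite F" "Q \<subseteq> (\<Union>\<kappa>\<in>F. A \<kappa>)"
        using compactE_image[OF \<open>compact Q\<close>, of N A] A(1) by metis
      then have "Q \<subseteq> (\<Union>\<kappa>\<in>F. dual \<inter> A \<kappa>)" using Qd by blast
      also have "\<dots> = (\<Union>\<kappa>\<in>F. dual_times \<kappa> -` U \<inter> dual)"
        using A(2) \<open>F \<subseteq> N\<close> by (intro SUP_cong[OF refl]) (metis subsetD)
      finally show ?thesis using \<open>F \<subseteq> N\<close> \<open>finite F\<close> by blast
    qed
    then obtain F where F: "F \<subseteq> N" "finite F" "Q \<subseteq> (\<Union>\<kappa>\<in>F. dual_times \<kappa> -` U \<inter> dual)" by auto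
    define Z where "Z = (\<Union>\<kappa>\<in>F. dual_times \<kappa> -` (U - V) \<inter> dual)"
    have meask: "dual_times \<kappa> \<in> measurable M M" if "\<kappa> \<in> dual" for \<kappa>
      using sp continuous_on_dual_times[OF that] dual_times_closed[OF that]
      by (intro continuous_map_measurable_borel_sets[of M "top_of_set dual" M "top_of_set dual"]) auto
    have "dual_times \<kappa> -` (U - V) \<inter> dual \<in> null_sets M" if "\<kappa> \<in> F" for \<kappa>
    proof (rule null_setsI)
      have \<kappa>: "\<kappa> \<in> dual" using that F by (auto simp: N_def)
      have UV: "U - V \<in> sets M" using null by auto
      show "emeasure M (dual_times \<kappa> -` (U - V) \<inter> dual) = 0" using inv[OF \<kappa> UV] null by auto
      show "dual_times \<kappa> -` (U - V) \<inter> dual \<in> sets M" using measurable_sets[OF meask[OF \<kappa>] UV] sp by simp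
    qed
    then have Z: "Z \<in> null_sets M" unfolding Z_def using F(2) by (intro null_sets_UN') (auto intro: countable_finite)
    \<comment> \<open>On \<open>Q\<close> a point of \<open>U\<close> is reached by some \<open>\<kappa> \<in> F\<close>, and membership in \<open>V\<close> is not affected by \<open>\<kappa>\<close>.\<close>
    have bound: "h \<xi> \<le> e + indicator V \<xi> + indicator Z \<xi>" if \<xi>: "\<xi> \<in> dual" for \<xi>
    proof (cases "\<xi> \<in> Q")
      case False
      then have "h \<xi> < e" using \<xi> by (auto simp: Q_def)
      then show ?thesis by (simp add: indicator_def)
    next
      case True
      then obtain \<kappa> where \<kappa>: "\<kappa> \<in> F" "dual_times \<kappa> \<xi> \<in> U" using F by auto
      have \<kappa>N: "\<kappa> \<in> dual" "\<And>\<gamma>. \<gamma> \<in> C \<Longrightarrow> \<kappa> \<gamma> = 1" using \<kappa> F by (auto simp: N_def)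
      have "dual_times \<kappa> \<xi> \<gamma> = \<xi> \<gamma>" if "\<gamma> \<in> C" for \<gamma> using that C(3) \<kappa>N(2)[OF that] by (auto simp: dual_times_def)
      then have "g n (dual_times \<kappa> \<xi>) = g n \<xi>" for n using gC[OF dual_times_closed[OF \<kappa>N(1) \<xi>] \<xi>] by auto
      then have "dual_times \<kappa> \<xi> \<in> V \<longleftrightarrow> \<xi> \<in> V" using \<xi> dual_times_closed[OF \<kappa>N(1) \<xi>] by (auto simp: V_def)
      then have "\<xi> \<in> V \<or> \<xi> \<in> Z" using \<kappa> \<xi> by (auto simp: Z_def)
      moreover have "h \<xi> \<le> 1" using h \<xi> by (auto simp: minorants_def)
      ultimately show ?thesis using \<open>e > 0\<close> by (auto simp: indicator_def)
    qed
    have Zs: "Z \<in> sets M" using Z by auto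
    have "mean h = (\<integral>\<xi>. h \<xi> \<partial>M)" using integral_eq_mean_functional[OF M conth] by simp
    also have "\<dots> \<le> (\<integral>\<xi>. e + indicator V \<xi> + indicator Z \<xi> \<partial>M)"
      using integrable_continuous[OF M conth] opM[OF V] Zs bound sp
      by (intro integral_mono) (auto simp: emeasure_eq_measure)
    also have "\<dots> = e + measure M V + measure M Z"
      using opM[OF V] Zs sets.sets_into_space[OF opM[OF V]] sets.sets_into_space[OF Zs]
      by (simp add: emeasure_eq_measure prob_space Int_absorb2)
    also have "measure M Z = 0" using Z by (simp add: measure_eq_0_null_sets)
    also have "measure M V \<le> inner_content U" using finite_measure_mono[OF VU opM[OF U]] mU[OF U] by simp
    finally show "mean h \<le> inner_content U + e" by simp
  qed
  moreover have "\<exists>f :: _ \<Rightarrow> real. continuous_on dual f \<and> (\<forall>\<xi>\<in>dual. 0 \<le> f \<xi>) \<and> W = {\<xi> \<in> dual. f \<xi> > 0}"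
    by (rule cozero_of_countable[OF C(1,2) W]) (rule sat)
  ultimately show ?thesis using UW by auto
qed

text \<open>The lower bound holds because minorants integrate to their means, the upper bound because the
  majorant \<open>{f > 0}\<close> satisfies it.\<close>

lemma invariant_measure_open:
  assumes M: "invariant_probability G (top_of_set dual) translate M" and U: "openin (top_of_set dual) U"
  shows "measure M U = inner_content U"
proof (rule antisym)
  interpret prob_space M using M by (simp add: invariant_probability_def)
  have sp: "sets M = borel_sets (top_of_set dual)" using M by (auto simp: invariant_probability_def)
  have Us: "U \<in> sets M" using sp openin_borel_sets[OF U] by simp
  obtain f :: "_ \<Rightarrow> real" where f: "continuous_on dual f" "\<And>\<xi>. \<xi> \<in> dual \<Longrightarrow> 0 \<le> f \<xi>" "U \<subseteq> {\<xi> \<in> dual. f \<xi> > 0}"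
    "inner_content {\<xi> \<in> dual. f \<xi> > 0} \<le> inner_content U"
    using cozero_majorant[OF U] by auto
  have "openin (top_of_set dual) (dual \<inter> f -` {0<..})"
    using f(1) by (intro continuous_openin_preimage_gen) auto
  moreover have "dual \<inter> f -` {0<..} = {\<xi> \<in> dual. f \<xi> > 0}" by auto
  ultimately have "{\<xi> \<in> dual. f \<xi> > 0} \<in> sets M" using sp openin_borel_sets by metis
  then have "measure M U \<le> measure M {\<xi> \<in> dual. f \<xi> > 0}" using f(3) by (intro finite_measure_mono)
  also have "\<dots> \<le> inner_content {\<xi> \<in> dual. f \<xi> > 0}" using measure_cozero_le[OF M f(1,2) refl] .
  finally show "measure M U \<le> inner_content U" using f(4) by simp
  show "inner_content U \<le> measure M U" using inner_content_le_measure[OF M Us] .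
qed

proposition uniquely_ergodic_dual: "uniquely_ergodic G (top_of_set dual) translate"
  unfolding uniquely_ergodic_def
proof (rule ex_ex1I)
  show "\<exists>M. invariant_probability G (top_of_set dual) translate M"
    using invariant_measure_exists by auto
  fix M N
  assume M: "invariant_probability G (top_of_set dual) translate M"
    and N: "invariant_probability G (top_of_set dual) translate N"
  interpret M: prob_space M using M by (simp add: invariant_probability_def)
  interpret N: prob_space N using N by (simp add: invariant_probability_def)
  show "M = N"
  proof (rule borel_measure_eqI[of _ _ "top_of_set dual"])
    show "emeasure M U = emeasure N U" if "openin (top_of_set dual) U" for U
      using invariant_measure_open[OF M that] invariant_measure_open[OF N that]
      by (simp add: M.emeasure_eq_measure N.emeasure_eq_measure)
  qed (use M N in \<open>auto simp: invariant_probability_def M.finite_measure_axioms N.finite_measure_axioms\<close>)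
qed

end

section \<open>Pure point spectrum of the dual\<close>

lemma cmod_add_square_le: "(cmod (a + b))\<^sup>2 \<le> 2 * (cmod a)\<^sup>2 + 2 * (cmod b)\<^sup>2"
proof -
  have "(cmod (a + b))\<^sup>2 \<le> (cmod a + cmod b)\<^sup>2" by (intro power_mono norm_triangle_ineq) simp
  also have "\<dots> \<le> 2 * (cmod a)\<^sup>2 + 2 * (cmod b)\<^sup>2"
    using sum_squares_bound[of "cmod a" "cmod b"] by (simp add: power2_sum)
  finally show ?thesis .
qed

lemma L2_functions_add:
  assumes "f \<in> L2_functions M" "g \<in> L2_functions M" shows "(\<lambda>x. f x + g x) \<in> L2_functions M"
proof -
  have [measurable]: "f \<in> borel_measurable M" "g \<in> borel_measurable M" using assms by (auto simp: L2_functions_def)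
  have "integrable M (\<lambda>x. (cmod (f x + g x))\<^sup>2)"
  proof (rule Bochner_Integration.integrable_bound)
    show "integrable M (\<lambda>x. 2 * (cmod (f x))\<^sup>2 + 2 * (cmod (g x))\<^sup>2)"
      using assms by (auto simp: L2_functions_def)
  qed (auto intro!: AE_I2 cmod_add_square_le)
  then show ?thesis by (simp add: L2_functions_def)
qed

lemma L2_functions_scale:
  assumes "f \<in> L2_functions M" shows "(\<lambda>x. c * f x) \<in> L2_functions M"
  using assms by (auto simp: L2_functions_def norm_mult power_mult_distrib)

lemma closed_L2_subspace_L2_functions: "closed_L2_subspace M (L2_functions M)"
  unfolding closed_L2_subspace_def
  by (auto intro: L2_functions_add L2_functions_scale) (simp add: L2_functions_def)

text \<open>The intersection in the definition is taken over a nonempty family, since the square integrable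
  functions themselves form a closed subspace.\<close>

lemma pure_point_spectrum_iff:
  "pure_point_spectrum G T act M \<longleftrightarrow>
     (\<forall>V. closed_L2_subspace M V \<longrightarrow> L2_eigenfunctions G T act M \<subseteq> V \<longrightarrow> L2_functions M \<subseteq> V)"
proof -
  have "L2_functions M \<in> {V. closed_L2_subspace M V \<and> L2_eigenfunctions G T act M \<subseteq> V}"
    using closed_L2_subspace_L2_functions by (auto simp: L2_eigenfunctions_def)
  then have "\<Inter>{V. closed_L2_subspace M V \<and> L2_eigenfunctions G T act M \<subseteq> V} \<subseteq> L2_functions M" by blast
  then show ?thesis unfolding pure_point_spectrum_def by blast
qed

lemma closed_L2_subspace_add:
  assumes "closed_L2_subspace M V" "f \<in> V" "g \<in> V" shows "(\<lambda>x. f x + g x) \<in> V"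
proof -
  have "\<forall>f\<in>V. \<forall>g\<in>V. (\<lambda>x. f x + g x) \<in> V"
    using assms(1) unfolding closed_L2_subspace_def by (elim conjE)
  from bspec[OF bspec[OF this assms(2)] assms(3)] show ?thesis .
qed

lemma closed_L2_subspace_scale:
  assumes "closed_L2_subspace M V" "f \<in> V" shows "(\<lambda>x. c * f x) \<in> V"
proof -
  have "\<forall>c. \<forall>f\<in>V. (\<lambda>x. c * f x) \<in> V"
    using assms(1) unfolding closed_L2_subspace_def by (elim conjE)
  from bspec[OF spec[OF this] assms(2)] show ?thesis .
qed

lemma closed_L2_subspace_zero: "closed_L2_subspace M V \<Longrightarrow> (\<lambda>x. 0) \<in> V"
  unfolding closed_L2_subspace_def by (elim conjE)

lemma closed_L2_subspace_limit:
  assumes "closed_L2_subspace M V" "f \<in> L2_functions M"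
    and "\<And>e. e > 0 \<Longrightarrow> \<exists>g\<in>V. (\<integral>x. (cmod (f x - g x))\<^sup>2 \<partial>M) < e"
  shows "f \<in> V"
proof -
  have "\<exists>g\<in>V. sqrt (\<integral>x. (cmod (f x - g x))\<^sup>2 \<partial>M) < e" if "e > 0" for e
  proof -
    have "e\<^sup>2 > 0" using that by simp
    then obtain g where g: "g \<in> V" "(\<integral>x. (cmod (f x - g x))\<^sup>2 \<partial>M) < e\<^sup>2" using assms(3) by blast
    then have "sqrt (\<integral>x. (cmod (f x - g x))\<^sup>2 \<partial>M) < sqrt (e\<^sup>2)" by (simp only: real_sqrt_less_iff)
    then show ?thesis using g(1) that by auto
  qed
  then show ?thesis using assms(1,2) unfolding closed_L2_subspace_def by blast
qed

text \<open>Closed subspaces do not see the values of a function outside the space of the measure.\<close>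

lemma closed_L2_subspace_cong:
  assumes "closed_L2_subspace M V" "f \<in> L2_functions M" "g \<in> V" "\<And>x. x \<in> space M \<Longrightarrow> f x = g x"
  shows "f \<in> V"
proof (rule closed_L2_subspace_limit[OF assms(1,2)])
  fix e :: real assume "e > 0"
  have "(\<integral>x. (cmod (f x - g x))\<^sup>2 \<partial>M) = (\<integral>x. 0 \<partial>M)"
    using assms(4) by (intro Bochner_Integration.integral_cong) auto
  then show "\<exists>g\<in>V. (\<integral>x. (cmod (f x - g x))\<^sup>2 \<partial>M) < e" using assms(3) \<open>e > 0\<close> by (intro bexI[of _ g]) auto
qed

lemma (in finite_measure) bounded_L2_function:
  assumes "f \<in> borel_measurable M" "\<And>x. x \<in> space M \<Longrightarrow> cmod (f x) \<le> B"
  shows "f \<in> L2_functions M"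
proof -
  have "integrable M (\<lambda>x. (cmod (f x))\<^sup>2)"
    using assms by (intro integrable_const_bound[where B = "B\<^sup>2"]) (auto intro!: AE_I2 power_mono)
  then show ?thesis using assms by (simp add: L2_functions_def)
qed

lemma closed_L2_subspace_sum:
  assumes V: "closed_L2_subspace M V" and "finite I" "\<And>i. i \<in> I \<Longrightarrow> f i \<in> V"
  shows "(\<lambda>x. \<Sum>i\<in>I. c i * f i x) \<in> V"
  using assms(2,3)
proof (induction I)
  case empty then show ?case using closed_L2_subspace_zero[OF V] by simp
next
  case (insert a I)
  then have "(\<lambda>x. c a * f a x + (\<Sum>i\<in>I. c i * f i x)) \<in> V"
    by (intro closed_L2_subspace_add[OF V] closed_L2_subspace_scale[OF V]) auto
  then show ?case using insert by simp
qed

lemma (in finite_measure) L2_functions_subset: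
  assumes V: "closed_L2_subspace M V" and ind: "\<And>A. A \<in> sets M \<Longrightarrow> (indicator A :: 'a \<Rightarrow> complex) \<in> V"
  shows "L2_functions M \<subseteq> V"
proof
  fix f assume f: "f \<in> L2_functions M"
  then have [measurable]: "f \<in> borel_measurable M" and int: "integrable M (\<lambda>x. (cmod (f x))\<^sup>2)"
    by (auto simp: L2_functions_def)
  have "\<exists>F. (\<forall>i. simple_function M (F i)) \<and> (\<forall>x\<in>space M. (\<lambda>i. F i x) \<longlonglongrightarrow> f x) \<and>
      (\<forall>i. \<forall>x\<in>space M. dist (F i x) 0 \<le> 2 * dist (f x) 0)"
    by (rule borel_measurable_implies_sequence_metric) simp
  then obtain F where F': "\<forall>i. simple_function M (F i)" "\<forall>x\<in>space M. (\<lambda>i. F i x) \<longlonglongrightarrow> f x"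
    "\<forall>i. \<forall>x\<in>space M. dist (F i x) 0 \<le> 2 * dist (f x) 0" by blast
  have F: "simple_function M (F i)" "x \<in> space M \<Longrightarrow> (\<lambda>i. F i x) \<longlonglongrightarrow> f x"
    "x \<in> space M \<Longrightarrow> dist (F i x) 0 \<le> 2 * dist (f x) 0" for i x
    using F' by auto
  have Fm[measurable]: "F i \<in> borel_measurable M" for i using F(1) by (rule borel_measurable_simple_function)
  have FL: "F i \<in> L2_functions M" for i
  proof -
    have "integrable M (\<lambda>x. (cmod (F i x))\<^sup>2)"
    proof (rule Bochner_Integration.integrable_bound)
      show "integrable M (\<lambda>x. 4 * (cmod (f x))\<^sup>2)" using int by simp
      show "AE x in M. norm ((cmod (F i x))\<^sup>2) \<le> norm (4 * (cmod (f x))\<^sup>2)"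
        using F(3) power_mono[of "cmod (F i _)" "2 * cmod (f _)" 2] by (auto intro!: AE_I2 simp: power_mult_distrib)
    qed auto
    then show ?thesis by (simp add: L2_functions_def)
  qed
  have FV: "F i \<in> V" for i
  proof (rule closed_L2_subspace_cong[OF V FL])
    show "(\<lambda>x. \<Sum>y\<in>F i ` space M. y * indicator (F i -` {y} \<inter> space M) x) \<in> V"
      using simple_functionD[OF F(1)[of i]] by (intro closed_L2_subspace_sum[OF V] ind) auto
    fix x assume x: "x \<in> space M"
    have "(\<Sum>y\<in>F i ` space M. y * indicator (F i -` {y} \<inter> space M) x) =
        (\<Sum>y\<in>F i ` space M. if y = F i x then y else 0)"
      using x by (intro sum.cong) (auto simp: indicator_def)
    also have "\<dots> = F i x" using x simple_functionD(1)[OF F(1)[of i]] by (simp add: sum.delta')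
    finally show "F i x = (\<Sum>y\<in>F i ` space M. y * indicator (F i -` {y} \<inter> space M) x)" by simp
  qed
  have lim: "(\<lambda>i. \<integral>x. (cmod (f x - F i x))\<^sup>2 \<partial>M) \<longlonglongrightarrow> (\<integral>x. 0 \<partial>M)"
  proof (rule integral_dominated_convergence[where w = "\<lambda>x. 9 * (cmod (f x))\<^sup>2"])
    show "AE x in M. (\<lambda>i. (cmod (f x - F i x))\<^sup>2) \<longlonglongrightarrow> 0"
    proof (rule AE_I2)
      fix x assume "x \<in> space M"
      then have "(\<lambda>i. (cmod (f x - F i x))\<^sup>2) \<longlonglongrightarrow> (cmod (f x - f x))\<^sup>2"
        using F(2) by (intro tendsto_intros) auto
      then show "(\<lambda>i. (cmod (f x - F i x))\<^sup>2) \<longlonglongrightarrow> 0" by simp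
    qed
    show "AE x in M. norm ((cmod (f x - F i x))\<^sup>2) \<le> 9 * (cmod (f x))\<^sup>2" for i
    proof (rule AE_I2)
      fix x assume "x \<in> space M"
      then have "cmod (f x - F i x) \<le> 3 * cmod (f x)"
        using F(3)[of x i] norm_triangle_ineq4[of "f x" "F i x"] by simp
      then have "(cmod (f x - F i x))\<^sup>2 \<le> (3 * cmod (f x))\<^sup>2" by (intro power_mono) auto
      then show "norm ((cmod (f x - F i x))\<^sup>2) \<le> 9 * (cmod (f x))\<^sup>2" by (simp add: power_mult_distrib)
    qed
  qed (use int in auto)
  show "f \<in> V"
  proof (rule closed_L2_subspace_limit[OF V f])
    fix e :: real assume "e > 0"
    then have "\<forall>\<^sub>F i in sequentially. (\<integral>x. (cmod (f x - F i x))\<^sup>2 \<partial>M) < e"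
      using lim by (intro order_tendstoD) auto
    then obtain i where "(\<integral>x. (cmod (f x - F i x))\<^sup>2 \<partial>M) < e" by (auto dest: eventually_happens)
    then show "\<exists>g\<in>V. (\<integral>x. (cmod (f x - g x))\<^sup>2 \<partial>M) < e" using FV by auto
  qed
qed

context character_subgroup
begin

text \<open>Each step enlarges the set of functions known to lie in \<open>V\<close>: trigonometric polynomials,
  continuous functions, indicators of open sets, indicators of Borel sets.\<close>

proposition pure_point_spectrum_dual:
  assumes M: "invariant_probability G (top_of_set dual) translate M"
  shows "pure_point_spectrum G T translate M"
  unfolding pure_point_spectrum_iff
proof (intro allI impI)
  fix V assume V: "closed_L2_subspace M V" and eig: "L2_eigenfunctions G T translate M \<subseteq> V"
  interpret prob_space M using M by (simp add: invariant_probability_def)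
  have sp: "space M = dual" "sets M = borel_sets (top_of_set dual)" using M by (auto simp: invariant_probability_def)
  have meas: "f \<in> borel_measurable M" if "continuous_on dual f" for f :: "_ \<Rightarrow> complex"
    using sp that by (intro continuous_map_borel_measurable[of M "top_of_set dual"]) auto
  note Vadd = closed_L2_subspace_add[OF V] and Vscale = closed_L2_subspace_scale[OF V]
  have trigV: "p \<in> V" if "p \<in> trig" for p
    using that
  proof (induction rule: trig.induct)
    case (char \<gamma> c)
    have "(\<lambda>\<xi>. c * \<xi> \<gamma>) \<in> L2_functions M"
      using char by (intro bounded_L2_function[where B = "cmod c"] meas)
        (auto simp: sp norm_mult dual_norm intro!: continuous_intros continuous_on_eval)
    then have "(\<lambda>\<xi>. c * \<xi> \<gamma>) \<in> L2_eigenfunctions G T translate M"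
      using char E_characters sp unfolding L2_eigenfunctions_def
      by (auto intro!: bexI[of _ \<gamma>] AE_I2 simp: translate_apply)
    then show ?case using eig by auto
  next
    case (add p q)
    then show ?case by (intro Vadd)
  qed
  have contV: "(\<lambda>\<xi>. complex_of_real (f \<xi>)) \<in> V" if f: "continuous_on dual f" for f
  proof (rule closed_L2_subspace_limit[OF V])
    have "bounded (f ` dual)" using compact_continuous_image[OF f compact_dual] compact_imp_bounded by blast
    then obtain B where "\<And>x. x \<in> dual \<Longrightarrow> norm (f x) \<le> B" by (auto simp: bounded_iff)
    then show "(\<lambda>\<xi>. complex_of_real (f \<xi>)) \<in> L2_functions M"
      using f sp by (intro bounded_L2_function[where B = B] meas continuous_on_of_real) auto
    fix e :: real assume "e > 0"
    \<comment> \<open>Then \<open>d\<^sup>2 \<le> d < e\<close>.\<close>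
    define d where "d = min 1 (e / 2)"
    have d: "d > 0" "d\<^sup>2 < e" 
    proof -
      show "d > 0" using \<open>e > 0\<close> by (simp add: d_def)
      then have "d * d \<le> d * 1" by (intro mult_left_mono) (auto simp: d_def)
      then show "d\<^sup>2 < e" using \<open>e > 0\<close> by (simp add: power2_eq_square d_def min_def split: if_splits)
    qed
    obtain p where p: "p \<in> trig" "\<And>\<xi>. \<xi> \<in> dual \<Longrightarrow> cmod (of_real (f \<xi>) - p \<xi>) < d"
      using trig_dense[OF f d(1)] by metis
    have le: "(cmod (of_real (f \<xi>) - p \<xi>))\<^sup>2 \<le> d\<^sup>2" if "\<xi> \<in> dual" for \<xi>
      using p(2)[OF that] by (intro power_mono) auto
    have "(\<lambda>\<xi>. of_real (f \<xi>) - p \<xi>) \<in> L2_functions M"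
      using f sp p(2) by (intro bounded_L2_function[where B = d] meas continuous_intros trig_continuous[OF p(1)])
        (auto simp: less_imp_le)
    then have "(\<integral>\<xi>. (cmod (of_real (f \<xi>) - p \<xi>))\<^sup>2 \<partial>M) \<le> (\<integral>\<xi>. d\<^sup>2 \<partial>M)"
      using le sp by (intro integral_mono) (auto simp: L2_functions_def)
    also have "\<dots> < e" using d(2) by (simp add: prob_space)
    finally show "\<exists>g\<in>V. (\<integral>x. (cmod (of_real (f x) - g x))\<^sup>2 \<partial>M) < e" using trigV[OF p(1)] by auto
  qed
  have indL: "(indicator A :: _ \<Rightarrow> complex) \<in> L2_functions M" if "A \<in> sets M" for A
    using that by (intro bounded_L2_function[where B = 1]) (auto simp: indicator_def)
  have openV: "(indicator U :: _ \<Rightarrow> complex) \<in> V" if U: "openin (top_of_set dual) U" for U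
  proof (rule closed_L2_subspace_limit[OF V])
    have Us: "U \<in> sets M" using sp openin_borel_sets[OF U] by simp
    then show "(indicator U :: _ \<Rightarrow> complex) \<in> L2_functions M" by (rule indL)
    fix e :: real assume "e > 0"
    obtain f where f: "f \<in> minorants U" "inner_content U - e < mean f"
      using inner_content_approx[OF \<open>e > 0\<close>] by metis
    have contf: "continuous_on dual f" using f by (simp add: minorants_def)
    have le: "(cmod (indicator U \<xi> - of_real (f \<xi>)))\<^sup>2 \<le> indicator U \<xi> - f \<xi>" if "\<xi> \<in> dual" for \<xi>
    proof -
      define a where "a = indicator U \<xi> - f \<xi>"
      have a: "0 \<le> a" "a \<le> 1"
        using f(1) that by (auto simp: minorants_def indicator_def a_def)
      have "indicator U \<xi> - of_real (f \<xi>) = complex_of_real a"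
        by (auto simp: indicator_def a_def)
      then have "(cmod (indicator U \<xi> - of_real (f \<xi>)))\<^sup>2 = a * a"
        using a by (simp add: power2_eq_square)
      also have "\<dots> \<le> a * 1" using a by (intro mult_left_mono)
      finally show ?thesis by (simp add: a_def)
    qed
    have int: "integrable M (\<lambda>\<xi>. indicator U \<xi> - f \<xi>)"
      using integrable_continuous[OF M contf] Us by (auto simp: emeasure_eq_measure)
    have fm: "f \<in> borel_measurable M" using integrable_continuous[OF M contf] by auto
    have "integrable M (\<lambda>\<xi>. (cmod (indicator U \<xi> - of_real (f \<xi>)))\<^sup>2)"
    proof (rule Bochner_Integration.integrable_bound[OF int])
      show "(\<lambda>\<xi>. (cmod (indicator U \<xi> - of_real (f \<xi>)))\<^sup>2) \<in> borel_measurable M"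
        using fm Us by measurable
      show "AE \<xi> in M. norm ((cmod (indicator U \<xi> - of_real (f \<xi>)))\<^sup>2) \<le> norm (indicator U \<xi> - f \<xi>)"
        using le sp by (intro AE_I2) (fastforce intro: order_trans[OF _ abs_ge_self])
    qed
    then have "(\<integral>\<xi>. (cmod (indicator U \<xi> - of_real (f \<xi>)))\<^sup>2 \<partial>M) \<le> (\<integral>\<xi>. indicator U \<xi> - f \<xi> \<partial>M)"
      using int le sp by (intro integral_mono) auto
    also have "\<dots> = measure M U - mean f"
      using integrable_continuous[OF M contf] integral_eq_mean_functional[OF M contf] Us sets.sets_into_space[OF Us]
      by (simp add: emeasure_eq_measure Int_absorb2)
    also have "\<dots> < e" using invariant_measure_open[OF M U] f(2) by simp
    finally show "\<exists>g\<in>V. (\<integral>x. (cmod (indicator U x - g x))\<^sup>2 \<partial>M) < e" using contV[OF contf] by auto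
  qed
  have "(indicator A :: _ \<Rightarrow> complex) \<in> V" if A: "A \<in> sets M" for A
  proof -
    have "Int_stable {U. openin (top_of_set dual) U}" by (auto simp: Int_stable_def)
    moreover have "{U. openin (top_of_set dual) U} \<subseteq> Pow dual" using openin_subset by fastforce
    moreover have "A \<in> sigma_sets dual {U. openin (top_of_set dual) U}" using A sp by (simp add: borel_sets_def)
    ultimately show ?thesis
    proof (induction rule: sigma_sets_induct_disjoint)
      case (basic U) then show ?case by (intro openV) simp
    next
      case empty
      then show ?case using closed_L2_subspace_zero[OF V] by (simp add: indicator_def[abs_def])
    next
      case (compl A)
      have As: "A \<in> sets M" using compl(1) sp by (simp add: borel_sets_def)
      have "(indicator dual :: _ \<Rightarrow> complex) \<in> V" by (rule openV) (simp add: openin_subtopology_self)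
      then have "(\<lambda>x. indicator dual x + (-1) * indicator A x :: complex) \<in> V"
        by (rule Vadd) (rule Vscale, rule compl(2))
      moreover have "(\<lambda>x. indicator dual x + (-1) * indicator A x :: complex) = indicator (dual - A)"
        using sets.sets_into_space[OF As] sp by (auto simp: indicator_def fun_eq_iff)
      ultimately show ?case by simp
    next
      case (union A)
      have As: "A i \<in> sets M" for i using union(2) sp by (auto simp: borel_sets_def)
      show ?case
      proof (rule closed_L2_subspace_limit[OF V])
        show "(indicator (\<Union>i. A i) :: _ \<Rightarrow> complex) \<in> L2_functions M" using As by (intro indL) auto
        fix e :: real assume "e > 0"
        have "(\<lambda>n. \<Sum>i<n. measure M (A i)) \<longlonglongrightarrow> measure M (\<Union>i. A i)"
          using finite_measure_UNION[of A] As union(1) unfolding sums_def by auto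
        then have "\<forall>\<^sub>F n in sequentially. measure M (\<Union>i. A i) - e < (\<Sum>i<n. measure M (A i))"
          using \<open>e > 0\<close> by (intro order_tendstoD) auto
        then obtain n where n: "measure M (\<Union>i. A i) - e < (\<Sum>i<n. measure M (A i))"
          by (auto dest: eventually_happens)
        define u :: "_ \<Rightarrow> complex" where "u x = (\<Sum>i\<in>{..<n}. 1 * indicator (A i) x)" for x
        have gV: "u \<in> V" unfolding u_def[abs_def] using union(3) by (intro closed_L2_subspace_sum[OF V]) auto
        have "disjoint_family_on A {..<n}" using union(1) by (auto simp: disjoint_family_on_def)
        then have g: "u = indicator (\<Union>i<n. A i)"
          by (auto simp: u_def fun_eq_iff indicator_UN_disjoint)
        let ?R = "(\<Union>i. A i) - (\<Union>i<n. A i)"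
        have "(cmod (indicator (\<Union>i. A i) x - indicator (\<Union>i<n. A i) x))\<^sup>2 = indicator ?R x" for x
          by (auto simp: indicator_def)
        then have "(\<integral>x. (cmod (indicator (\<Union>i. A i) x - u x))\<^sup>2 \<partial>M) = (\<integral>x. indicator ?R x \<partial>M)"
          unfolding g by (simp only:)
        also have "\<dots> = measure M ?R"
        proof -
          have "?R \<in> sets M" using As by auto
          then show ?thesis using sets.sets_into_space[of ?R M] by (simp add: Int_absorb2)
        qed
        also have "\<dots> = measure M (\<Union>i. A i) - measure M (\<Union>i<n. A i)"
          using As by (intro finite_measure_Diff) auto
        also have "measure M (\<Union>i<n. A i) = (\<Sum>i<n. measure M (A i))"
          using As union(1) by (intro finite_measure_finite_Union) (auto simp: disjoint_family_on_def)
        finally have "(\<integral>x. (cmod (indicator (\<Union>i. A i) x - u x))\<^sup>2 \<partial>M) < e" using n by simp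
        then show "\<exists>g\<in>V. (\<integral>x. (cmod (indicator (\<Union>i. A i) x - g x))\<^sup>2 \<partial>M) < e" using gV by blast
      qed
    qed
  qed
  then show "L2_functions M \<subseteq> V" by (intro L2_functions_subset V)
qed

end

section \<open>Transport along conjugacies\<close>

lemma (in dynamical_system) continuous_map_act:
  assumes "t \<in> carrier G" shows "continuous_map X X (act t)"
proof -
  have "continuous_map X (prod_topology T X) (\<lambda>x. (t, x))"
    using assms topspace_eq_carrier by (auto simp: continuous_map_pairwise o_def)
  from continuous_map_compose[OF this continuous_action] show ?thesis by (simp add: o_def)
qed

lemma (in dynamical_system) act_closed: "t \<in> carrier G \<Longrightarrow> x \<in> topspace X \<Longrightarrow> act t x \<in> topspace X"
  using element_image by blast

lemma conjugacy_inverse: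
  assumes c: "conjugacy G X actX Y actY h" and closed: "\<And>t x. t \<in> carrier G \<Longrightarrow> x \<in> topspace X \<Longrightarrow> actX t x \<in> topspace X"
  obtains g where "conjugacy G Y actY X actX g"
    "\<And>x. x \<in> topspace X \<Longrightarrow> g (h x) = x" "\<And>y. y \<in> topspace Y \<Longrightarrow> h (g y) = y"
    "continuous_map X Y h" "continuous_map Y X g"
proof -
  have "homeomorphic_map X Y h" using c by (simp add: conjugacy_def)
  then obtain g where g: "homeomorphic_maps X Y h g" by (auto simp: homeomorphic_map_maps)
  then have hg: "continuous_map X Y h" "continuous_map Y X g"
    "\<And>x. x \<in> topspace X \<Longrightarrow> g (h x) = x" "\<And>y. y \<in> topspace Y \<Longrightarrow> h (g y) = y"
    by (auto simp: homeomorphic_maps_def)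
  have "homeomorphic_map Y X g" using g homeomorphic_maps_map by blast
  moreover have "g (actY t y) = actX t (g y)" if t: "t \<in> carrier G" and y: "y \<in> topspace Y" for t y
  proof -
    have gy: "g y \<in> topspace X" using hg(2) y by (auto simp: continuous_map_def)
    have "h (actX t (g y)) = actY t (h (g y))" using c t gy by (simp add: conjugacy_def)
    then have "h (actX t (g y)) = actY t y" using hg(4)[OF y] by simp
    then show ?thesis using hg(3)[OF closed[OF t gy]] by metis
  qed
  ultimately have "conjugacy G Y actY X actX g" by (simp add: conjugacy_def)
  then show ?thesis using that hg by blast
qed

lemma conjugacy_compose:
  assumes "conjugacy G X actX Y actY h" "conjugacy G Y actY Z actZ k"
  shows "conjugacy G X actX Z actZ (k \<circ> h)"
proof -
  have "h x \<in> topspace Y" if "x \<in> topspace X" for x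
    using assms(1) that homeomorphic_imp_surjective_map by (fastforce simp: conjugacy_def)
  then show ?thesis using assms by (auto simp: conjugacy_def intro: homeomorphic_map_compose)
qed

proposition minimal_system_conjugate:
  assumes X: "minimal_system G T X actX" and c: "conjugacy G X actX Y actY h"
    and ext: "\<And>t. t \<in> carrier G \<Longrightarrow> actY t \<in> extensional (topspace Y)"
  shows "minimal_system G T Y actY"
proof -
  interpret X: minimal_system G T X actX by fact
  obtain g where g: "conjugacy G Y actY X actX g"
    and gh: "\<And>x. x \<in> topspace X \<Longrightarrow> g (h x) = x" and hg: "\<And>y. y \<in> topspace Y \<Longrightarrow> h (g y) = y"
    and conth: "continuous_map X Y h" and contg: "continuous_map Y X g"
    using conjugacy_inverse[OF c X.act_closed] by metis
  have hom: "homeomorphic_map X Y h" using c by (simp add: conjugacy_def)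
  have hX: "h x \<in> topspace Y" if "x \<in> topspace X" for x using conth that by (auto simp: continuous_map_def)
  have gY: "g y \<in> topspace X" if "y \<in> topspace Y" for y using contg that by (auto simp: continuous_map_def)
  have act: "actY t y = h (actX t (g y))" if "t \<in> carrier G" "y \<in> topspace Y" for t y
    using c that gY hg by (simp add: conjugacy_def)
  have closed: "actY t y \<in> topspace Y" if "t \<in> carrier G" "y \<in> topspace Y" for t y
    using that by (simp add: act hX gY X.act_closed)
  have comp: "actY (s \<otimes>\<^bsub>G\<^esub> t) y = actY s (actY t y)"
    if "s \<in> carrier G" "t \<in> carrier G" "y \<in> topspace Y" for s t y
    using that act[of s "h (actX t (g y))"]
    by (simp add: act[of t] act[of "s \<otimes>\<^bsub>G\<^esub> t"] hX gh gY X.act_closed X.composition_rule)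
  have one: "actY \<one>\<^bsub>G\<^esub> y = y" if "y \<in> topspace Y" for y
  proof -
    have "actX \<one>\<^bsub>G\<^esub> (g y) = g y" using X.id_eq_one gY[OF that] by (metis restrict_apply')
    then show ?thesis using that by (simp add: act hg)
  qed
  show ?thesis
  proof (intro minimal_system.intro dynamical_system.intro dynamical_system_axioms.intro minimal_system_axioms.intro)
    show "topological_comm_group G T" by (rule X.topological_comm_group_axioms)
    show "group_action G (topspace Y) actY"
      by (rule X.group_actionI) (auto simp: closed ext one comp)
    show "compact_space Y" using hom X.compact homeomorphic_compact_space homeomorphic_space by blast
    show "Hausdorff_space Y" using hom X.Hausdorff homeomorphic_Hausdorff_space homeomorphic_space by blast
    have "continuous_map (prod_topology T Y) (prod_topology T X) (\<lambda>(t, y). (t, g y))"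
      using continuous_map_compose[OF continuous_map_snd contg, of T]
      by (auto simp: continuous_map_pairwise o_def case_prod_unfold continuous_map_fst)
    from continuous_map_compose[OF continuous_map_compose[OF this X.continuous_action] conth]
    show "continuous_map (prod_topology T Y) Y (\<lambda>(t, y). actY t y)"
      by (rule continuous_map_eq) (auto simp: act X.topspace_eq_carrier)
    show "topspace Y \<noteq> {}" using X.nonempty hX by (metis ex_in_conv)
    fix y assume y: "y \<in> topspace Y"
    have "orbit G actY y = h ` orbit G actX (g y)"
    proof -
      have "orbit G actY y = (\<lambda>t. actY t y) ` carrier G" by (auto simp: orbit_def)
      also have "\<dots> = (\<lambda>t. h (actX t (g y))) ` carrier G" by (intro image_cong refl act y)
      also have "\<dots> = h ` orbit G actX (g y)" by (auto simp: orbit_def)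
      finally show ?thesis .
    qed
    moreover have "orbit G actX (g y) \<subseteq> topspace X" using y gY X.act_closed by (auto simp: orbit_def)
    ultimately have "Y closure_of orbit G actY y = h ` (X closure_of orbit G actX (g y))"
      using homeomorphic_map_closure_of[OF hom] by metis
    also have "\<dots> = h ` topspace X" using X.dense_orbits[OF gY[OF y]] by simp
    also have "\<dots> = topspace Y" using homeomorphic_imp_surjective_map[OF hom] .
    finally show "Y closure_of orbit G actY y = topspace Y" .
  qed
qed

text \<open>The image measure, on the Borel sets of a topology that is not the topology of a type class.\<close>

definition borel_pushforward :: "'x measure \<Rightarrow> 'y topology \<Rightarrow> ('x \<Rightarrow> 'y) \<Rightarrow> 'y measure" where
  "borel_pushforward M Y h = distr M (sigma (topspace Y) {U. openin Y U}) h"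

lemma space_borel_pushforward: "space (borel_pushforward M Y h) = topspace Y"
  unfolding borel_pushforward_def space_distr by (rule space_measure_of) (auto dest: openin_subset)

lemma sets_borel_pushforward: "sets (borel_pushforward M Y h) = borel_sets Y"
  unfolding borel_pushforward_def sets_distr borel_sets_def by (rule sets_measure_of) (auto dest: openin_subset)

lemma measurable_borel_pushforward:
  assumes "space M = topspace X" "sets M = borel_sets X" "continuous_map X Y h"
  shows "h \<in> measurable M (sigma (topspace Y) {U. openin Y U})"
  using continuous_map_measurable_borel_sets[OF assms(1,2) space_borel_pushforward sets_borel_pushforward assms(3)]
  by (simp add: borel_pushforward_def)

lemma emeasure_borel_pushforward:
  assumes "space M = topspace X" "sets M = borel_sets X" "continuous_map X Y h" "B \<in> borel_sets Y"
  shows "emeasure (borel_pushforward M Y h) B = emeasure M (h -` B \<inter> space M)"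
  using emeasure_distr[OF measurable_borel_pushforward[OF assms(1-3)], of B] assms(4)
    sets_borel_pushforward[of M Y h] by (simp add: borel_pushforward_def)

lemma invariant_probability_pushforward:
  assumes X: "dynamical_system G T X actX" and Y: "dynamical_system G T Y actY"
    and c: "conjugacy G X actX Y actY h" and M: "invariant_probability G X actX M"
  shows "invariant_probability G Y actY (borel_pushforward M Y h)"
proof -
  interpret X: dynamical_system G T X actX by fact
  interpret Y: dynamical_system G T Y actY by fact
  have sp: "space M = topspace X" "sets M = borel_sets X" using M by (auto simp: invariant_probability_def)
  have conth: "continuous_map X Y h" using c by (simp add: conjugacy_def homeomorphic_imp_continuous_map)
  note em = emeasure_borel_pushforward[OF sp conth]
  have meas: "h \<in> measurable M (borel_pushforward M Y h)"
    using continuous_map_measurable_borel_sets[OF sp space_borel_pushforward sets_borel_pushforward conth] .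
  show ?thesis
    unfolding invariant_probability_def
  proof (intro conjI ballI)
    show "prob_space (borel_pushforward M Y h)"
      unfolding borel_pushforward_def using M measurable_borel_pushforward[OF sp conth]
      by (intro prob_space.prob_space_distr) (auto simp: invariant_probability_def)
    show "space (borel_pushforward M Y h) = topspace Y" by (rule space_borel_pushforward)
    show "sets (borel_pushforward M Y h) = borel_sets Y" by (rule sets_borel_pushforward)
    fix t B assume t: "t \<in> carrier G" and B: "B \<in> sets (borel_pushforward M Y h)"
    then have B': "B \<in> borel_sets Y" by (simp add: sets_borel_pushforward)
    let ?B = "actY t -` B \<inter> topspace Y"
    have "actY t \<in> measurable (borel_pushforward M Y h) (borel_pushforward M Y h)"
      using continuous_map_measurable_borel_sets[OF space_borel_pushforward sets_borel_pushforward
          space_borel_pushforward sets_borel_pushforward Y.continuous_map_act[OF t]] .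
    from measurable_sets[OF this B] have tB: "?B \<in> borel_sets Y"
      by (simp add: space_borel_pushforward sets_borel_pushforward)
    have hB: "h -` B \<inter> topspace X \<in> sets M" using measurable_sets[OF meas B] sp by simp
    have hX: "h x \<in> topspace Y" if "x \<in> topspace X" for x using conth that by (auto simp: continuous_map_def)
    have "emeasure (borel_pushforward M Y h) ?B = emeasure M (h -` ?B \<inter> topspace X)"
      using em[OF tB] sp by simp
    also have "h -` ?B \<inter> topspace X = actX t -` (h -` B \<inter> topspace X) \<inter> topspace X"
      using c t hX X.act_closed[OF t] by (auto simp: conjugacy_def)
    also have "emeasure M (actX t -` (h -` B \<inter> topspace X) \<inter> topspace X) = emeasure M (h -` B \<inter> topspace X)"
    proof -
      have "\<forall>B\<in>sets M. emeasure M (actX t -` B \<inter> space M) = emeasure M B"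
        using M t by (auto simp only: invariant_probability_def)
      from bspec[OF this hB] show ?thesis by (simp only: sp)
    qed
    also have "\<dots> = emeasure (borel_pushforward M Y h) B" using em[OF B'] sp by simp
    finally show "emeasure (borel_pushforward M Y h) (actY t -` B \<inter> space (borel_pushforward M Y h)) =
        emeasure (borel_pushforward M Y h) B" by (simp add: space_borel_pushforward)
  qed
qed

lemma borel_pushforward_inverse:
  assumes sp: "space M = topspace X" "sets M = borel_sets X"
    and h: "continuous_map X Y h" and g: "continuous_map Y X g" "\<And>x. x \<in> topspace X \<Longrightarrow> g (h x) = x"
  shows "borel_pushforward (borel_pushforward M Y h) X g = M"
proof (rule measure_eqI)
  show "sets (borel_pushforward (borel_pushforward M Y h) X g) = sets M" by (simp add: sets_borel_pushforward sp)
  fix B assume "B \<in> sets (borel_pushforward (borel_pushforward M Y h) X g)"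
  then have B: "B \<in> borel_sets X" by (simp add: sets_borel_pushforward)
  let ?N = "borel_pushforward M Y h"
  have "g \<in> measurable ?N M"
    using continuous_map_measurable_borel_sets[OF space_borel_pushforward sets_borel_pushforward sp g(1)] .
  from measurable_sets[OF this, of B] have gB: "g -` B \<inter> topspace Y \<in> borel_sets Y"
    using B sp by (simp add: space_borel_pushforward sets_borel_pushforward)
  have "emeasure (borel_pushforward ?N X g) B = emeasure ?N (g -` B \<inter> topspace Y)"
    using emeasure_borel_pushforward[OF space_borel_pushforward sets_borel_pushforward g(1) B]
    by (simp add: space_borel_pushforward)
  also have "\<dots> = emeasure M (h -` (g -` B \<inter> topspace Y) \<inter> topspace X)"
    using emeasure_borel_pushforward[OF sp h gB] sp by simp
  also have "h -` (g -` B \<inter> topspace Y) \<inter> topspace X = B"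
  proof -
    have "B \<subseteq> topspace X" using sets.sets_into_space[of B M] B sp by simp
    moreover have "\<And>x. x \<in> topspace X \<Longrightarrow> h x \<in> topspace Y" using h by (auto simp: continuous_map_def)
    ultimately show ?thesis using g(2) by auto
  qed
  finally show "emeasure (borel_pushforward ?N X g) B = emeasure M B" .
qed

proposition uniquely_ergodic_conjugate:
  assumes X: "dynamical_system G T X actX" and Y: "dynamical_system G T Y actY"
    and c: "conjugacy G X actX Y actY h" and u: "uniquely_ergodic G X actX"
  shows "uniquely_ergodic G Y actY"
proof -
  interpret X: dynamical_system G T X actX by fact
  obtain g where g: "conjugacy G Y actY X actX g"
    and hg: "\<And>y. y \<in> topspace Y \<Longrightarrow> h (g y) = y"
    and conth: "continuous_map X Y h" and contg: "continuous_map Y X g"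
    using conjugacy_inverse[OF c X.act_closed] by metis
  obtain M where M: "invariant_probability G X actX M"
    and uniq: "\<And>M'. invariant_probability G X actX M' \<Longrightarrow> M' = M"
    using u unfolding uniquely_ergodic_def by auto
  have "N = borel_pushforward M Y h" if N: "invariant_probability G Y actY N" for N
  proof -
    have "borel_pushforward N X g = M" using uniq invariant_probability_pushforward[OF Y X g N] by simp
    moreover have "borel_pushforward (borel_pushforward N X g) Y h = N"
      using N hg by (intro borel_pushforward_inverse[OF _ _ contg conth]) (auto simp: invariant_probability_def)
    ultimately show ?thesis by simp
  qed
  then show ?thesis
    unfolding uniquely_ergodic_def using invariant_probability_pushforward[OF X Y c M] by blast
qed

text \<open>Composition with the inverse conjugacy \<open>g\<close> identifies the two spaces of square integrable
  functions and matches their eigenfunctions.  So a closed subspace \<open>V\<close> for \<open>Y\<close> pulls back to a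
  closed subspace \<open>W\<close> for \<open>X\<close>, which must be everything.\<close>

proposition pure_point_spectrum_conjugate:
  assumes X: "dynamical_system G T X actX" and Y: "dynamical_system G T Y actY"
    and c: "conjugacy G X actX Y actY h"
    and pp: "\<And>M. invariant_probability G X actX M \<Longrightarrow> pure_point_spectrum G T actX M"
    and N: "invariant_probability G Y actY N"
  shows "pure_point_spectrum G T actY N"
  unfolding pure_point_spectrum_iff
proof (intro allI impI)
  fix V assume V: "closed_L2_subspace N V" and eig: "L2_eigenfunctions G T actY N \<subseteq> V"
  interpret X: dynamical_system G T X actX by fact
  interpret Y: dynamical_system G T Y actY by fact
  obtain g where g: "conjugacy G Y actY X actX g"
    and hg: "\<And>y. y \<in> topspace Y \<Longrightarrow> h (g y) = y" and gh: "\<And>x. x \<in> topspace X \<Longrightarrow> g (h x) = x"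
    and conth: "continuous_map X Y h" and contg: "continuous_map Y X g"
    using conjugacy_inverse[OF c X.act_closed] by metis
  have spN: "space N = topspace Y" "sets N = borel_sets Y" using N by (auto simp: invariant_probability_def)
  define M where "M = borel_pushforward N X g"
  have M: "invariant_probability G X actX M"
    unfolding M_def by (rule invariant_probability_pushforward[OF Y X g N])
  have spM: "space M = topspace X" "sets M = borel_sets X" using M by (auto simp: invariant_probability_def)
  have measg: "g \<in> measurable N (sigma (topspace X) {U. openin X U})"
    using measurable_borel_pushforward[OF spN contg] .
  have gM: "g \<in> measurable N M" using continuous_map_measurable_borel_sets[OF spN spM contg] .
  have hN: "h \<in> measurable M N" using continuous_map_measurable_borel_sets[OF spM spN conth] .
  have borelM: "borel_measurable (sigma (topspace X) {U. openin X U}) = borel_measurable M"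
    by (rule measurable_cong_sets) (auto simp: M_def borel_pushforward_def)
  have int: "(\<integral>y. f (g y) \<partial>N) = (\<integral>x. f x \<partial>M)" if "f \<in> borel_measurable M" for f :: "_ \<Rightarrow> real"
    unfolding M_def borel_pushforward_def
    by (rule integral_distr[OF measg, symmetric]) (simp only: borelM that)
  have intb: "integrable M f \<longleftrightarrow> integrable N (\<lambda>y. f (g y))" if "f \<in> borel_measurable M" for f :: "_ \<Rightarrow> real"
    unfolding M_def borel_pushforward_def
    by (rule integrable_distr_eq[OF measg]) (simp only: borelM that)
  have L2g: "(\<lambda>y. f (g y)) \<in> L2_functions N" if "f \<in> L2_functions M" for f
  proof -
    have f: "f \<in> borel_measurable M" "integrable M (\<lambda>x. (cmod (f x))\<^sup>2)" using that by (auto simp: L2_functions_def)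
    have "integrable N (\<lambda>y. (cmod (f (g y)))\<^sup>2)"
      using intb[of "\<lambda>x. (cmod (f x))\<^sup>2"] f by simp
    then show ?thesis using measurable_compose[OF gM f(1)] by (simp add: L2_functions_def)
  qed
  define W where "W = {f \<in> L2_functions M. (\<lambda>y. f (g y)) \<in> V}"
  have "closed_L2_subspace M W"
    unfolding closed_L2_subspace_def
  proof (intro conjI ballI allI impI)
    show "W \<subseteq> L2_functions M" by (auto simp: W_def)
    show "(\<lambda>_. 0) \<in> W"
      using closed_L2_subspace_zero[OF V] closed_L2_subspace_zero[OF closed_L2_subspace_L2_functions[of M]]
      by (simp add: W_def)
    show "(\<lambda>x. f x + f' x) \<in> W" if "f \<in> W" "f' \<in> W" for f f'
      using that closed_L2_subspace_add[OF V, of "\<lambda>y. f (g y)" "\<lambda>y. f' (g y)"] by (simp add: W_def L2_functions_add)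
    show "(\<lambda>x. a * f x) \<in> W" if "f \<in> W" for a f
      using that closed_L2_subspace_scale[OF V, of "\<lambda>y. f (g y)"] by (simp add: W_def L2_functions_scale)
    fix f assume f: "f \<in> L2_functions M"
      and lim: "\<forall>e>0. \<exists>f'\<in>W. sqrt (\<integral>x. (cmod (f x - f' x))\<^sup>2 \<partial>M) < e"
    have ex: "\<exists>u\<in>V. sqrt (\<integral>y. (cmod (f (g y) - u y))\<^sup>2 \<partial>N) < e" if "e > 0" for e
    proof -
      obtain f' where f': "f' \<in> W" "sqrt (\<integral>x. (cmod (f x - f' x))\<^sup>2 \<partial>M) < e" using lim \<open>e > 0\<close> by blast
      have [measurable]: "f \<in> borel_measurable M" "f' \<in> borel_measurable M"
        using f f'(1) by (auto simp: W_def L2_functions_def)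
      have "(\<integral>y. (cmod (f (g y) - f' (g y)))\<^sup>2 \<partial>N) = (\<integral>x. (cmod (f x - f' x))\<^sup>2 \<partial>M)"
        by (rule int) measurable
      then show ?thesis using f' by (intro bexI[of _ "\<lambda>y. f' (g y)"]) (simp_all add: W_def)
    qed
    have cl: "\<forall>f\<in>L2_functions N.
        (\<forall>e>0. \<exists>g\<in>V. sqrt (\<integral>x. (cmod (f x - g x))\<^sup>2 \<partial>N) < e) \<longrightarrow> f \<in> V"
      using V unfolding closed_L2_subspace_def by (elim conjE)
    have "(\<lambda>y. f (g y)) \<in> V"
      by (rule mp[OF bspec[OF cl L2g[OF f]]], intro allI impI, rule ex)
    then show "f \<in> W" using f by (simp add: W_def)
  qed
  moreover have "L2_eigenfunctions G T actX M \<subseteq> W"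
  proof
    fix f assume "f \<in> L2_eigenfunctions G T actX M"
    then obtain \<gamma> where f: "f \<in> L2_functions M" and \<gamma>: "\<gamma> \<in> carrier (dual_group G T)"
      and ae: "\<And>t. t \<in> carrier G \<Longrightarrow> AE x in M. f (actX t x) = \<gamma> t * f x"
      by (auto simp: L2_eigenfunctions_def)
    have "AE y in N. f (g (actY t y)) = \<gamma> t * f (g y)" if t: "t \<in> carrier G" for t
    proof -
      have "AE y in N. f (actX t (g y)) = \<gamma> t * f (g y)"
        using AE_distrD[OF measg] ae[OF t] unfolding M_def borel_pushforward_def by blast
      moreover have "AE y in N. g (actY t y) = actX t (g y)"
        using g t spN by (intro AE_I2) (auto simp: conjugacy_def)
      ultimately show ?thesis by eventually_elim simp
    qed
    then have "(\<lambda>y. f (g y)) \<in> L2_eigenfunctions G T actY N"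
      using L2g[OF f] \<gamma> by (auto simp: L2_eigenfunctions_def)
    then show "f \<in> W" using eig f by (auto simp: W_def)
  qed
  ultimately have LW: "L2_functions M \<subseteq> W" using pp[OF M] unfolding pure_point_spectrum_iff by blast
  show "L2_functions N \<subseteq> V"
  proof
    fix f assume f: "f \<in> L2_functions N"
    have f': "f \<in> borel_measurable N" "integrable N (\<lambda>x. (cmod (f x))\<^sup>2)" using f by (auto simp: L2_functions_def)
    have fh: "(\<lambda>x. f (h x)) \<in> borel_measurable M" using measurable_compose[OF hN f'(1)] .
    have "integrable N (\<lambda>y. (cmod (f (h (g y))))\<^sup>2)"
      using f'(2) by (rule Bochner_Integration.integrable_cong[THEN iffD1, OF refl, rotated]) (use hg spN in auto)
    then have "integrable M (\<lambda>x. (cmod (f (h x)))\<^sup>2)"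
      using intb[of "\<lambda>x. (cmod (f (h x)))\<^sup>2"] fh by auto
    then have "(\<lambda>x. f (h x)) \<in> W" using fh LW by (auto simp: L2_functions_def)
    then have "(\<lambda>y. f (h (g y))) \<in> V" by (simp add: W_def)
    then show "f \<in> V" by (rule closed_L2_subspace_cong[OF V f]) (use hg spN in auto)
  qed
qed

section \<open>Continuous eigenfunctions and the quotient\<close>

lemma continuous_eigenfunctionD:
  assumes "continuous_eigenfunction G T X act \<gamma> f"
  shows "\<gamma> \<in> carrier (dual_group G T)" and "f \<in> extensional (topspace X)"
    and "continuous_map X euclidean f" and "\<exists>x\<in>topspace X. f x \<noteq> 0"
    and "t \<in> carrier G \<Longrightarrow> x \<in> topspace X \<Longrightarrow> f (act t x) = \<gamma> t * f x"
  using assms by (auto simp: continuous_eigenfunction_def)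

context minimal_system
begin

abbreviation eigenfunction :: "('a \<Rightarrow> complex) \<Rightarrow> ('c \<Rightarrow> complex) \<Rightarrow> bool" where
  "eigenfunction \<equiv> continuous_eigenfunction G T X act"

abbreviation E :: "('a \<Rightarrow> complex) set" where
  "E \<equiv> continuous_eigenvalues G T X act"

text \<open>The level set of the value at \<open>x\<close> is closed and contains the dense orbit of \<open>x\<close>.\<close>

lemma invariant_constant:
  fixes f :: "'c \<Rightarrow> 'y::t1_space"
  assumes f: "continuous_map X euclidean f"
    and inv: "\<And>t x. t \<in> carrier G \<Longrightarrow> x \<in> topspace X \<Longrightarrow> f (act t x) = f x"
    and xy: "x \<in> topspace X" "y \<in> topspace X"
  shows "f y = f x"
proof -
  have "closedin X {z \<in> topspace X. f z \<in> {f x}}"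
    using f by (rule closedin_continuous_map_preimage) simp
  moreover have "orbit G act x \<subseteq> {z \<in> topspace X. f z \<in> {f x}}"
    using inv xy act_closed by (auto simp: orbit_def)
  ultimately have "X closure_of orbit G act x \<subseteq> {z \<in> topspace X. f z \<in> {f x}}"
    by (intro closure_of_minimal)
  then show ?thesis using dense_orbits[OF xy(1)] xy(2) by auto
qed

lemma eigenfunction_norm:
  assumes f: "eigenfunction \<gamma> f" and xy: "x \<in> topspace X" "y \<in> topspace X"
  shows "cmod (f y) = cmod (f x)"
proof (rule invariant_constant[OF _ _ xy])
  show "continuous_map X euclidean (\<lambda>x. cmod (f x))"
    using continuous_eigenfunctionD(3)[OF f] by (simp add: continuous_map_atin tendsto_norm)
  show "cmod (f (act t x)) = cmod (f x)" if "t \<in> carrier G" "x \<in> topspace X" for t x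
    using continuous_eigenfunctionD(5)[OF f that] dual_groupD(1)[OF continuous_eigenfunctionD(1)[OF f] that(1)]
    by (simp add: norm_mult)
qed

lemma eigenfunction_nonzero:
  assumes f: "eigenfunction \<gamma> f" and x: "x \<in> topspace X" shows "f x \<noteq> 0"
proof -
  obtain y where "y \<in> topspace X" "f y \<noteq> 0" using continuous_eigenfunctionD(4)[OF f] by auto
  then show ?thesis using eigenfunction_norm[OF f _ x, of y] by auto
qed

text \<open>The quotient of two eigenfunctions with the same eigenvalue is invariant.  The statement is
  cross-multiplied to avoid division.\<close>

lemma eigenfunction_unique:
  assumes f: "eigenfunction \<gamma> f" and g: "eigenfunction \<gamma> g" and xy: "x \<in> topspace X" "y \<in> topspace X"
  shows "f y * g x = f x * g y"
proof -
  have "f y / g y = f x / g x"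
  proof (rule invariant_constant[OF _ _ xy])
    show "continuous_map X euclidean (\<lambda>x. f x / g x)"
      using continuous_eigenfunctionD(3)[OF f] continuous_eigenfunctionD(3)[OF g] eigenfunction_nonzero[OF g]
      by (simp add: continuous_map_atin tendsto_divide)
    show "f (act t x) / g (act t x) = f x / g x" if "t \<in> carrier G" "x \<in> topspace X" for t x
    proof -
      have "\<gamma> t \<noteq> 0" using dual_groupD(1)[OF continuous_eigenfunctionD(1)[OF f] that(1)] by auto
      then show ?thesis
        using continuous_eigenfunctionD(5)[OF f that] continuous_eigenfunctionD(5)[OF g that] by simp
    qed
  qed
  then show ?thesis
    using eigenfunction_nonzero[OF g xy(1)] eigenfunction_nonzero[OF g xy(2)] by (simp add: field_simps)
qed

lemma eigenfunction_scale:
  assumes f: "eigenfunction \<gamma> f" and "c \<noteq> 0"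
  shows "eigenfunction \<gamma> (\<lambda>x\<in>topspace X. c * f x)"
proof -
  have "continuous_map X euclidean (\<lambda>x. c * f x)"
    using continuous_eigenfunctionD(3)[OF f] by (simp add: continuous_map_atin tendsto_mult)
  then have "continuous_map X euclidean (\<lambda>x\<in>topspace X. c * f x)"
    by (rule continuous_map_eq) simp
  then show ?thesis
    using f \<open>c \<noteq> 0\<close> act_closed by (auto simp: continuous_eigenfunction_def)
qed

lemma eigenfunction_one: "eigenfunction (\<lambda>t\<in>carrier G. 1) (\<lambda>x\<in>topspace X. 1)"
proof -
  have "continuous_map T euclidean (\<lambda>t. 1 :: complex)" "continuous_map X euclidean (\<lambda>x. 1 :: complex)" by simp_all
  then have "continuous_map T euclidean (\<lambda>t\<in>carrier G. 1 :: complex)"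
    "continuous_map X euclidean (\<lambda>x\<in>topspace X. 1 :: complex)"
    using topspace_eq_carrier by (auto elim!: continuous_map_eq)
  then show ?thesis
    using ex_in_conv[of "topspace X"] nonempty act_closed
    by (auto simp: continuous_eigenfunction_def dual_group_def hom_def circle_group_def)
qed

lemma eigenfunction_mult:
  assumes f: "eigenfunction \<gamma> f" and g: "eigenfunction \<delta> g"
  shows "eigenfunction (\<lambda>t\<in>carrier G. \<gamma> t * \<delta> t) (\<lambda>x\<in>topspace X. f x * g x)"
proof -
  note \<gamma> = dual_groupD[OF continuous_eigenfunctionD(1)[OF f]]
  note \<delta> = dual_groupD[OF continuous_eigenfunctionD(1)[OF g]]
  have "continuous_map T euclidean (\<lambda>t\<in>carrier G. \<gamma> t * \<delta> t)"
    using topspace_eq_carrier by (intro continuous_map_eq[OF continuous_map_complex_mult[OF \<gamma>(4) \<delta>(4)]]) simp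
  then have "(\<lambda>t\<in>carrier G. \<gamma> t * \<delta> t) \<in> carrier (dual_group G T)"
    using \<gamma>(1,2) \<delta>(1,2) by (auto simp: dual_group_def hom_def circle_group_def norm_mult)
  moreover have "continuous_map X euclidean (\<lambda>x\<in>topspace X. f x * g x)"
    by (intro continuous_map_eq[OF continuous_map_complex_mult[OF
            continuous_eigenfunctionD(3)[OF f] continuous_eigenfunctionD(3)[OF g]]]) simp
  moreover obtain x where "x \<in> topspace X" using nonempty by blast
  moreover have "f x * g x \<noteq> 0" if "x \<in> topspace X" for x
    using eigenfunction_nonzero[OF f that] eigenfunction_nonzero[OF g that] by simp
  ultimately show ?thesis
    using continuous_eigenfunctionD(5)[OF f] continuous_eigenfunctionD(5)[OF g] act_closed
    unfolding continuous_eigenfunction_def by auto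
qed

lemma eigenfunction_cnj:
  assumes f: "eigenfunction \<gamma> f"
  shows "eigenfunction (\<lambda>t\<in>carrier G. cnj (\<gamma> t)) (\<lambda>x\<in>topspace X. cnj (f x))"
proof -
  note \<gamma> = dual_groupD[OF continuous_eigenfunctionD(1)[OF f]]
  have "continuous_map T euclidean (\<lambda>t. cnj (\<gamma> t))" "continuous_map X euclidean (\<lambda>x. cnj (f x))"
    using \<gamma>(4) continuous_eigenfunctionD(3)[OF f] by (simp_all add: continuous_map_atin tendsto_cnj)
  then have "continuous_map T euclidean (\<lambda>t\<in>carrier G. cnj (\<gamma> t))"
    "continuous_map X euclidean (\<lambda>x\<in>topspace X. cnj (f x))"
    using topspace_eq_carrier by (auto elim!: continuous_map_eq)
  moreover then have "(\<lambda>t\<in>carrier G. cnj (\<gamma> t)) \<in> carrier (dual_group G T)"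
    using \<gamma>(1,2) by (auto simp: dual_group_def hom_def circle_group_def)
  moreover obtain x where "x \<in> topspace X" using nonempty by blast
  ultimately show ?thesis
    using continuous_eigenfunctionD(5)[OF f] eigenfunction_nonzero[OF f] act_closed
    unfolding continuous_eigenfunction_def by auto
qed

sublocale chars: character_subgroup G T E
proof
  show "E \<subseteq> carrier (dual_group G T)"
    by (auto simp: continuous_eigenvalues_def dest: continuous_eigenfunctionD(1))
  show "(\<lambda>t\<in>carrier G. 1) \<in> E" using eigenfunction_one by (auto simp: continuous_eigenvalues_def)
  show "(\<lambda>t\<in>carrier G. \<gamma> t * \<delta> t) \<in> E" if "\<gamma> \<in> E" "\<delta> \<in> E" for \<gamma> \<delta>
    using that eigenfunction_mult by (fastforce simp: continuous_eigenvalues_def)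
  show "(\<lambda>t\<in>carrier G. cnj (\<gamma> t)) \<in> E" if "\<gamma> \<in> E" for \<gamma>
    using that eigenfunction_cnj by (fastforce simp: continuous_eigenvalues_def)
qed

lemma eigenvalue_dual_eq: "eigenvalue_dual G T X act = top_of_set chars.dual"
  unfolding eigenvalue_dual_def eigenvalue_group_def by (rule chars.dual_topology_eq)

lemma eigenvalue_dual_action_eq: "eigenvalue_dual_action G T X act = chars.translate"
  unfolding eigenvalue_dual_action_def chars.translate_def eigenvalue_dual_eq by simp

end

locale pointed_minimal_system = minimal_system +
  fixes x0 assumes x0: "x0 \<in> topspace X"
begin

definition normalised :: "('a \<Rightarrow> complex) \<Rightarrow> 'c \<Rightarrow> complex" where
  "normalised \<gamma> = (SOME f. eigenfunction \<gamma> f \<and> f x0 = 1)"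

lemma normalised_eq: assumes "eigenfunction \<gamma> f" "f x0 = 1" shows "normalised \<gamma> = f"
proof -
  have n: "eigenfunction \<gamma> (normalised \<gamma>) \<and> normalised \<gamma> x0 = 1"
    unfolding normalised_def by (rule someI[of _ f]) (use assms in simp)
  show ?thesis
  proof (rule extensionalityI[of _ "topspace X"])
    show "normalised \<gamma> \<in> extensional (topspace X)" "f \<in> extensional (topspace X)"
      using n assms continuous_eigenfunctionD(2) by blast+
    show "normalised \<gamma> x = f x" if "x \<in> topspace X" for x
      using eigenfunction_unique[OF _ assms(1) x0 that, of "normalised \<gamma>"] n assms(2) by simp
  qed
qed

lemma normalised:
  assumes "\<gamma> \<in> E" shows "eigenfunction \<gamma> (normalised \<gamma>)" and "normalised \<gamma> x0 = 1"
proof -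
  obtain f where f: "eigenfunction \<gamma> f" using assms by (auto simp: continuous_eigenvalues_def)
  let ?g = "\<lambda>x\<in>topspace X. inverse (f x0) * f x"
  have "f x0 \<noteq> 0" using eigenfunction_nonzero[OF f x0] .
  then have g: "eigenfunction \<gamma> ?g" "?g x0 = 1" using eigenfunction_scale[OF f] x0 by auto
  show "eigenfunction \<gamma> (normalised \<gamma>)" "normalised \<gamma> x0 = 1"
    unfolding normalised_eq[OF g] by (rule g)+
qed

lemma eigenfunction_eq_scale:
  assumes f: "eigenfunction \<gamma> f" shows "f = (\<lambda>x\<in>topspace X. f x0 * normalised \<gamma> x)"
proof (rule extensionalityI[of _ "topspace X"])
  have \<gamma>: "\<gamma> \<in> E" using f by (auto simp: continuous_eigenvalues_def)
  show "f x = (\<lambda>x\<in>topspace X. f x0 * normalised \<gamma> x) x" if "x \<in> topspace X" for x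
    using eigenfunction_unique[OF f normalised(1)[OF \<gamma>] x0 that] normalised(2)[OF \<gamma>] that by simp
qed (use continuous_eigenfunctionD(2)[OF f] in auto)

lemma normalised_mult:
  assumes "\<gamma> \<in> E" "\<delta> \<in> E"
  shows "normalised (\<lambda>t\<in>carrier G. \<gamma> t * \<delta> t) = (\<lambda>x\<in>topspace X. normalised \<gamma> x * normalised \<delta> x)"
  using normalised[OF assms(1)] normalised[OF assms(2)] x0
  by (intro normalised_eq eigenfunction_mult) auto

lemma normalised_one: "normalised (\<lambda>t\<in>carrier G. 1) = (\<lambda>x\<in>topspace X. 1)"
  using x0 by (intro normalised_eq eigenfunction_one) auto

lemma normalised_norm: "\<gamma> \<in> E \<Longrightarrow> x \<in> topspace X \<Longrightarrow> cmod (normalised \<gamma> x) = 1"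
  using eigenfunction_norm[OF normalised(1) x0] normalised(2) by fastforce

definition factor :: "'c \<Rightarrow> ('a \<Rightarrow> complex) \<Rightarrow> complex" where
  "factor x = (\<lambda>\<gamma>\<in>E. normalised \<gamma> x)"

lemma factor_dual: assumes x: "x \<in> topspace X" shows "factor x \<in> chars.dual"
  using x by (auto simp: chars.dual_def factor_def normalised_norm normalised_mult chars.E_mult)

lemma factor_act:
  assumes "t \<in> carrier G" "x \<in> topspace X" shows "factor (act t x) = chars.translate t (factor x)"
proof (rule chars.dual_ext)
  show "factor (act t x) \<gamma> = chars.translate t (factor x) \<gamma>" if \<gamma>: "\<gamma> \<in> E" for \<gamma>
    using continuous_eigenfunctionD(5)[OF normalised(1)[OF \<gamma>] assms] chars.translate_apply[OF factor_dual[OF assms(2)] \<gamma>] \<gamma>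
    by (simp add: factor_def)
qed (use assms in \<open>auto intro: factor_dual chars.translate_closed act_closed\<close>)

lemma continuous_factor: "continuous_map X (top_of_set chars.dual) factor"
proof -
  have "continuous_map X (product_topology (\<lambda>_. euclidean) UNIV) factor"
    unfolding continuous_map_componentwise_UNIV
  proof
    fix \<gamma>
    show "continuous_map X euclidean (\<lambda>x. factor x \<gamma>)"
      using continuous_eigenfunctionD(3)[OF normalised(1), of \<gamma>] by (cases "\<gamma> \<in> E") (simp_all add: factor_def eta_contract_eq)
  qed
  then show ?thesis using factor_dual
    by (auto simp: continuous_map_in_subtopology euclidean_product_topology)
qed

text \<open>The image is compact and invariant, and the dual group has no proper nonempty closed invariant
  subset.\<close>

proposition factor_surj: "factor ` topspace X = chars.dual"
proof (rule chars.invariant_closed_eq_dual)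
  have "compactin (top_of_set chars.dual) (factor ` topspace X)"
    using image_compactin[OF _ continuous_factor] compact by (simp add: compact_space_def)
  then show "closedin (top_of_set chars.dual) (factor ` topspace X)"
    by (rule compactin_imp_closedin[OF Hausdorff_space_top_of_set])
  show "factor ` topspace X \<noteq> {}" using x0 by auto
  fix t \<xi> assume t: "t \<in> carrier G" and "\<xi> \<in> factor ` topspace X"
  then obtain x where x: "x \<in> topspace X" "\<xi> = factor x" by auto
  show "chars.translate t \<xi> \<in> factor ` topspace X"
    unfolding x(2) factor_act[OF t x(1), symmetric] using act_closed[OF t x(1)] by (rule imageI)
qed

abbreviation r where "r \<equiv> eigen_rel G T X act"
abbreviation XS where "XS \<equiv> eigen_quotient G T X act"
abbreviation actS where "actS \<equiv> eigen_quotient_action G T X act"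

text \<open>Every eigenfunction is a scalar multiple of a normalised one.\<close>

lemma eigen_rel_iff: "(x, y) \<in> r \<longleftrightarrow> x \<in> topspace X \<and> y \<in> topspace X \<and> factor x = factor y"
proof -
  have "(\<forall>\<gamma> f. eigenfunction \<gamma> f \<longrightarrow> f x = f y) \<longleftrightarrow> factor x = factor y"
    if xy: "x \<in> topspace X" "y \<in> topspace X"
  proof
    assume "\<forall>\<gamma> f. eigenfunction \<gamma> f \<longrightarrow> f x = f y"
    then show "factor x = factor y" unfolding factor_def using normalised(1) by (intro restrict_ext) blast
  next
    assume eq: "factor x = factor y"
    show "\<forall>\<gamma> f. eigenfunction \<gamma> f \<longrightarrow> f x = f y"
    proof (intro allI impI)
      fix \<gamma> f assume f: "eigenfunction \<gamma> f"
      then have "\<gamma> \<in> E" by (auto simp: continuous_eigenvalues_def)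
      then have "normalised \<gamma> x = normalised \<gamma> y" using fun_cong[OF eq, of \<gamma>] by (simp add: factor_def)
      moreover have "f z = f x0 * normalised \<gamma> z" if "z \<in> topspace X" for z
        using fun_cong[OF eigenfunction_eq_scale[OF f], of z] that by simp
      ultimately show "f x = f y" using xy by simp
    qed
  qed
  then show ?thesis by (auto simp: eigen_rel_def)
qed

lemma rel_class: "x \<in> topspace X \<Longrightarrow> r `` {x} = {y \<in> topspace X. factor y = factor x}"
  by (auto simp: eigen_rel_iff)

lemma topspace_XS: "topspace XS = (\<lambda>x. r `` {x}) ` topspace X"
  by (auto simp: eigen_quotient_def topspace_quotient_topology quotient_def)

text \<open>The factor map induced on classes, through an arbitrary representative.\<close>

definition class_factor :: "'c set \<Rightarrow> ('a \<Rightarrow> complex) \<Rightarrow> complex" where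
  "class_factor c = factor (SOME x. x \<in> c)"

lemma class_factor: assumes "x \<in> topspace X" shows "class_factor (r `` {x}) = factor x"
proof -
  have "x \<in> r `` {x}" using assms by (simp add: rel_class)
  then have "(SOME y. y \<in> r `` {x}) \<in> r `` {x}" by (rule someI[where P = "\<lambda>y. y \<in> r `` {x}"])
  then show ?thesis using assms by (simp add: class_factor_def rel_class)
qed

lemma continuous_quotient_map: "continuous_map X XS (\<lambda>x. r `` {x})"
  unfolding continuous_map_def
proof (intro conjI allI impI)
  show "(\<lambda>x. r `` {x}) \<in> topspace X \<rightarrow> topspace XS" by (auto simp: topspace_XS)
  fix U assume "openin XS U"
  then show "openin X {x \<in> topspace X. r `` {x} \<in> U}"
    by (simp add: eigen_quotient_def openin_quotient_topology)
qed

lemma compact_XS: "compact_space XS"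
  using image_compactin[OF _ continuous_quotient_map, of "topspace X"] compact
  by (simp add: compact_space_def topspace_XS)

lemma actS_class:
  assumes "t \<in> carrier G" "x \<in> topspace X" shows "actS t (r `` {x}) = r `` {act t x}"
proof -
  have "(\<Union>y\<in>r `` {x}. r `` {act t y}) = r `` {act t x}"
  proof -
    have "r `` {act t y} = r `` {act t x}" if "y \<in> r `` {x}" for y
      using that assms by (auto simp: rel_class act_closed factor_act)
    moreover have "r `` {x} \<noteq> {}" using assms by (auto simp: rel_class)
    ultimately show ?thesis by auto
  qed
  then show ?thesis using assms by (simp add: eigen_quotient_action_def topspace_XS)
qed

lemma conjugacy_quotient: "conjugacy G XS actS (top_of_set chars.dual) chars.translate class_factor"
  unfolding conjugacy_def
proof (intro conjI ballI)
  show "homeomorphic_map XS (top_of_set chars.dual) class_factor"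
  proof (rule continuous_imp_homeomorphic_map)
    show "continuous_map XS (top_of_set chars.dual) class_factor"
      unfolding continuous_map_def
    proof (intro conjI allI impI)
      show "class_factor \<in> topspace XS \<rightarrow> topspace (top_of_set chars.dual)"
        by (auto simp: topspace_XS class_factor factor_dual)
      fix U assume "openin (top_of_set chars.dual) U"
      then have "openin X {x \<in> topspace X. factor x \<in> U}"
        using continuous_factor by (auto simp: continuous_map_def)
      also have "{x \<in> topspace X. factor x \<in> U} = {x \<in> topspace X. r `` {x} \<in> {c \<in> topspace XS. class_factor c \<in> U}}"
        by (auto simp: topspace_XS class_factor)
      finally show "openin XS {c \<in> topspace XS. class_factor c \<in> U}"
        by (auto simp: eigen_quotient_def openin_quotient_topology topspace_quotient_topology)
    qed
    show "compact_space XS" by (rule compact_XS)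
    show "Hausdorff_space (top_of_set chars.dual)" by (rule Hausdorff_space_top_of_set)
    show "class_factor ` topspace XS = topspace (top_of_set chars.dual)"
      using factor_surj by (simp add: topspace_XS image_image class_factor)
    show "inj_on class_factor (topspace XS)"
    proof (rule inj_onI)
      fix c d assume "c \<in> topspace XS" "d \<in> topspace XS" and eq: "class_factor c = class_factor d"
      then obtain x y where "x \<in> topspace X" "c = r `` {x}" "y \<in> topspace X" "d = r `` {y}"
        by (auto simp: topspace_XS)
      then show "c = d" using eq class_factor[of x] class_factor[of y] rel_class[of x] rel_class[of y] by simp
    qed
  qed
  fix t c assume t: "t \<in> carrier G" and "c \<in> topspace XS"
  then obtain x where x: "x \<in> topspace X" "c = r `` {x}" by (auto simp: topspace_XS)
  then show "class_factor (actS t c) = chars.translate t (class_factor c)"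
    using t by (simp add: actS_class class_factor act_closed factor_act)
qed

lemma actS_closed: "t \<in> carrier G \<Longrightarrow> c \<in> topspace XS \<Longrightarrow> actS t c \<in> topspace XS"
  by (auto simp: topspace_XS actS_class act_closed)

end

section \<open>The Gelfand spectrum\<close>

text \<open>Closedness in the supremum metric, in terms of pointwise estimates.\<close>

lemma closedin_cfunspace:
  assumes comp: "compact_space X" and ne: "topspace X \<noteq> {}"
  shows "closedin (mtopology_of (cfunspace X (euclidean_metric :: complex metric))) S \<longleftrightarrow>
    S \<subseteq> {f \<in> extensional (topspace X). continuous_map X euclidean f} \<and>
    (\<forall>f \<in> extensional (topspace X). continuous_map X euclidean f \<longrightarrow>
       (\<forall>e>0. \<exists>g\<in>S. \<forall>x\<in>topspace X. cmod (f x - g x) < e) \<longrightarrow> f \<in> S)"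
proof -
  let ?m = "cfunspace X (euclidean_metric :: complex metric)"
  let ?C = "{f \<in> extensional (topspace X). continuous_map X euclidean f}"
  have C: "mspace ?m = ?C"
    using comp by (subst compactin_mspace_cfunspace) (auto simp: compact_space_def)
  interpret M: Metric_space "mspace ?m" "mdist ?m" by (rule Metric_space_mspace_mdist)
  have le: "mdist ?m f g \<le> a \<longleftrightarrow> (\<forall>x\<in>topspace X. cmod (f x - g x) \<le> a)" if "f \<in> ?C" "g \<in> ?C" for f g a
  proof -
    have "f \<in> mspace ?m" "g \<in> mspace ?m" unfolding C by (rule that)+
    from cfunspace_mdist_le[OF this ne, of a] show ?thesis by (simp add: dist_norm)
  qed
  have near: "(\<exists>r>0. disjnt S (M.mball f r)) \<longleftrightarrow>
      \<not> (\<forall>e>0. \<exists>g\<in>S. \<forall>x\<in>topspace X. cmod (f x - g x) < e)" if f: "f \<in> ?C" and S: "S \<subseteq> ?C" for f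
  proof -
    have "(\<forall>r>0. \<exists>g\<in>S. mdist ?m f g < r) \<longleftrightarrow> (\<forall>e>0. \<exists>g\<in>S. \<forall>x\<in>topspace X. cmod (f x - g x) < e)" (is "?L \<longleftrightarrow> ?R")
    proof
      assume L: ?L
      show ?R
      proof (intro allI impI)
        fix e :: real assume "e > 0"
        then have "e / 2 > 0" by simp
        then obtain g where g: "g \<in> S" "mdist ?m f g < e / 2" using L by blast
        then have "\<forall>x\<in>topspace X. cmod (f x - g x) \<le> e / 2" using le[of f g "e / 2"] f S by auto
        then show "\<exists>g\<in>S. \<forall>x\<in>topspace X. cmod (f x - g x) < e"
          using g(1) \<open>e > 0\<close> by (intro bexI[of _ g]) (auto intro: le_less_trans)
      qed
    next
      assume R: ?R
      show ?L
      proof (intro allI impI)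
        fix e :: real assume "e > 0"
        then have "e / 2 > 0" by simp
        then obtain g where g: "g \<in> S" "\<forall>x\<in>topspace X. cmod (f x - g x) < e / 2" using R by blast
        then have "mdist ?m f g \<le> e / 2" using le[of f g "e / 2"] f S by (auto simp: less_imp_le)
        then show "\<exists>g\<in>S. mdist ?m f g < e" using g(1) \<open>e > 0\<close> by (intro bexI[of _ g]) auto
      qed
    qed
    moreover have "disjnt S (M.mball f r) \<longleftrightarrow> \<not> (\<exists>g\<in>S. mdist ?m f g < r)" for r
      unfolding disjnt_iff M.in_mball unfolding C using f S by blast
    ultimately show ?thesis by blast
  qed
  have "closedin (mtopology_of ?m) S \<longleftrightarrow> S \<subseteq> ?C \<and> (\<forall>f. f \<in> ?C - S \<longrightarrow> (\<exists>r>0. disjnt S (M.mball f r)))"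
    unfolding mtopology_of_def M.closedin_metric unfolding C ..
  also have "\<dots> \<longleftrightarrow> S \<subseteq> ?C \<and> (\<forall>f. f \<in> ?C - S \<longrightarrow> \<not> (\<forall>e>0. \<exists>g\<in>S. \<forall>x\<in>topspace X. cmod (f x - g x) < e))"
    using near by (intro conj_cong refl iff_allI imp_cong) auto
  also have "\<dots> \<longleftrightarrow> S \<subseteq> ?C \<and> (\<forall>f \<in> extensional (topspace X). continuous_map X euclidean f \<longrightarrow>
       (\<forall>e>0. \<exists>g\<in>S. \<forall>x\<in>topspace X. cmod (f x - g x) < e) \<longrightarrow> f \<in> S)"
    by blast
  finally show ?thesis .
qed

context pointed_minimal_system
begin

definition CX :: "('c \<Rightarrow> complex) set" where
  "CX = {f \<in> extensional (topspace X). continuous_map X euclidean f}"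

abbreviation A where "A \<equiv> eigen_algebra G T X act"
abbreviation XA where "XA \<equiv> eigen_spectrum G T X act"
abbreviation actA where "actA \<equiv> eigen_spectrum_action G T X act"

lemma closed_subalgebra_iff:
  "closed_subalgebra X S \<longleftrightarrow> S \<subseteq> CX \<and>
     (\<forall>f\<in>CX. (\<forall>e>0. \<exists>g\<in>S. \<forall>x\<in>topspace X. cmod (f x - g x) < e) \<longrightarrow> f \<in> S) \<and>
     (\<lambda>x\<in>topspace X. 0) \<in> S \<and>
     (\<forall>f\<in>S. \<forall>g\<in>S. (\<lambda>x\<in>topspace X. f x + g x) \<in> S) \<and>
     (\<forall>c. \<forall>f\<in>S. (\<lambda>x\<in>topspace X. c * f x) \<in> S) \<and>
     (\<forall>f\<in>S. \<forall>g\<in>S. (\<lambda>x\<in>topspace X. f x * g x) \<in> S)"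
  unfolding closed_subalgebra_def closedin_cfunspace[OF compact nonempty] CX_def by blast

lemma CX_restrict: "continuous_map X euclidean f \<Longrightarrow> (\<lambda>x\<in>topspace X. f x) \<in> CX"
  unfolding CX_def by (auto elim: continuous_map_eq)

lemma CX_ops:
  assumes "f \<in> CX" "g \<in> CX"
  shows "(\<lambda>x\<in>topspace X. f x + g x) \<in> CX" "(\<lambda>x\<in>topspace X. c * f x) \<in> CX" "(\<lambda>x\<in>topspace X. f x * g x) \<in> CX"
proof -
  have "continuous_map X euclidean f" "continuous_map X euclidean g" using assms by (auto simp: CX_def)
  then have cont: "continuous_map X euclidean (\<lambda>x. f x + g x)" "continuous_map X euclidean (\<lambda>x. c * f x)"
    "continuous_map X euclidean (\<lambda>x. f x * g x)"
    by (simp_all add: continuous_map_atin tendsto_add tendsto_mult)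
  show "(\<lambda>x\<in>topspace X. f x + g x) \<in> CX" "(\<lambda>x\<in>topspace X. c * f x) \<in> CX" "(\<lambda>x\<in>topspace X. f x * g x) \<in> CX"
    by (intro CX_restrict cont)+
qed

lemma CX_zero: "(\<lambda>x\<in>topspace X. 0) \<in> CX"
  by (rule CX_restrict) simp

lemma closed_subalgebra_CX: "closed_subalgebra X CX"
  unfolding closed_subalgebra_iff using CX_ops CX_zero by auto

lemma eigenfunction_CX: "eigenfunction \<gamma> f \<Longrightarrow> f \<in> CX"
  by (simp add: CX_def continuous_eigenfunctionD(2,3))

lemma eigen_algebra_least:
  assumes "closed_subalgebra X S" "\<And>\<gamma> f. eigenfunction \<gamma> f \<Longrightarrow> f \<in> S" shows "A \<subseteq> S"
  unfolding eigen_algebra_def using assms by (intro Inter_lower) auto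

lemma A_CX: "A \<subseteq> CX"
  by (rule eigen_algebra_least[OF closed_subalgebra_CX eigenfunction_CX])

lemma eigenfunction_A: "eigenfunction \<gamma> f \<Longrightarrow> f \<in> A"
  unfolding eigen_algebra_def by auto

lemma eigen_algebra_memI:
  assumes "\<And>S. closed_subalgebra X S \<Longrightarrow> {f. \<exists>\<gamma>. eigenfunction \<gamma> f} \<subseteq> S \<Longrightarrow> f \<in> S" shows "f \<in> A"
  unfolding eigen_algebra_def using assms by auto

lemma eigen_algebra_memD:
  assumes "f \<in> A" "closed_subalgebra X S" "{f. \<exists>\<gamma>. eigenfunction \<gamma> f} \<subseteq> S" shows "f \<in> S"
  using assms unfolding eigen_algebra_def by auto

lemma A_zero: "(\<lambda>x\<in>topspace X. 0) \<in> A"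
  by (rule eigen_algebra_memI) (simp add: closed_subalgebra_def)

lemma A_add: assumes "f \<in> A" "g \<in> A" shows "(\<lambda>x\<in>topspace X. f x + g x) \<in> A"
proof (rule eigen_algebra_memI)
  fix S assume S: "closed_subalgebra X S" "{f. \<exists>\<gamma>. eigenfunction \<gamma> f} \<subseteq> S"
  then show "(\<lambda>x\<in>topspace X. f x + g x) \<in> S"
    using eigen_algebra_memD[OF assms(1) S] eigen_algebra_memD[OF assms(2) S] unfolding closed_subalgebra_def by blast
qed

lemma A_mult: assumes "f \<in> A" "g \<in> A" shows "(\<lambda>x\<in>topspace X. f x * g x) \<in> A"
proof (rule eigen_algebra_memI)
  fix S assume S: "closed_subalgebra X S" "{f. \<exists>\<gamma>. eigenfunction \<gamma> f} \<subseteq> S"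
  then show "(\<lambda>x\<in>topspace X. f x * g x) \<in> S"
    using eigen_algebra_memD[OF assms(1) S] eigen_algebra_memD[OF assms(2) S] unfolding closed_subalgebra_def by blast
qed

lemma A_scale: assumes "f \<in> A" shows "(\<lambda>x\<in>topspace X. c * f x) \<in> A"
proof (rule eigen_algebra_memI)
  fix S assume S: "closed_subalgebra X S" "{f. \<exists>\<gamma>. eigenfunction \<gamma> f} \<subseteq> S"
  then show "(\<lambda>x\<in>topspace X. c * f x) \<in> S"
    using eigen_algebra_memD[OF assms(1) S] unfolding closed_subalgebra_def by blast
qed

lemma A_closed:
  assumes "f \<in> CX" "\<And>e. e > 0 \<Longrightarrow> \<exists>g\<in>A. \<forall>x\<in>topspace X. cmod (f x - g x) < e" shows "f \<in> A"
proof (rule eigen_algebra_memI)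
  fix S assume S: "closed_subalgebra X S" "{f. \<exists>\<gamma>. eigenfunction \<gamma> f} \<subseteq> S"
  have "\<forall>e>0. \<exists>g\<in>S. \<forall>x\<in>topspace X. cmod (f x - g x) < e"
    using assms(2) eigen_algebra_memD[OF _ S] by meson
  then show "f \<in> S" using S(1) assms(1) unfolding closed_subalgebra_iff by blast
qed

lemma A_ext: "f \<in> A \<Longrightarrow> f \<in> extensional (topspace X)"
  using A_CX by (auto simp: CX_def)

text \<open>The continuous functions \<open>f\<close> for which \<open>f (act t \<cdot>)\<close> lies in the algebra form a closed subalgebra
  that contains the eigenfunctions.\<close>

lemma A_act:
  assumes t: "t \<in> carrier G" and f: "f \<in> A" shows "(\<lambda>x\<in>topspace X. f (act t x)) \<in> A"
proof -
  let ?s = "\<lambda>f. \<lambda>x\<in>topspace X. f (act t x)"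
  define S where "S = {f \<in> CX. ?s f \<in> A}"
  have sC: "?s f \<in> CX" if "f \<in> CX" for f
  proof -
    have "continuous_map X euclidean (\<lambda>x. f (act t x))"
      using continuous_map_compose[OF continuous_map_act[OF t], of euclidean f] that by (simp add: CX_def o_def)
    then show ?thesis by (rule CX_restrict)
  qed
  have cl: "act t x \<in> topspace X" if "x \<in> topspace X" for x using act_closed[OF t that] .
  have "closed_subalgebra X S"
    unfolding closed_subalgebra_iff
  proof (intro conjI ballI allI impI)
    show "S \<subseteq> CX" by (auto simp: S_def)
    fix f assume f: "f \<in> CX" and lim: "\<forall>e>0. \<exists>g\<in>S. \<forall>x\<in>topspace X. cmod (f x - g x) < e"
    have "?s f \<in> A"
    proof (rule A_closed[OF sC[OF f]])
      fix e :: real assume "e > 0"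
      then obtain g where g: "g \<in> S" "\<forall>x\<in>topspace X. cmod (f x - g x) < e" using lim by blast
      then show "\<exists>g\<in>A. \<forall>x\<in>topspace X. cmod (?s f x - g x) < e"
        using cl by (intro bexI[of _ "?s g"]) (auto simp: S_def)
    qed
    then show "f \<in> S" using f by (simp add: S_def)
  next
    have eq: "?s (\<lambda>x\<in>topspace X. 0) = (\<lambda>x\<in>topspace X. 0)" using cl by (auto intro!: restrict_ext)
    show "(\<lambda>x\<in>topspace X. 0) \<in> S" unfolding S_def by (simp only: mem_Collect_eq eq CX_zero A_zero simp_thms)
  next
    fix f g assume "f \<in> S" "g \<in> S"
    then have f: "f \<in> CX" "?s f \<in> A" and g: "g \<in> CX" "?s g \<in> A" by (auto simp: S_def)
    have eq: "?s (\<lambda>x\<in>topspace X. f x + g x) = (\<lambda>x\<in>topspace X. ?s f x + ?s g x)"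
      "?s (\<lambda>x\<in>topspace X. f x * g x) = (\<lambda>x\<in>topspace X. ?s f x * ?s g x)"
      using cl by (auto intro!: restrict_ext)
    show "(\<lambda>x\<in>topspace X. f x + g x) \<in> S" unfolding S_def mem_Collect_eq eq
      by (rule conjI[OF CX_ops(1)[OF f(1) g(1)] A_add[OF f(2) g(2)]])
    show "(\<lambda>x\<in>topspace X. f x * g x) \<in> S" unfolding S_def mem_Collect_eq eq
      by (rule conjI[OF CX_ops(3)[OF f(1) g(1)] A_mult[OF f(2) g(2)]])
  next
    fix c f assume "f \<in> S"
    then have f: "f \<in> CX" "?s f \<in> A" by (auto simp: S_def)
    have eq: "?s (\<lambda>x\<in>topspace X. c * f x) = (\<lambda>x\<in>topspace X. c * ?s f x)" using cl by (auto intro!: restrict_ext)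
    show "(\<lambda>x\<in>topspace X. c * f x) \<in> S" unfolding S_def mem_Collect_eq eq
      by (rule conjI[OF CX_ops(2)[OF f(1) f(1)] A_scale[OF f(2)]])
  qed
  moreover have "f \<in> S" if f: "eigenfunction \<gamma> f" for \<gamma> f
  proof -
    have "?s f = (\<lambda>x\<in>topspace X. \<gamma> t * f x)"
      using continuous_eigenfunctionD(5)[OF f t] by (auto intro!: restrict_ext)
    then show ?thesis using eigenfunction_CX[OF f] A_scale[OF eigenfunction_A[OF f]] by (simp add: S_def)
  qed
  ultimately have "A \<subseteq> S" by (rule eigen_algebra_least)
  then show ?thesis using f by (auto simp: S_def)
qed

abbreviation \<Delta> where "\<Delta> \<equiv> multiplicative_functionals (topspace X) A"

lemma functionalD:
  assumes "\<phi> \<in> \<Delta>"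
  shows "\<phi> \<in> extensional A" and "f \<in> A \<Longrightarrow> g \<in> A \<Longrightarrow> \<phi> (\<lambda>x\<in>topspace X. f x + g x) = \<phi> f + \<phi> g"
    and "f \<in> A \<Longrightarrow> \<phi> (\<lambda>x\<in>topspace X. c * f x) = c * \<phi> f"
    and "f \<in> A \<Longrightarrow> g \<in> A \<Longrightarrow> \<phi> (\<lambda>x\<in>topspace X. f x * g x) = \<phi> f * \<phi> g"
    and "\<exists>f\<in>A. \<phi> f \<noteq> 0"
  using assms unfolding multiplicative_functionals_def by auto

lemma functional_one: assumes \<phi>: "\<phi> \<in> \<Delta>" shows "\<phi> (\<lambda>x\<in>topspace X. 1) = 1"
proof -
  obtain f where f: "f \<in> A" "\<phi> f \<noteq> 0" using functionalD(5)[OF \<phi>] by auto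
  have "(\<lambda>x\<in>topspace X. f x * (\<lambda>x\<in>topspace X. 1) x) = f"
    using A_ext[OF f(1)] by (intro extensionalityI[of _ "topspace X"]) auto
  then have "\<phi> f = \<phi> f * \<phi> (\<lambda>x\<in>topspace X. 1)"
    using functionalD(4)[OF \<phi> f(1) eigenfunction_A[OF eigenfunction_one]] by simp
  then show ?thesis using f(2) by simp
qed

text \<open>If \<open>\<bar>\<phi> f\<bar>\<close> exceeded the bound, then \<open>h = f / \<phi> f\<close> would have supremum norm less than \<open>1\<close> and
  \<open>\<phi> h = 1\<close>.  The geometric series \<open>k = h + h\<^sup>2 + \<dots>\<close> lies in the algebra and satisfies
  \<open>k = h + h k\<close>, so that \<open>\<phi> k = 1 + \<phi> k\<close>.\<close>

proposition functional_contraction: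
  assumes \<phi>: "\<phi> \<in> \<Delta>" and f: "f \<in> A" and B: "\<And>x. x \<in> topspace X \<Longrightarrow> cmod (f x) \<le> B"
  shows "cmod (\<phi> f) \<le> B"
proof (rule ccontr)
  assume "\<not> cmod (\<phi> f) \<le> B"
  then have big: "B < cmod (\<phi> f)" by simp
  have "0 \<le> B" using B[OF x0] norm_ge_zero order_trans by blast
  then have "\<phi> f \<noteq> 0" using big by auto
  define q where "q = B / cmod (\<phi> f)"
  have q: "0 \<le> q" "q < 1"
    using \<open>0 \<le> B\<close> big \<open>\<phi> f \<noteq> 0\<close> by (simp_all add: q_def pos_divide_less_eq)
  define h where "h = (\<lambda>x\<in>topspace X. inverse (\<phi> f) * f x)"
  have hA: "h \<in> A" unfolding h_def using A_scale[OF f] .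
  have h1: "\<phi> h = 1" unfolding h_def using functionalD(3)[OF \<phi> f] \<open>\<phi> f \<noteq> 0\<close> by simp
  have hq: "cmod (h x) \<le> q" if "x \<in> topspace X" for x
    using mult_right_mono[OF B[OF that], of "inverse (cmod (\<phi> f))"] that
    by (simp add: h_def q_def norm_mult norm_inverse divide_inverse mult.commute)
  have h_ne: "1 - h x \<noteq> 0" if "x \<in> topspace X" for x using hq[OF that] q by auto
  define k where "k = (\<lambda>x\<in>topspace X. h x / (1 - h x))"
  have hC: "continuous_map X euclidean h" using hA A_CX by (auto simp: CX_def)
  have kC: "k \<in> CX"
    unfolding k_def using hC h_ne
    by (intro CX_restrict) (simp add: continuous_map_atin tendsto_divide tendsto_diff)
  have k: "k x = h x + h x * k x" if "x \<in> topspace X" for x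
    using h_ne[OF that] that by (simp add: k_def field_simps)
  have kb: "cmod (k x) \<le> q / (1 - q)" if "x \<in> topspace X" for x
  proof -
    have "1 - q \<le> cmod (1 - h x)" using hq[OF that] norm_triangle_ineq2[of 1 "h x"] by simp
    then show ?thesis using that q hq[OF that] by (simp add: k_def norm_divide frac_le)
  qed
  \<comment> \<open>The partial sums of the geometric series; \<open>s \<mapsto> h + h s\<close> contracts the distance to \<open>k\<close> by \<open>q\<close>.\<close>
  have approx: "\<exists>s\<in>A. \<forall>x\<in>topspace X. cmod (k x - s x) \<le> q ^ n * (q / (1 - q))" for n
  proof (induction n)
    case 0
    show ?case using kb A_zero by (intro bexI[of _ "\<lambda>x\<in>topspace X. 0"]) auto
  next
    case (Suc n)
    then obtain s where s: "s \<in> A" "\<And>x. x \<in> topspace X \<Longrightarrow> cmod (k x - s x) \<le> q ^ n * (q / (1 - q))" by auto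
    let ?s = "\<lambda>x\<in>topspace X. h x + (\<lambda>x\<in>topspace X. h x * s x) x"
    have "?s \<in> A" using hA s(1) by (intro A_add A_mult)
    moreover have "cmod (k x - ?s x) \<le> q ^ Suc n * (q / (1 - q))" if x: "x \<in> topspace X" for x
    proof -
      have "k x - ?s x = h x * (k x - s x)" using k[OF x] x by (simp add: algebra_simps)
      then have "cmod (k x - ?s x) = cmod (h x) * cmod (k x - s x)" by (simp add: norm_mult)
      also have "\<dots> \<le> q * (q ^ n * (q / (1 - q)))" using hq[OF x] s(2)[OF x] q by (intro mult_mono) auto
      finally show ?thesis by simp
    qed
    ultimately show ?case by blast
  qed
  have kA: "k \<in> A"
  proof (rule A_closed[OF kC])
    fix e :: real assume "e > 0"
    have "(\<lambda>n. q ^ n * (q / (1 - q))) \<longlonglongrightarrow> 0 * (q / (1 - q))"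
      using q by (intro tendsto_mult LIMSEQ_power_zero tendsto_const) simp
    then have "\<forall>\<^sub>F n in sequentially. q ^ n * (q / (1 - q)) < e"
      using \<open>e > 0\<close> by (intro order_tendstoD) auto
    then obtain n where n: "q ^ n * (q / (1 - q)) < e" by (auto dest: eventually_happens)
    obtain s where "s \<in> A" "\<forall>x\<in>topspace X. cmod (k x - s x) \<le> q ^ n * (q / (1 - q))" using approx by blast
    then show "\<exists>s\<in>A. \<forall>x\<in>topspace X. cmod (k x - s x) < e" using n by (intro bexI[of _ s]) (auto intro: le_less_trans)
  qed
  have hk: "(\<lambda>x\<in>topspace X. h x * k x) \<in> A" using hA kA by (rule A_mult)
  have "k = (\<lambda>x\<in>topspace X. h x + (\<lambda>x\<in>topspace X. h x * k x) x)"
    using A_ext[OF kA] k by (intro extensionalityI[of _ "topspace X"]) auto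
  then have "\<phi> k = \<phi> h + \<phi> h * \<phi> k"
    using functionalD(2)[OF \<phi> hA hk] functionalD(4)[OF \<phi> hA kA] by simp
  then show False using h1 by simp
qed

text \<open>Functionals are contractions, so the set on which two of them agree is a closed subalgebra.\<close>

lemma functional_eqI:
  assumes \<phi>: "\<phi> \<in> \<Delta>" and \<psi>: "\<psi> \<in> \<Delta>" and eq: "\<And>\<gamma>. \<gamma> \<in> E \<Longrightarrow> \<phi> (normalised \<gamma>) = \<psi> (normalised \<gamma>)"
  shows "\<phi> = \<psi>"
proof -
  define S where "S = {f \<in> A. \<phi> f = \<psi> f}"
  have diff: "cmod (\<theta> f - \<theta> g) \<le> e"
    if \<theta>: "\<theta> \<in> \<Delta>" and fg: "f \<in> A" "g \<in> A" and e: "\<And>x. x \<in> topspace X \<Longrightarrow> cmod (f x - g x) < e" for \<theta> f g e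
  proof -
    let ?g = "\<lambda>x\<in>topspace X. (-1) * g x"
    have gA: "?g \<in> A" using A_scale[OF fg(2)] .
    have "cmod (\<theta> (\<lambda>x\<in>topspace X. f x + ?g x)) \<le> e"
      using A_add[OF fg(1) gA] e by (intro functional_contraction[OF \<theta>]) (auto simp: less_imp_le)
    then show ?thesis using functionalD(2)[OF \<theta> fg(1) gA] functionalD(3)[OF \<theta> fg(2), of "-1"] by simp
  qed
  have "closed_subalgebra X S"
    unfolding closed_subalgebra_iff
  proof (intro conjI ballI allI impI)
    show "S \<subseteq> CX" using A_CX by (auto simp: S_def)
    fix f assume f: "f \<in> CX" and lim: "\<forall>e>0. \<exists>g\<in>S. \<forall>x\<in>topspace X. cmod (f x - g x) < e"
    have fA: "f \<in> A"
      by (rule A_closed[OF f]) (use lim in \<open>auto simp: S_def\<close>)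
    have "cmod (\<phi> f - \<psi> f) \<le> 0 + e" if "e > 0" for e
    proof -
      have "e / 2 > 0" using that by simp
      then obtain g where g: "g \<in> S" "\<forall>x\<in>topspace X. cmod (f x - g x) < e / 2" using lim by blast
      have "cmod (\<phi> f - \<phi> g) \<le> e / 2" "cmod (\<psi> f - \<psi> g) \<le> e / 2"
        using diff[OF \<phi> fA, of g "e / 2"] diff[OF \<psi> fA, of g "e / 2"] g by (auto simp: S_def)
      moreover have "\<phi> f - \<psi> f = (\<phi> f - \<phi> g) - (\<psi> f - \<psi> g)" using g(1) by (simp add: S_def)
      then have "cmod (\<phi> f - \<psi> f) \<le> cmod (\<phi> f - \<phi> g) + cmod (\<psi> f - \<psi> g)" by (metis norm_triangle_ineq4)
      ultimately show ?thesis by linarith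
    qed
    then have "cmod (\<phi> f - \<psi> f) \<le> 0" by (rule field_le_epsilon)
    then show "f \<in> S" using fA by (simp add: S_def)
  next
    have "(\<lambda>x\<in>topspace X. 0 * (\<lambda>x\<in>topspace X. 0 :: complex) x) = (\<lambda>x\<in>topspace X. 0)" by (auto intro!: restrict_ext)
    then have "\<phi> (\<lambda>x\<in>topspace X. 0) = 0" "\<psi> (\<lambda>x\<in>topspace X. 0) = 0"
      using functionalD(3)[OF \<phi> A_zero, of 0] functionalD(3)[OF \<psi> A_zero, of 0] by simp_all
    then show "(\<lambda>x\<in>topspace X. 0) \<in> S" using A_zero by (simp add: S_def)
  next
    fix f g assume "f \<in> S" "g \<in> S"
    then show "(\<lambda>x\<in>topspace X. f x + g x) \<in> S" "(\<lambda>x\<in>topspace X. f x * g x) \<in> S"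
      by (simp_all add: S_def A_add A_mult functionalD(2,4)[OF \<phi>] functionalD(2,4)[OF \<psi>])
  next
    fix c f assume "f \<in> S"
    then show "(\<lambda>x\<in>topspace X. c * f x) \<in> S"
      by (simp add: S_def A_scale functionalD(3)[OF \<phi>] functionalD(3)[OF \<psi>])
  qed
  moreover have "f \<in> S" if f: "eigenfunction \<gamma> f" for \<gamma> f
  proof -
    have \<gamma>: "\<gamma> \<in> E" using f by (auto simp: continuous_eigenvalues_def)
    have n: "normalised \<gamma> \<in> A" using eigenfunction_A[OF normalised(1)[OF \<gamma>]] .
    have "\<phi> f = \<psi> f"
      using functionalD(3)[OF \<phi> n, of "f x0"] functionalD(3)[OF \<psi> n, of "f x0"] eq[OF \<gamma>]
        eigenfunction_eq_scale[OF f] by simp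
    then show ?thesis using eigenfunction_A[OF f] by (simp add: S_def)
  qed
  ultimately have "A \<subseteq> S" by (rule eigen_algebra_least)
  then show ?thesis
    using functionalD(1)[OF \<phi>] functionalD(1)[OF \<psi>] by (intro extensionalityI[of _ A]) (auto simp: S_def)
qed

definition evaluation :: "'c \<Rightarrow> ('c \<Rightarrow> complex) \<Rightarrow> complex" where
  "evaluation x = (\<lambda>f\<in>A. f x)"

lemma evaluation_functional: assumes x: "x \<in> topspace X" shows "evaluation x \<in> \<Delta>"
proof -
  have "\<exists>f\<in>A. f x \<noteq> 0" 
    using eigenfunction_A[OF eigenfunction_one] x by (intro bexI[of _ "\<lambda>x\<in>topspace X. 1"]) simp_all
  then show ?thesis
    using x A_add A_mult A_scale by (auto simp: multiplicative_functionals_def evaluation_def)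
qed

definition spectrum_factor :: "(('c \<Rightarrow> complex) \<Rightarrow> complex) \<Rightarrow> ('a \<Rightarrow> complex) \<Rightarrow> complex" where
  "spectrum_factor \<phi> = (\<lambda>\<gamma>\<in>E. \<phi> (normalised \<gamma>))"

lemma normalised_A: "\<gamma> \<in> E \<Longrightarrow> normalised \<gamma> \<in> A"
  using eigenfunction_A[OF normalised(1)] .

text \<open>Both \<open>\<phi> f\<close> and \<open>\<phi> (cnj f)\<close> have modulus at most \<open>1\<close> for a normalised eigenfunction
  \<open>f\<close>, and their product is \<open>\<phi> 1 = 1\<close>.\<close>

lemma spectrum_factor_dual: assumes \<phi>: "\<phi> \<in> \<Delta>" shows "spectrum_factor \<phi> \<in> chars.dual"
proof -
  have le: "cmod (\<phi> (normalised \<gamma>)) \<le> 1" if "\<gamma> \<in> E" for \<gamma>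
    using normalised_norm[OF that] by (intro functional_contraction[OF \<phi> normalised_A[OF that]]) auto
  have mult: "\<phi> (normalised (\<lambda>t\<in>carrier G. \<gamma> t * \<delta> t)) = \<phi> (normalised \<gamma>) * \<phi> (normalised \<delta>)"
    if "\<gamma> \<in> E" "\<delta> \<in> E" for \<gamma> \<delta>
    unfolding normalised_mult[OF that] using functionalD(4)[OF \<phi>] normalised_A that by blast
  have "cmod (\<phi> (normalised \<gamma>)) = 1" if \<gamma>: "\<gamma> \<in> E" for \<gamma>
  proof -
    let ?c = "\<lambda>t\<in>carrier G. cnj (\<gamma> t)"
    have "(\<lambda>t\<in>carrier G. \<gamma> t * ?c t) = (\<lambda>t\<in>carrier G. 1)"
      using chars.char_props(1)[OF \<gamma>] by (auto simp: cmod_1_cnj_mult intro!: restrict_ext)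
    then have "\<phi> (normalised \<gamma>) * \<phi> (normalised ?c) = 1"
      using mult[OF \<gamma> chars.E_cnj[OF \<gamma>]] normalised_one functional_one[OF \<phi>] by simp
    then have "cmod (\<phi> (normalised \<gamma>)) * cmod (\<phi> (normalised ?c)) = 1" by (metis norm_mult norm_one)
    moreover have "cmod (\<phi> (normalised \<gamma>)) * cmod (\<phi> (normalised ?c)) \<le> cmod (\<phi> (normalised \<gamma>)) * 1"
      by (rule mult_left_mono[OF le[OF chars.E_cnj[OF \<gamma>]]]) simp
    ultimately show ?thesis using le[OF \<gamma>] by linarith
  qed
  then show ?thesis using mult by (auto simp: chars.dual_def spectrum_factor_def chars.E_mult)
qed

lemma spectrum_factor_evaluation: "spectrum_factor (evaluation x) = factor x"
  by (auto simp: spectrum_factor_def evaluation_def factor_def normalised_A intro!: restrict_ext)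

lemma inj_spectrum_factor: "inj_on spectrum_factor \<Delta>"
proof (rule inj_onI)
  fix \<phi> \<psi> assume \<phi>\<psi>: "\<phi> \<in> \<Delta>" "\<psi> \<in> \<Delta>" and eq: "spectrum_factor \<phi> = spectrum_factor \<psi>"
  show "\<phi> = \<psi>"
  proof (rule functional_eqI[OF \<phi>\<psi>])
    show "\<phi> (normalised \<gamma>) = \<psi> (normalised \<gamma>)" if "\<gamma> \<in> E" for \<gamma>
      using fun_cong[OF eq, of \<gamma>] that by (simp add: spectrum_factor_def)
  qed
qed

lemma topspace_XA: "topspace XA = \<Delta>"
  unfolding eigen_spectrum_def gelfand_spectrum_def
  by (auto simp: multiplicative_functionals_def PiE_UNIV_domain extensional_def)

text \<open>The factor map is onto, so some evaluation has the same image in the dual group as \<open>\<phi>\<close>, and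
  this image determines a functional.\<close>

proposition functional_is_evaluation: "\<Delta> = evaluation ` topspace X"
proof (intro antisym subsetI)
  fix \<phi> assume \<phi>: "\<phi> \<in> \<Delta>"
  then obtain x where x: "x \<in> topspace X" "spectrum_factor \<phi> = factor x"
    using spectrum_factor_dual[OF \<phi>] factor_surj by auto
  then have "\<phi> = evaluation x"
    using inj_onD[OF inj_spectrum_factor _ \<phi> evaluation_functional[OF x(1)]] spectrum_factor_evaluation by simp
  then show "\<phi> \<in> evaluation ` topspace X" using x(1) by auto
qed (auto simp: evaluation_functional)

lemma continuous_evaluation: "continuous_map X XA evaluation"
proof -
  have "continuous_map X (product_topology (\<lambda>_. euclidean) A) evaluation"
    unfolding continuous_map_componentwise
  proof (intro conjI ballI)
    show "evaluation ` topspace X \<subseteq> extensional A" by (auto simp: evaluation_def)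
    show "continuous_map X euclidean (\<lambda>x. evaluation x f)" if "f \<in> A" for f
      using that A_CX by (auto simp: evaluation_def CX_def)
  qed
  then show ?thesis
    unfolding eigen_spectrum_def gelfand_spectrum_def continuous_map_in_subtopology
    using evaluation_functional by auto
qed

lemma actA_apply:
  assumes "\<phi> \<in> \<Delta>" "f \<in> A" shows "actA t \<phi> f = \<phi> (\<lambda>x\<in>topspace X. f (act t x))"
  using assms by (simp add: eigen_spectrum_action_def topspace_XA)

lemma actA_evaluation:
  assumes t: "t \<in> carrier G" and x: "x \<in> topspace X" shows "actA t (evaluation x) = evaluation (act t x)"
proof (rule extensionalityI[of _ A])
  show "actA t (evaluation x) \<in> extensional A"
    using evaluation_functional[OF x] by (simp add: eigen_spectrum_action_def topspace_XA)
  show "evaluation (act t x) \<in> extensional A" by (simp add: evaluation_def)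
  show "actA t (evaluation x) f = evaluation (act t x) f" if "f \<in> A" for f
    using actA_apply[OF evaluation_functional[OF x] that] A_act[OF t that] that x by (simp add: evaluation_def)
qed

lemma actA_closed: "t \<in> carrier G \<Longrightarrow> \<phi> \<in> topspace XA \<Longrightarrow> actA t \<phi> \<in> topspace XA"
  by (auto simp: topspace_XA functional_is_evaluation actA_evaluation act_closed)

lemma conjugacy_spectrum: "conjugacy G XA actA (top_of_set chars.dual) chars.translate spectrum_factor"
  unfolding conjugacy_def
proof (intro conjI ballI)
  show "homeomorphic_map XA (top_of_set chars.dual) spectrum_factor"
  proof (rule continuous_imp_homeomorphic_map)
    have "continuous_map XA (product_topology (\<lambda>_. euclidean) UNIV) spectrum_factor"
      unfolding continuous_map_componentwise_UNIV
    proof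
      fix \<gamma>
      show "continuous_map XA euclidean (\<lambda>\<phi>. spectrum_factor \<phi> \<gamma>)"
      proof (cases "\<gamma> \<in> E")
        case True
        have "continuous_map XA euclidean (\<lambda>\<phi>. \<phi> (normalised \<gamma>))"
          unfolding eigen_spectrum_def gelfand_spectrum_def
          by (intro continuous_map_from_subtopology continuous_map_product_projection normalised_A True)
        then show ?thesis using True by (simp add: spectrum_factor_def)
      qed (simp add: spectrum_factor_def)
    qed
    then show "continuous_map XA (top_of_set chars.dual) spectrum_factor"
      using spectrum_factor_dual topspace_XA by (auto simp: continuous_map_in_subtopology euclidean_product_topology)
    show "compact_space XA"
      using image_compactin[OF _ continuous_evaluation, of "topspace X"] compact
      by (simp add: compact_space_def topspace_XA functional_is_evaluation)
    show "Hausdorff_space (top_of_set chars.dual)" by (rule Hausdorff_space_top_of_set)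
    show "spectrum_factor ` topspace XA = topspace (top_of_set chars.dual)"
      using factor_surj by (simp add: topspace_XA functional_is_evaluation image_image spectrum_factor_evaluation)
    show "inj_on spectrum_factor (topspace XA)" using inj_spectrum_factor topspace_XA by simp
  qed
  fix t \<phi> assume t: "t \<in> carrier G" and "\<phi> \<in> topspace XA"
  then obtain x where x: "x \<in> topspace X" "\<phi> = evaluation x" by (auto simp: topspace_XA functional_is_evaluation)
  then show "spectrum_factor (actA t \<phi>) = chars.translate t (spectrum_factor \<phi>)"
    using t by (simp add: actA_evaluation spectrum_factor_evaluation factor_act)
qed

end

section \<open>The three conjugate systems\<close>

context pointed_minimal_system
begin

lemma conjugacy_dual_spectrum:
  obtains g where "conjugacy G (top_of_set chars.dual) chars.translate XA actA g"
    "\<And>\<phi>. \<phi> \<in> topspace XA \<Longrightarrow> g (spectrum_factor \<phi>) = \<phi>"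
  using conjugacy_inverse[OF conjugacy_spectrum actA_closed] by metis

lemma conjugacy_dual_quotient:
  obtains g where "conjugacy G (top_of_set chars.dual) chars.translate XS actS g"
  using conjugacy_inverse[OF conjugacy_quotient actS_closed] by metis

proposition conjugacy_quotient_spectrum:
  "\<exists>h. conjugacy G XS actS XA actA h \<and> (\<forall>x\<in>topspace X. \<forall>f\<in>A. h (r `` {x}) f = f x)"
proof -
  obtain g where g: "conjugacy G (top_of_set chars.dual) chars.translate XA actA g"
    "\<And>\<phi>. \<phi> \<in> topspace XA \<Longrightarrow> g (spectrum_factor \<phi>) = \<phi>"
    using conjugacy_dual_spectrum by metis
  have "(g \<circ> class_factor) (r `` {x}) f = f x" if x: "x \<in> topspace X" and f: "f \<in> A" for x f
  proof -
    have "g (factor x) = evaluation x"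
      using g(2)[of "evaluation x"] evaluation_functional[OF x] by (simp add: topspace_XA spectrum_factor_evaluation)
    then show ?thesis using f by (simp add: class_factor[OF x] evaluation_def)
  qed
  then show ?thesis using conjugacy_compose[OF conjugacy_quotient g(1)] by blast
qed

proposition conjugacy_spectrum_dual:
  "\<exists>h. conjugacy G XA actA (top_of_set chars.dual) chars.translate h \<and>
     (\<forall>\<phi>\<in>topspace XA. \<forall>\<gamma>\<in>E. \<forall>f. eigenfunction \<gamma> f \<and> f x0 = 1 \<longrightarrow> h \<phi> \<gamma> = \<phi> f)"
proof -
  have "spectrum_factor \<phi> \<gamma> = \<phi> f" if "\<gamma> \<in> E" "eigenfunction \<gamma> f" "f x0 = 1" for \<phi> \<gamma> f
    using normalised_eq[OF that(2,3)] that(1) by (simp add: spectrum_factor_def)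
  then show ?thesis using conjugacy_spectrum by blast
qed

proposition conjugacy_quotient_dual:
  "\<exists>h. conjugacy G XS actS (top_of_set chars.dual) chars.translate h \<and>
     (\<forall>x\<in>topspace X. \<forall>\<gamma>\<in>E. \<forall>f. eigenfunction \<gamma> f \<and> f x0 = 1 \<longrightarrow> h (r `` {x}) \<gamma> = f x)"
proof -
  have "class_factor (r `` {x}) \<gamma> = f x" if "x \<in> topspace X" "\<gamma> \<in> E" "eigenfunction \<gamma> f" "f x0 = 1" for x \<gamma> f
    using normalised_eq[OF that(3,4)] that(2) by (simp add: class_factor[OF that(1)] factor_def)
  then show ?thesis using conjugacy_quotient by blast
qed

text \<open>The dual group has the three dynamical properties, and they pass along the conjugacy.\<close>

lemma conjugate_of_dual:
  assumes c: "conjugacy G (top_of_set chars.dual) chars.translate Y actY h"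
    and ext: "\<And>t. t \<in> carrier G \<Longrightarrow> actY t \<in> extensional (topspace Y)"
  shows "minimal_system G T Y actY" and "uniquely_ergodic G Y actY"
    and "invariant_probability G Y actY m \<Longrightarrow> pure_point_spectrum G T actY m"
proof -
  have D: "dynamical_system G T (top_of_set chars.dual) chars.translate"
    using chars.minimal_dual by (simp add: minimal_system_def)
  show Y: "minimal_system G T Y actY" by (rule minimal_system_conjugate[OF chars.minimal_dual c ext])
  then have Y': "dynamical_system G T Y actY" by (simp add: minimal_system_def)
  show "uniquely_ergodic G Y actY" by (rule uniquely_ergodic_conjugate[OF D Y' c chars.uniquely_ergodic_dual])
  show "pure_point_spectrum G T actY m" if "invariant_probability G Y actY m"
    by (rule pure_point_spectrum_conjugate[OF D Y' c chars.pure_point_spectrum_dual that])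
qed

lemma actA_extensional: "actA t \<in> extensional (topspace XA)"
  by (simp add: eigen_spectrum_action_def)

lemma actS_extensional: "actS t \<in> extensional (topspace XS)"
  by (simp add: eigen_quotient_action_def)

end

theorem theorem3p10:
  fixes G :: "('g, 'm) monoid_scheme" and T :: "'g topology"
    and X :: "'x topology" and act :: "'g \<Rightarrow> 'x \<Rightarrow> 'x"
  assumes "topological_comm_group G T"
    and "Hausdorff_space T" and "locally_compact_space T" and "sigma_compact_space T"
    and "minimal_system G T X act"
  defines "E \<equiv> continuous_eigenvalues G T X act"
    and "A \<equiv> eigen_algebra G T X act"
    and "r \<equiv> eigen_rel G T X act"
    and "XA \<equiv> eigen_spectrum G T X act" and "actA \<equiv> eigen_spectrum_action G T X act"
    and "TE \<equiv> eigenvalue_dual G T X act" and "actE \<equiv> eigenvalue_dual_action G T X act"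
    and "XS \<equiv> eigen_quotient G T X act" and "actS \<equiv> eigen_quotient_action G T X act"
  shows
    "(\<exists>h. conjugacy G XS actS XA actA h \<and>
        (\<forall>x\<in>topspace X. \<forall>f\<in>A. h (r `` {x}) f = f x)) \<and>
     (\<forall>x0\<in>topspace X.
        (\<exists>h. conjugacy G XA actA TE actE h \<and>
           (\<forall>\<phi>\<in>topspace XA. \<forall>\<gamma>\<in>E. \<forall>f.
              continuous_eigenfunction G T X act \<gamma> f \<and> f x0 = 1 \<longrightarrow> h \<phi> \<gamma> = \<phi> f)) \<and>
        (\<exists>h. conjugacy G XS actS TE actE h \<and>
           (\<forall>x\<in>topspace X. \<forall>\<gamma>\<in>E. \<forall>f.
              continuous_eigenfunction G T X act \<gamma> f \<and> f x0 = 1 \<longrightarrow> h (r `` {x}) \<gamma> = f x))) \<and>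
     minimal_system G T XA actA \<and> minimal_system G T TE actE \<and> minimal_system G T XS actS \<and>
     uniquely_ergodic G XA actA \<and> uniquely_ergodic G TE actE \<and> uniquely_ergodic G XS actS \<and>
     (\<forall>m. invariant_probability G XA actA m \<longrightarrow> pure_point_spectrum G T actA m) \<and>
     (\<forall>m. invariant_probability G TE actE m \<longrightarrow> pure_point_spectrum G T actE m) \<and>
     (\<forall>m. invariant_probability G XS actS m \<longrightarrow> pure_point_spectrum G T actS m)"
proof -
  interpret S: minimal_system G T X act by fact
  have pointed: "pointed_minimal_system G T X act x0" if "x0 \<in> topspace X" for x0
    by unfold_locales (rule that)
  have TE: "TE = top_of_set S.chars.dual" "actE = S.chars.translate"
    unfolding TE_def actE_def by (rule S.eigenvalue_dual_eq, rule S.eigenvalue_dual_action_eq)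
  obtain x where x: "x \<in> topspace X" using S.nonempty by blast
  interpret P: pointed_minimal_system G T X act x by (rule pointed[OF x])
  obtain g where g: "conjugacy G (top_of_set S.chars.dual) S.chars.translate XA actA g"
    unfolding XA_def actA_def using P.conjugacy_dual_spectrum by metis
  obtain k where k: "conjugacy G (top_of_set S.chars.dual) S.chars.translate XS actS k"
    unfolding XS_def actS_def using P.conjugacy_dual_quotient by metis
  note XA = P.conjugate_of_dual[OF g, folded XA_def actA_def, OF P.actA_extensional[folded XA_def actA_def]]
  note XS = P.conjugate_of_dual[OF k, folded XS_def actS_def, OF P.actS_extensional[folded XS_def actS_def]]
  have conj: "(\<exists>h. conjugacy G XA actA TE actE h \<and>
           (\<forall>\<phi>\<in>topspace XA. \<forall>\<gamma>\<in>E. \<forall>f.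
              continuous_eigenfunction G T X act \<gamma> f \<and> f x0 = 1 \<longrightarrow> h \<phi> \<gamma> = \<phi> f)) \<and>
        (\<exists>h. conjugacy G XS actS TE actE h \<and>
           (\<forall>x\<in>topspace X. \<forall>\<gamma>\<in>E. \<forall>f.
              continuous_eigenfunction G T X act \<gamma> f \<and> f x0 = 1 \<longrightarrow> h (r `` {x}) \<gamma> = f x))"
    if "x0 \<in> topspace X" for x0
    unfolding TE unfolding XA_def actA_def XS_def actS_def E_def r_def
    using pointed_minimal_system.conjugacy_spectrum_dual[OF pointed[OF that]]
      pointed_minimal_system.conjugacy_quotient_dual[OF pointed[OF that]] by (rule conjI)
  have canon: "\<exists>h. conjugacy G XS actS XA actA h \<and> (\<forall>x\<in>topspace X. \<forall>f\<in>A. h (r `` {x}) f = f x)"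
    unfolding XA_def actA_def XS_def actS_def A_def r_def by (rule P.conjugacy_quotient_spectrum)
  show ?thesis
    by (intro conjI ballI allI impI canon conj XA XS)
      (simp_all add: TE S.chars.minimal_dual S.chars.uniquely_ergodic_dual S.chars.pure_point_spectrum_dual)
qed

end
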